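(* Let $d\ge1$, $\alpha>1$, $M>2$ and $R>\|\mathrm{Id}\|_{C^\alpha(\tilde\Omega)}$. There exist constants $c>0$ and $n_0$, depending only on $d,\alpha,M,R$, such that for all $n\ge n_0$ and $\epsilon>0$ with $n\epsilon\ge n_0$, $$\inf_{\hat T_{\mathrm{priv}}}\ \sup_{P\in\mathcal M,\ T_0\in\mathcal T_\alpha(R)}\mathbb E\left(\int\|T_0-\hat T_{\mathrm{priv}}\|^2\,dP\right)\ \ge\ c\,\max\left\{\frac1n,\ n^{-\frac{2\alpha}{2\alpha-2+d}},\ (n\epsilon)^{-\frac{2\alpha}{\alpha-1+d}}\right\},$$ where the infimum is over all $\epsilon$-differentially private estimators $\hat T_{\mathrm{priv}}$ of $T_0$ based on $(X_{1:n},Y_{1:n})$, and the expectation is over the data ($X_1,\dots,X_n$ i.i.d. from $P$ and $Y_1,\dots,Y_n$ i.i.d. from $Q=(T_0)_\#P$, all mutually independent) and the randomness of the estimator.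
   Context: Let $\Omega=[0,1]^d$ and $\tilde\Omega=[-1,2]^d$. Hölder norm: for $T:\tilde\Omega\to\mathbb R^d$ with components $T_i$, $\|T\|_{C^\alpha(\tilde\Omega)}=\sum_{i=1}^d\Big(\sum_{|b|\le\alpha}\|\partial^bT_i\|_\infty+\sum_{|b|=\lfloor\alpha\rfloor}\sup_{x\ne y\in\tilde\Omega}\frac{|\partial^bT_i(x)-\partial^bT_i(y)|}{|x-y|^{\alpha-\lfloor\alpha\rfloor}}\Big)$ ($b$ multi-indices). $\mathcal M$ is the set of probability measures $P$ on $\mathbb R^d$ supported on $\Omega$, absolutely continuous with respect to Lebesgue measure, with density $\rho_P$ satisfying $1/M\le\rho_P\le M$ a.e. on $\Omega$. Given $P$, $\mathcal T$ is the set of differentiable maps $T:\tilde\Omega\to\mathbb R^d$ such that $T=\nabla f$ for some differentiable convex $f:\tilde\Omega\to\mathbb R$, with $\|T(x)\|\le M$ and $\frac1M I_d\preceq\nabla^2f(x)\preceq M I_d$ for all $x\in\tilde\Omega$, and $(T_{\#}P)(\Omega)=1$. $\mathcal T_\alpha(R)$ is the set of $T\in\mathcal T$ that are $\lfloor\alpha\rfloor$ times differentiable with $\|T\|_{C^\alpha(\tilde\Omega)}\le R$. Differential privacy: two datasets $(X_{1:n},Y_{1:n})$ and $(X'_{1:n},Y'_{1:n})$ with entries in $\Omega$ are neighboring if their Hamming distance is at most $1$, i.e. they differ in at most one of the $2n$ entries. A randomized mechanism (conditional probability kernel) $\mathsf A$ is $\epsilon$-differentially private if for all neighboring $D,D'$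 and all measurable sets $S$ of outputs, $\mathbb P(\mathsf A(D)\in S)\le e^\epsilon\,\mathbb P(\mathsf A(D')\in S)$. An estimator is a (possibly randomized) measurable function of the dataset with values in maps from $\Omega$ to $\mathbb R^d$.
   Formalization: The bound ‖T(x)‖ ≤ M in the class of transport maps is taken in the maximum norm; with the Euclidean norm the class is empty when 2M² < 3√d (e.g. M = 2.1, d = 100), and the claim fails. The loss and the Hölder quotients use the Euclidean norm. *)

theory Defs
  imports "HOL-Probability.Probability"
begin

definition Omega :: "(real ^ 'd) set"
  where "Omega = cbox (vec 0) (vec 1)"

definition Omega_tilde :: "(real ^ 'd) set"
  where "Omega_tilde = cbox (vec (- 1)) (vec 2)"


subsection \<open>Derivatives and the Hoelder norm on the enlarged cube\<close>

text \<open>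
  Maps on the closed cube are represented by total functions whose values outside the cube are
  irrelevant; all derivatives are therefore taken within the cube (one-sided on its faces).
\<close>

definition partial :: "'d \<Rightarrow> (real ^ 'd \<Rightarrow> real) \<Rightarrow> real ^ 'd \<Rightarrow> real"
  where "partial i f x =
    vector_derivative (\<lambda>s. f (x + s *\<^sub>R axis i 1))
      (at 0 within {s. x + s *\<^sub>R axis i 1 \<in> Omega_tilde})"

primrec times_differentiable :: "nat \<Rightarrow> (real ^ 'd \<Rightarrow> real) \<Rightarrow> bool"
  where
    "times_differentiable 0 f = True"
  | "times_differentiable (Suc k) f =
      (f differentiable_on Omega_tilde \<and> (\<forall>i. times_differentiable k (partial i f)))"

text \<open>
  The derivative for a multi-index \<open>b\<close>. The coordinate type carries no order, so an arbitrary list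
  containing each coordinate \<open>i\<close> exactly \<open>b i\<close> times fixes the order of differentiation. For
  functions that are \<open>\<bar>b\<bar>\<close> times differentiable the order is immaterial (symmetry of second
  derivatives).
\<close>

definition multi_partial :: "('d \<Rightarrow> nat) \<Rightarrow> (real ^ 'd \<Rightarrow> real) \<Rightarrow> real ^ 'd \<Rightarrow> real"
  where "multi_partial b f = foldr partial (SOME xs. \<forall>i. count_list xs i = b i) f"

definition mi_order :: "('d::finite \<Rightarrow> nat) \<Rightarrow> nat"
  where "mi_order b = (\<Sum>j\<in>UNIV. b j)"

text \<open>
  Extended-valued, so that an unbounded derivative makes the norm infinite. For integer \<open>\<alpha>\<close> the
  Hoelder exponent is 0 and \<open>norm (x - y) powr 0 = 1\<close> for \<open>x \<noteq> y\<close>.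
\<close>

definition holder_norm :: "real \<Rightarrow> (real ^ 'd \<Rightarrow> real ^ 'd) \<Rightarrow> ennreal"
  where "holder_norm \<alpha> T =
    (\<Sum>i\<in>UNIV.
      (\<Sum>b | real (mi_order b) \<le> \<alpha>.
        SUP x\<in>Omega_tilde. ennreal \<bar>multi_partial b (\<lambda>z. T z $ i) x\<bar>) +
      (\<Sum>b | int (mi_order b) = \<lfloor>\<alpha>\<rfloor>.
        SUP (x, y)\<in>{(x, y). x \<in> Omega_tilde \<and> y \<in> Omega_tilde \<and> x \<noteq> y}.
          ennreal (\<bar>multi_partial b (\<lambda>z. T z $ i) x - multi_partial b (\<lambda>z. T z $ i) y\<bar>
            / norm (x - y) powr (\<alpha> - of_int \<lfloor>\<alpha>\<rfloor>))))"


subsection \<open>The classes of measures and of transport maps\<close>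

definition measure_class :: "real \<Rightarrow> (real ^ 'd) measure set"
  where "measure_class M =
    {P. prob_space P \<and> measure P Omega = 1 \<and>
        (\<exists>\<rho> :: real ^ 'd \<Rightarrow> real. \<rho> \<in> borel_measurable borel \<and>
           P = density lborel (\<lambda>x. ennreal (\<rho> x)) \<and>
           (AE x in lborel. x \<in> Omega \<longrightarrow> 1 / M \<le> \<rho> x \<and> \<rho> x \<le> M))}"

text \<open>
  The restriction discards the irrelevant (possibly non-measurable) part of \<open>T\<close> outside the
  enlarged cube; it is harmless because \<open>P\<close> is supported on \<open>Omega\<close>.
\<close>

definition pushforward :: "(real ^ 'd) measure \<Rightarrow> (real ^ 'd \<Rightarrow> real ^ 'd) \<Rightarrow> (real ^ 'd) measure"
  where "pushforward P T = distr (restrict_space P Omega_tilde) borel T"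

definition psd :: "real ^ 'd ^ 'd \<Rightarrow> bool"
  where "psd A \<longleftrightarrow> transpose A = A \<and> (\<forall>v. 0 \<le> v \<bullet> (A *v v))"

definition loewner_le :: "real ^ 'd ^ 'd \<Rightarrow> real ^ 'd ^ 'd \<Rightarrow> bool"
  where "loewner_le A B \<longleftrightarrow> psd (B - A)"

definition hessian :: "(real ^ 'd \<Rightarrow> real) \<Rightarrow> real ^ 'd \<Rightarrow> real ^ 'd ^ 'd"
  where "hessian f x = (\<chi> i j. partial i (partial j f) x)"

text \<open>
  The bound \<open>M\<close> on \<open>T x\<close> is in the maximum norm. This is the norm in which the identity is bounded
  by 2 on the cube \<open>[-1, 2]\<^sup>d\<close>, so that \<open>M > 2\<close> leaves room around the identity in every dimension.
  With the Euclidean norm, the condition on the Hessian would make the class empty as soon as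
  \<open>2 * M\<^sup>2 < 3 * sqrt d\<close>.
\<close>

definition transport_maps :: "real \<Rightarrow> (real ^ 'd) measure \<Rightarrow> (real ^ 'd \<Rightarrow> real ^ 'd) set"
  where "transport_maps M P =
    {T. T differentiable_on Omega_tilde \<and>
        (\<forall>x\<in>Omega_tilde. infnorm (T x) \<le> M) \<and>
        (\<exists>f :: real ^ 'd \<Rightarrow> real.
           convex_on Omega_tilde f \<and>
           (\<forall>x\<in>Omega_tilde. (f has_derivative (\<lambda>h. T x \<bullet> h)) (at x within Omega_tilde)) \<and>
           (\<forall>x\<in>Omega_tilde. loewner_le (mat (1 / M)) (hessian f x) \<and>
                            loewner_le (hessian f x) (mat M))) \<and>
        measure (pushforward P T) Omega = 1}"

definition smooth_transport_maps ::
    "real \<Rightarrow> real \<Rightarrow> real \<Rightarrow> (real ^ 'd) measure \<Rightarrow> (real ^ 'd \<Rightarrow> real ^ 'd) set"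
  where "smooth_transport_maps \<alpha> M R P =
    {T \<in> transport_maps M P.
       (\<forall>i. times_differentiable (nat \<lfloor>\<alpha>\<rfloor>) (\<lambda>x. T x $ i)) \<and> holder_norm \<alpha> T \<le> ennreal R}"


subsection \<open>Private estimators and their risk\<close>

type_synonym 'd dataset = "(nat \<Rightarrow> real ^ 'd) \<times> (nat \<Rightarrow> real ^ 'd)"

definition dataset_space :: "nat \<Rightarrow> 'd::finite dataset measure"
  where "dataset_space n =
    (\<Pi>\<^sub>M i\<in>{..<n}. restrict_space borel Omega) \<Otimes>\<^sub>M (\<Pi>\<^sub>M i\<in>{..<n}. restrict_space borel Omega)"

definition hamming :: "nat \<Rightarrow> 'd::finite dataset \<Rightarrow> 'd dataset \<Rightarrow> nat"
  where "hamming n D D' =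
    card {i. i < n \<and> fst D i \<noteq> fst D' i} + card {i. i < n \<and> snd D i \<noteq> snd D' i}"

definition sq_dist :: "(real ^ 'd) measure \<Rightarrow> (real ^ 'd \<Rightarrow> real ^ 'd) \<Rightarrow> (real ^ 'd \<Rightarrow> real ^ 'd) \<Rightarrow> ennreal"
  where "sq_dist P S T = (\<integral>\<^sup>+x\<in>Omega. ennreal ((norm (S x - T x))\<^sup>2) \<partial>P)"

text \<open>
  The output space of estimators: all Borel maps on \<open>Omega\<close>, with the sigma-algebra generated by the
  balls of \<open>L\<^sup>2(Omega)\<close>. By separability this is the Borel sigma-algebra on the square-integrable
  maps. A map that is not square-integrable has infinite loss. For an arbitrary measurable output
  space whose points are turned into maps by a jointly measurable evaluation, the induced function
  into this space is measurable by Tonelli's theorem, and privacy is preserved, so no such estimator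
  is excluded.
\<close>

definition map_space :: "(real ^ 'd \<Rightarrow> real ^ 'd) measure"
  where "map_space =
    sigma (borel_measurable (restrict_space borel Omega))
      {{T \<in> borel_measurable (restrict_space borel Omega). sq_dist lborel T g \<le> ennreal r} | g r.
         g \<in> borel_measurable (restrict_space borel Omega) \<and> sq_dist lborel g (\<lambda>_. 0) < \<infinity>}"

definition private_estimators ::
    "nat \<Rightarrow> real \<Rightarrow> ('d::finite dataset \<Rightarrow> (real ^ 'd \<Rightarrow> real ^ 'd) measure) set"
  where "private_estimators n \<epsilon> =
    {A. A \<in> dataset_space n \<rightarrow>\<^sub>M prob_algebra map_space \<and>
        (\<forall>D\<in>space (dataset_space n). \<forall>D'\<in>space (dataset_space n). hamming n D D' \<le> 1 \<longrightarrow>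
           (\<forall>S\<in>sets map_space. measure (A D) S \<le> exp \<epsilon> * measure (A D') S))}"

text \<open>
  Both sampling distributions give full mass to \<open>Omega\<close>; restricting them makes the data law live on
  the space on which estimators are defined.
\<close>

definition data_law ::
    "nat \<Rightarrow> (real ^ 'd) measure \<Rightarrow> (real ^ 'd \<Rightarrow> real ^ 'd) \<Rightarrow> 'd::finite dataset measure"
  where "data_law n P T =
    (\<Pi>\<^sub>M i\<in>{..<n}. restrict_space P Omega) \<Otimes>\<^sub>M
    (\<Pi>\<^sub>M i\<in>{..<n}. restrict_space (pushforward P T) Omega)"

definition risk ::
    "nat \<Rightarrow> ('d::finite dataset \<Rightarrow> (real ^ 'd \<Rightarrow> real ^ 'd) measure) \<Rightarrow>
     (real ^ 'd) measure \<Rightarrow> (real ^ 'd \<Rightarrow> real ^ 'd) \<Rightarrow> ennreal"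
  where "risk n A P T = (\<integral>\<^sup>+D. (\<integral>\<^sup>+S. sq_dist P T S \<partial>A D) \<partial>data_law n P T)"

end

theory Submission
  imports Defs
begin

text \<open>
  The lower bound is obtained from perturbations of the identity. Divide \<open>Omega\<close> into \<open>k\<^sup>d\<close> cells of
  side \<open>1/k\<close> and let \<open>T\<close> be the gradient of \<open>\<bar>x\<bar>\<^sup>2/2\<close> plus, for each cell in a set \<open>\<theta>\<close>, a rescaled
  smooth bump supported in that cell, so that \<open>T - id\<close> has size \<open>a\<close> and the Hoelder norm grows by
  \<open>O(a k\<^sup>\<alpha>)\<close>. Being a contractive perturbation of the identity that is trivial outside the open cube,
  \<open>T\<close> is a bijection of \<open>Omega\<close>. The source is taken to be the image of the uniform
  distribution under the inverse of \<open>T\<close>, so the target sample is always uniform and carries no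
  information. The density of the source lies within \<open>O(a k)\<close> of 1, and adding a cell to \<open>\<theta>\<close> changes it
  only on that cell. Hence neighbouring patterns cannot be told apart if \<open>n (a k)\<^sup>2 k\<^sup>-\<^sup>d\<close> is small (by the
  chi-square divergence), nor privately if \<open>n \<epsilon> (a k) k\<^sup>-\<^sup>d\<close> is small (replacing the observations
  one at a time, each moves an output probability by at most \<open>\<epsilon>\<close> times the total variation), and Assouad's
  argument gives the lower bound \<open>c a\<^sup>2\<close>. The three rates come from \<open>k = 1\<close> with \<open>a\<close> of order \<open>n\<^sup>-\<^sup>1\<^sup>/\<^sup>2\<close>, and from
  \<open>a\<close> of order \<open>k\<^sup>-\<^sup>\<alpha>\<close> with \<open>k\<close> the smallest scale satisfying one of the two conditions.
\<close>


subsection \<open>A polynomial bump\<close>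

text \<open>Formally the source density is the Jacobian determinant of \<open>tmap\<close>, a
  product of eigenvalues 1 + O(a k). No determinant is computed: only two-sided bounds are needed,
  and they follow from Lipschitz constants of the map and of its inverse. The maximum norm is chosen
  because its balls are cubes, so that an L-Lipschitz map enlarges volume by at most L^d. Any
  further constant would destroy the closeness to 1 on which both information bounds rest.

  The displacement must be a gradient, so each component is a product with one differentiated
  factor. The separation of the maps is read off where the profile and its derivative are both
  positive. Finitely many derivatives suffice, hence a polynomial profile.

  A displacement of order a on a fixed fraction of each of the k^d cells gives a loss of order a^2.
  With a of order k^-\<alpha> the two conditions become n <= k^(2\<alpha>-2+d) and n\<epsilon> <=
  k^(\<alpha>-1+d), up to constants; this is where the two exponents come from.\<close>

lemma pderiv_dvd_power:
  fixes p r :: "real poly"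
  assumes "r ^ Suc n dvd p"
  shows "r ^ n dvd pderiv p"
proof -
  obtain q where q: "p = r ^ Suc n * q" using assms by (elim dvdE)
  show ?thesis unfolding q
    unfolding pderiv_mult pderiv_power_Suc by (intro dvd_add dvd_mult2 dvd_smult dvd_mult dvd_refl) simp_all
qed

text \<open>Each differentiation lowers the order of vanishing at the roots of \<open>r\<close> by
  at most one. It is used for \<open>r\<close> = t(1-t), to keep the derivatives of the profile zero
  at both ends.\<close>

lemma higher_pderiv_dvd_power:
  fixes p r :: "real poly"
  assumes "r ^ (n + m) dvd p"
  shows "r ^ n dvd (pderiv ^^ m) p"
  using assms
proof (induction m arbitrary: n)
  case (Suc m)
  then have "r ^ Suc n dvd (pderiv ^^ m) p" by (intro Suc.IH) simp
  then show ?case using pderiv_dvd_power by simp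
qed simp

text \<open>Double zeros at 0 and 1 allow a differentiable gluing with 0. The derivative is again a
  cut-off polynomial, so the argument repeats for higher orders.\<close>

lemma has_real_derivative_cutoff:
  fixes q :: "real poly"
  assumes "poly q 0 = 0" "poly q 1 = 0" "poly (pderiv q) 0 = 0" "poly (pderiv q) 1 = 0"
  shows "((\<lambda>t. if t \<in> {0..1} then poly q t else 0) has_real_derivative
    (if t \<in> {0..1} then poly (pderiv q) t else 0)) (at t)"
proof -
  have "((\<lambda>t. if t \<in> {0..1} then poly q t else 0) has_derivative
    (if t \<in> {0..1} then (*) (poly (pderiv q) t) else (\<lambda>_. 0))) (at t within {0..1} \<union> - {0..1})"
  proof (rule has_derivative_If_within_closures[where f'="\<lambda>t. (*) (poly (pderiv q) t)" and g'="\<lambda>_ _. 0"])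
    show "t \<in> {0..1} \<union> (closure {0..1} \<inter> closure (- {0..1})) \<Longrightarrow>
      (poly q has_derivative (*) (poly (pderiv q) t)) (at t within {0..1} \<union> (closure {0..1} \<inter> closure (- {0..1})))"
      using poly_DERIV[of q t] unfolding has_field_derivative_def by (rule has_derivative_at_withinI)
    have fr: "closure {0..1} \<inter> closure (- {0..1::real}) = {0, 1}"
      by (auto simp: closure_complement)
    show "poly q x = 0" if "x \<in> closure {0..1}" "x \<in> closure (- {0..1})" for x
    proof -
      have "x = 0 \<or> x = 1" using fr that by blast
      then show ?thesis using assms by auto
    qed
    show "(*) (poly (pderiv q) x) = (\<lambda>_. 0)" if "x \<in> closure {0..1}" "x \<in> closure (- {0..1})" for x
    proof -
      have "x = 0 \<or> x = 1" using fr that by blast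
      then have "poly (pderiv q) x = 0" using assms by auto
      then show ?thesis by (simp add: fun_eq_iff)
    qed
  qed auto
  then show ?thesis
    unfolding Compl_partition has_field_derivative_def
    by (cases "t \<in> {0..1}") (simp_all only: if_True if_False, simp add: lambda_zero)
qed

text \<open>The profile is a power of t(1-t), cut off outside the unit interval. The window from 1/8
  to 3/8 lies left of the maximum at 1/2, where the profile and its derivative are both bounded away
  from 0; a component of the displacement contains factors of both kinds.\<close>

lemma bump_exists:
  fixes K :: nat
  obtains c :: "nat \<Rightarrow> real \<Rightarrow> real" and B \<beta> :: real
  where "\<And>m t. m < K \<Longrightarrow> (c m has_real_derivative c (Suc m) t) (at t)"
    and "\<And>m t. m \<le> K \<Longrightarrow> t \<notin> {0<..<1} \<Longrightarrow> c m t = 0"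
    and "\<And>m t. m \<le> K \<Longrightarrow> \<bar>c m t\<bar> \<le> B"
    and "1 \<le> B" and "0 < \<beta>"
    and "\<And>t. t \<in> {1/8..3/8} \<Longrightarrow> \<beta> \<le> c 0 t"
    and "\<And>t. t \<in> {1/8..3/8} \<Longrightarrow> \<beta> \<le> c 1 t"
proof -
  define r :: "real poly" where "r = [:0, 1, -1:]"
  \<comment> \<open>The exponent \<open>2 + K\<close> leaves a zero at each endpoint after up to K +
    1 differentiations.\<close>
  define q where "q m = (pderiv ^^ m) (r ^ (2 + K))" for m
  define c where "c m t = (if t \<in> {0..1} then poly (q m) t else 0)" for m and t :: real
  have r: "poly r t = t * (1 - t)" for t by (simp add: r_def algebra_simps)
  have q0: "poly (q m) 0 = 0" "poly (q m) 1 = 0" if "m \<le> Suc K" for m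
  proof -
    have "r ^ (1 + m) dvd r ^ (2 + K)" by (rule le_imp_power_dvd) (use that in simp)
    from higher_pderiv_dvd_power[OF this] have "r dvd q m" by (simp add: q_def)
    then show "poly (q m) 0 = 0" "poly (q m) 1 = 0" by (auto elim!: dvdE simp: r)
  qed
  have qS: "pderiv (q m) = q (Suc m)" for m by (simp add: q_def)
  have d: "(c m has_real_derivative c (Suc m) t) (at t)" if "m < K" for m t
    using has_real_derivative_cutoff[of "q m" t] that q0[of m] q0[of "Suc m"]
    unfolding c_def[abs_def] qS by simp
  have s: "c m t = 0" if "m \<le> K" "t \<notin> {0<..<1}" for m t
  proof (cases "t = 0 \<or> t = 1")
    case True
    then show ?thesis using q0[of m] that by (auto simp: c_def)
  next
    case False
    then show ?thesis using that by (auto simp: c_def)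
  qed
  have "\<exists>b. \<forall>t. \<bar>c m t\<bar> \<le> b" for m
  proof -
    have "compact (poly (q m) ` {0..1})"
      by (intro compact_continuous_image continuous_intros) auto
    then have "bounded (poly (q m) ` {0..1})" by (rule compact_imp_bounded)
    then obtain b where "\<And>t. t \<in> {0..1} \<Longrightarrow> \<bar>poly (q m) t\<bar> \<le> b" unfolding bounded_iff by force
    then have "\<forall>t. \<bar>c m t\<bar> \<le> max b 0" by (force simp: c_def le_max_iff_disj)
    then show ?thesis by blast
  qed
  then obtain b where b: "\<And>m t. \<bar>c m t\<bar> \<le> b m" by metis
  \<comment> \<open>The summand 1 ensures \<open>1 \<le> B\<close>, so that powers of
    \<open>B\<close> never drop below 1.\<close>
  define B where "B = 1 + (\<Sum>m\<le>K. b m)"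
  have b0: "0 \<le> b m" for m using b[of m 0] by linarith
  have bd: "\<bar>c m t\<bar> \<le> B" if "m \<le> K" for m t
  proof -
    have "b m \<le> (\<Sum>m\<le>K. b m)" by (rule member_le_sum) (use that b0 in auto)
    then show ?thesis using b[of m t] by (simp add: B_def)
  qed
  have B1: "1 \<le> B" by (simp add: B_def sum_nonneg b0)
  have q1: "poly (q 1) t = real (2 + K) * (t * (1 - t)) ^ (1 + K) * (1 - 2 * t)" for t
  proof -
    have "poly (pderiv (r ^ Suc (1 + K))) t = real (Suc (1 + K)) * poly r t ^ (1 + K) * poly (pderiv r) t"
      unfolding pderiv_power_Suc by simp
    moreover have "poly (pderiv r) t = 1 - 2 * t" by (simp add: r_def pderiv_pCons)
    ultimately show ?thesis by (simp add: q_def r)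
  qed
  have lo: "(7/64) \<le> t * (1 - t)" if "t \<in> {1/8..3/8}" for t :: real
  proof -
    have "0 \<le> (t - 1/8) * (7/8 - t)" using that by (intro mult_nonneg_nonneg) auto
    then show ?thesis by (simp add: field_simps)
  qed
  \<comment> \<open>7/64 is the minimum of t(1-t) on the window, attained at t = 1/8.\<close>
  define \<beta> :: real where "\<beta> = (7/64) ^ (2 + K)"
  have \<beta>0: "\<beta> \<le> c 0 t" if "t \<in> {1/8..3/8}" for t
    using power_mono[OF lo[OF that], of "2 + K"] that by (auto simp: \<beta>_def c_def q_def r power_mult_distrib)
  have \<beta>1: "\<beta> \<le> c 1 t" if "t \<in> {1/8..3/8}" for t
  proof -
    \<comment> \<open>1/4 is the minimum of 1 - 2t on the window, attained at t = 3/8; it absorbs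
      the remaining factor 7/64.\<close>
    have "\<beta> \<le> 1 * (7/64) ^ (1 + K) * (1/4)" by (simp add: \<beta>_def)
    also have "\<dots> \<le> real (2 + K) * (t * (1 - t)) ^ (1 + K) * (1 - 2 * t)"
      using lo[OF that] that by (intro mult_mono power_mono) auto
    also have "\<dots> = c 1 t" using that q1[of t] by (auto simp: c_def)
    finally show ?thesis .
  qed
  show thesis
    by (rule that[of c B \<beta>]) (use d s bd B1 \<beta>0 \<beta>1 in \<open>auto simp: \<beta>_def\<close>)
qed


subsection \<open>Images of sets under Lipschitz maps\<close>

lemma infnorm_le_iff_cart:
  fixes x :: "real ^ 'd"
  shows "infnorm x \<le> r \<longleftrightarrow> (\<forall>i. \<bar>x $ i\<bar> \<le> r)"
  by (simp add: infnorm_cart) (subst cSup_le_iff, auto simp: full_SetCompr_eq intro!: bdd_above_finite)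

lemma cbox_cart_iff_infnorm:
  fixes z x :: "real ^ 'd"
  shows "x \<in> cbox (z - vec r) (z + vec r) \<longleftrightarrow> infnorm (x - z) \<le> r"
  unfolding infnorm_le_iff_cart by (auto simp: mem_box_cart abs_le_iff algebra_simps)

lemma emeasure_cube:
  fixes u v :: "real ^ 'd"
  assumes "\<And>i. v $ i - u $ i = s" "0 \<le> s"
  shows "emeasure lborel (cbox u v) = ennreal (s ^ CARD('d))"
proof -
  have "emeasure lborel (cbox u v) = ennreal (measure lborel (cbox u v))"
    using emeasure_lborel_cbox_finite[of u v] by (simp add: emeasure_eq_ennreal_measure less_top)
  also have "measure lborel (cbox u v) = (\<Prod>i\<in>UNIV. v $ i - u $ i)"
  proof (rule content_cbox_cart)
    have "u $ i \<le> v $ i" for i using assms(1)[of i] assms(2) by linarith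
    then show "cbox u v \<noteq> {}" by (auto simp: interval_ne_empty_cart)
  qed
  finally show ?thesis using assms by simp
qed

text \<open>A cube of side s is a ball of the maximum norm, so its image lies in a cube of side L s,
  and the volume factor is L^d with no dimensional constant. The set is covered by nonoverlapping
  dyadic cubes inside an open set of almost the same measure.\<close>

lemma emeasure_lipschitz_image_le:
  fixes f :: "real ^ 'd \<Rightarrow> real ^ 'd"
  assumes S: "S \<in> sets borel" "S \<subseteq> cbox (vec p) (vec q)" "p < q"
    and fS: "f ` S \<in> sets borel"
    and lip: "\<And>x y. infnorm (f x - f y) \<le> L * infnorm (x - y)" and "0 \<le> L"
  shows "emeasure lborel (f ` S) \<le> ennreal (L ^ CARD('d)) * emeasure lborel S"
proof -
  have key: "emeasure lborel (f ` S) \<le> ennreal (L ^ CARD('d)) * (emeasure lborel S + ennreal e)"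
    if e: "e > 0" for e
  proof -
    obtain U where U: "open U" "S \<subseteq> U" "emeasure lborel (U - S) < ennreal e"
      using outer_regular_lborel[OF S(1) e] by blast
    \<comment> \<open>Every cube of the covering lemma meets \<open>S\<close> in its tag, so this
      gauge forces it into \<open>U\<close>. The value off \<open>U\<close> only makes
      \<open>g\<close> a gauge.\<close>
    define g where "g x = (if x \<in> U then U else UNIV)" for x
    have gg: "gauge g" using U(1) by (auto simp: gauge_def g_def)
    have bx: "box (vec p) (vec q :: real ^ 'd) \<noteq> {}"
      using S(3) by (simp add: interval_ne_empty_cart)
    have "\<exists>\<D>. countable \<D> \<and> \<Union>\<D> \<subseteq> cbox (vec p) (vec q) \<and>
      (\<forall>K\<in>\<D>. interior K \<noteq> {} \<and> (\<exists>c d. K = cbox c d)) \<and>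
      pairwise (\<lambda>A B. interior A \<inter> interior B = {}) \<D> \<and> (\<forall>K\<in>\<D>. \<exists>x \<in> S \<inter> K. K \<subseteq> g x) \<and>
      (\<forall>u v. cbox u v \<in> \<D> \<longrightarrow> (\<exists>n. \<forall>i \<in> Basis. v \<bullet> i - u \<bullet> i = (vec q \<bullet> i - vec p \<bullet> i) / 2^n)) \<and>
      S \<subseteq> \<Union>\<D>"
    proof (rule covering_lemma[OF S(2) bx gg], goal_cases)
      case D: (1 \<D>)
      from D(1,2,4,7) show ?case
        by (intro exI[of _ \<D>] conjI ballI allI impI) (use D in \<open>auto dest: D(3) D(5) D(6)\<close>)
    qed
    then obtain \<D> where D: "countable \<D>" "\<Union>\<D> \<subseteq> cbox (vec p) (vec q)"
      "\<And>K. K \<in> \<D> \<Longrightarrow> interior K \<noteq> {} \<and> (\<exists>c d. K = cbox c d)"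
      "pairwise (\<lambda>A B. interior A \<inter> interior B = {}) \<D>"
      "\<And>K. K \<in> \<D> \<Longrightarrow> \<exists>x \<in> S \<inter> K. K \<subseteq> g x"
      "\<And>u v. cbox u v \<in> \<D> \<Longrightarrow> \<exists>n. \<forall>i \<in> Basis. v \<bullet> i - u \<bullet> i = (vec q \<bullet> i - vec p \<bullet> i) / 2^n"
      "S \<subseteq> \<Union>\<D>"
      by (elim exE conjE) (simp only: Ball_def; blast)
    \<comment> \<open>Enumeration of the countable family over all naturals, padded with empty sets,
      so that countable sums apply to finite families as well.\<close>
    define J where "J n = (if n \<in> to_nat_on \<D> ` \<D> then from_nat_into \<D> n else {})" for n
    have J: "J n = {} \<or> J n \<in> \<D>" for n
      using D(1) by (auto simp: J_def)
    have JU: "J n \<subseteq> U" for n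
    proof (cases "J n = {}")
      case False
      then obtain x where "x \<in> S" "J n \<subseteq> g x" using J[of n] D(5) by blast
      then show ?thesis using U(2) by (auto simp: g_def split: if_splits)
    qed simp
    have SJ: "S \<subseteq> (\<Union>n. J n)"
    proof
      fix x assume "x \<in> S"
      then obtain K where "x \<in> K" "K \<in> \<D>" using D(7) by blast
      then have "x \<in> J (to_nat_on \<D> K)" using D(1) by (simp add: J_def)
      then show "x \<in> (\<Union>n. J n)" by blast
    qed
    have disj: "disjoint_family (\<lambda>n. interior (J n))"
      unfolding disjoint_family_on_def
    proof (intro ballI impI)
      fix m n :: nat assume "m \<noteq> n"
      show "interior (J m) \<inter> interior (J n) = {}"
      proof (cases "J m = {} \<or> J n = {}")
        case False
        then obtain K K' where K: "K \<in> \<D>" "m = to_nat_on \<D> K" "K' \<in> \<D>" "n = to_nat_on \<D> K'"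
          by (auto simp: J_def split: if_splits)
        then have "J m = K" "J n = K'" using D(1) by (auto simp: J_def)
        moreover have "K \<noteq> K'" using K \<open>m \<noteq> n\<close> by auto
        ultimately show ?thesis using D(4) K by (auto simp: pairwise_def)
      qed auto
    qed
    have "\<exists>C. C \<in> sets borel \<and> f ` J n \<subseteq> C \<and> emeasure lborel C \<le> ennreal (L ^ CARD('d)) * emeasure lborel (interior (J n))"
      for n
    proof (cases "J n = {}")
      case False
      then obtain u v where uv: "J n = cbox u v" "cbox u v \<in> \<D>" using J[of n] D(3) by metis
      then obtain m where m: "\<forall>i \<in> Basis. v \<bullet> i - u \<bullet> i = (vec q \<bullet> i - vec p \<bullet> i) / 2^m" using D(6) by blast
      define s where "s = (q - p) / 2 ^ m"
      have s: "v $ i - u $ i = s" for i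
        using m[rule_format, of "axis i 1"] by (simp add: axis_in_Basis_iff inner_axis s_def)
      have s0: "0 < s" using S(3) by (simp add: s_def)
      define z where "z = u + vec (s / 2)"
      have uvz: "u = z - vec (s/2)" "v = z + vec (s/2)"
        using s by (auto simp: z_def vec_eq_iff algebra_simps field_simps)
      have "f ` cbox u v \<subseteq> cbox (f z - vec (L * (s/2))) (f z + vec (L * (s/2)))"
      proof clarify
        fix x assume "x \<in> cbox u v"
        then have "infnorm (x - z) \<le> s / 2" unfolding uvz cbox_cart_iff_infnorm .
        then have "infnorm (f x - f z) \<le> L * (s/2)" using lip[of x z] mult_left_mono[OF _ \<open>0 \<le> L\<close>] by (meson order_trans)
        then show "f x \<in> cbox (f z - vec (L * (s/2))) (f z + vec (L * (s/2)))"
          unfolding cbox_cart_iff_infnorm .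
      qed
      moreover have "emeasure lborel (cbox (f z - vec (L * (s/2))) (f z + vec (L * (s/2)))) = ennreal ((L * s) ^ CARD('d))"
        using \<open>0 \<le> L\<close> s0 by (intro emeasure_cube) auto
      moreover have "\<dots> = ennreal (L ^ CARD('d)) * emeasure lborel (interior (J n))"
      proof -
        have "emeasure lborel (interior (J n)) = emeasure lborel (cbox u v)"
          unfolding uv(1) interior_cbox by (simp add: emeasure_lborel_box_eq emeasure_lborel_cbox_eq)
        also have "\<dots> = ennreal (s ^ CARD('d))" using s s0 by (intro emeasure_cube) auto
        finally show ?thesis using \<open>0 \<le> L\<close> s0 by (simp add: power_mult_distrib ennreal_mult)
      qed
      ultimately show ?thesis unfolding uv(1)
        by (intro exI[of _ "cbox (f z - vec (L * (s/2))) (f z + vec (L * (s/2)))"]) auto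
    qed (auto intro: exI[of _ "{}"])
    then obtain C where C: "\<And>n. C n \<in> sets borel" "\<And>n. f ` J n \<subseteq> C n"
      "\<And>n. emeasure lborel (C n) \<le> ennreal (L ^ CARD('d)) * emeasure lborel (interior (J n))"
      by metis
    have "emeasure lborel (f ` S) \<le> emeasure lborel (\<Union>n. C n)"
      using SJ C(1,2) by (intro emeasure_mono) (auto, blast)
    also have "\<dots> \<le> (\<Sum>n. emeasure lborel (C n))"
      using C(1) by (intro emeasure_subadditive_countably) auto
    also have "\<dots> \<le> (\<Sum>n. ennreal (L ^ CARD('d)) * emeasure lborel (interior (J n)))"
      using C(3) by (intro suminf_le) auto
    also have "\<dots> = ennreal (L ^ CARD('d)) * (\<Sum>n. emeasure lborel (interior (J n)))"
      by (rule ennreal_suminf_cmult)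
    also have "(\<Sum>n. emeasure lborel (interior (J n))) = emeasure lborel (\<Union>n. interior (J n))"
      using disj by (intro suminf_emeasure) auto
    also have "\<dots> \<le> emeasure lborel (S \<union> (U - S))"
    proof (rule emeasure_mono)
      show "(\<Union>n. interior (J n)) \<subseteq> S \<union> (U - S)" using JU interior_subset by blast
    qed (use S(1) U(1) in simp)
    also have "\<dots> \<le> emeasure lborel S + emeasure lborel (U - S)"
      using S(1) U(1) by (intro emeasure_subadditive) auto
    also have "\<dots> \<le> emeasure lborel S + ennreal e" using U(3) by (intro add_left_mono) auto
    finally show ?thesis by (simp add: mult_left_mono)
  qed
  show ?thesis
  proof (rule ennreal_le_epsilon)
    fix e :: real assume "0 < e"
    \<comment> \<open>The summand 1 keeps the denominator positive also for L = 0.\<close>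
    define e' where "e' = e / (L ^ CARD('d) + 1)"
    have "0 < L ^ CARD('d) + 1" using \<open>0 \<le> L\<close> by (simp add: add_nonneg_pos)
    then have "0 < e'" "L ^ CARD('d) * e' \<le> e" using \<open>0 < e\<close> by (auto simp: e'_def field_simps)
    then have "ennreal (L ^ CARD('d)) * ennreal e' \<le> ennreal e"
      using \<open>0 \<le> L\<close> by (simp add: ennreal_mult'[symmetric] ennreal_leI)
    then show "emeasure lborel (f ` S) \<le> ennreal (L ^ CARD('d)) * emeasure lborel S + ennreal e"
      using key[OF \<open>0 < e'\<close>] by (simp add: distrib_left) (meson add_left_mono order_trans)
  qed
qed

section \<open>Densities with pointwise bounds from bounds on a measure\<close>

lemma AE_le_of_nn_integral_le:
  fixes f g :: "'a \<Rightarrow> ennreal"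
  assumes [measurable]: "f \<in> borel_measurable M" "g \<in> borel_measurable M"
    and fin: "(\<integral>\<^sup>+x. g x \<partial>M) \<noteq> \<infinity>"
    and le: "\<And>B. B \<in> sets M \<Longrightarrow> (\<integral>\<^sup>+x. f x * indicator B x \<partial>M) \<le> (\<integral>\<^sup>+x. g x * indicator B x \<partial>M)"
  shows "AE x in M. f x \<le> g x"
proof -
  \<comment> \<open>The exceptional set. Testing the hypothesis on it gives the integral of f - g
    over it as 0; the subtraction is legitimate because g has finite integral.\<close>
  define B where "B = {x \<in> space M. g x < f x}"
  have [measurable]: "B \<in> sets M" by (simp add: B_def)
  define F where "F x = g x * indicator B x" for x
  define G where "G x = f x * indicator B x" for x
  have [measurable]: "F \<in> borel_measurable M" "G \<in> borel_measurable M" unfolding F_def G_def by auto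
  have FG: "F x \<le> G x" if "x \<in> space M" for x using that by (auto simp: F_def G_def B_def indicator_def)
  have Ffin: "(\<integral>\<^sup>+x. F x \<partial>M) \<noteq> \<infinity>"
  proof -
    have "(\<integral>\<^sup>+x. F x \<partial>M) \<le> (\<integral>\<^sup>+x. g x \<partial>M)" by (intro nn_integral_mono) (auto simp: F_def indicator_def)
    then show ?thesis using fin by (auto simp: top_unique)
  qed
  have "(\<integral>\<^sup>+x. G x - F x \<partial>M) = (\<integral>\<^sup>+x. G x \<partial>M) - (\<integral>\<^sup>+x. F x \<partial>M)"
    using FG Ffin by (intro nn_integral_diff) auto
  also have "\<dots> = 0" using le[of B] Ffin by (intro diff_eq_0_ennreal) (auto simp: F_def G_def less_top)
  finally have "AE x in M. G x - F x = 0" by (subst (asm) nn_integral_0_iff_AE) auto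
  with AE_space show ?thesis
  proof eventually_elim
    case (elim x)
    then have "f x - g x = 0" if "g x < f x" using that by (simp add: F_def G_def B_def)
    then show ?case by (metis diff_gt_0_iff_gt_ennreal less_irrefl not_le)
  qed
qed

text \<open>The upper bound gives absolute continuity, and the Radon-Nikodym density inherits both
  bounds almost everywhere.\<close>

lemma density_between_exists:
  fixes P :: "'a measure"
  assumes "sigma_finite_measure M" and sets: "sets P = sets M"
    and W: "W \<in> sets M" "emeasure M W \<noteq> \<infinity>" and lu: "0 \<le> l" "l \<le> u"
    and lo: "\<And>B. B \<in> sets M \<Longrightarrow> ennreal l * emeasure M (B \<inter> W) \<le> emeasure P B"
    and hi: "\<And>B. B \<in> sets M \<Longrightarrow> emeasure P B \<le> ennreal u * emeasure M (B \<inter> W)"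
  obtains \<rho> :: "'a \<Rightarrow> real" where "\<rho> \<in> borel_measurable M" "P = density M (\<lambda>x. ennreal (\<rho> x))"
    "\<And>x. x \<in> W \<Longrightarrow> l \<le> \<rho> x \<and> \<rho> x \<le> u"
proof -
  interpret sigma_finite_measure M by fact
  note W(1)[measurable]
  have "absolutely_continuous M P"
    unfolding absolutely_continuous_def
  proof
    fix B assume "B \<in> null_sets M"
    then have B: "B \<in> sets M" "emeasure M B = 0" by auto
    then have "emeasure M (B \<inter> W) = 0"
      using emeasure_mono[of "B \<inter> W" B M] by simp
    then show "B \<in> null_sets P" using hi[OF B(1)] B(1) sets by (auto simp: null_sets_def)
  qed
  from Radon_Nikodym[OF this sets] obtain f where [measurable]: "f \<in> borel_measurable M" and P: "density M f = P"
    by blast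
  have emP: "emeasure P B = (\<integral>\<^sup>+x. f x * indicator B x \<partial>M)" if "B \<in> sets M" for B
    using that by (simp add: P[symmetric] emeasure_density)
  have int: "(\<integral>\<^sup>+x. (ennreal r * indicator W x) * indicator B x \<partial>M) = ennreal r * emeasure M (B \<inter> W)"
    if [measurable]: "B \<in> sets M" for B r
  proof -
    have "(\<integral>\<^sup>+x. (ennreal r * indicator W x) * indicator B x \<partial>M) = (\<integral>\<^sup>+x. ennreal r * indicator (B \<inter> W) x \<partial>M)"
      by (intro nn_integral_cong) (auto simp: indicator_def)
    then show ?thesis by (simp add: nn_integral_cmult)
  qed
  have WW: "(\<integral>\<^sup>+x. ennreal u * indicator W x \<partial>M) \<noteq> \<infinity>"
    using W by (simp add: nn_integral_cmult ennreal_mult_eq_top_iff)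
  have up: "AE x in M. f x \<le> ennreal u * indicator W x"
  proof (rule AE_le_of_nn_integral_le)
    fix B assume "B \<in> sets M"
    then show "(\<integral>\<^sup>+x. f x * indicator B x \<partial>M) \<le> (\<integral>\<^sup>+x. (ennreal u * indicator W x) * indicator B x \<partial>M)"
      using hi[of B] by (simp add: int emP)
  qed (use WW in auto)
  have dn: "AE x in M. ennreal l * indicator W x \<le> f x"
  proof (rule AE_le_of_nn_integral_le)
    have "(\<integral>\<^sup>+x. f x \<partial>M) = emeasure P (space M)"
      using emP[of "space M"] by (simp cong: nn_integral_cong)
    also have "\<dots> \<le> ennreal u * emeasure M (space M \<inter> W)" by (rule hi) simp
    also have "\<dots> < \<infinity>"
      using W by (simp add: ennreal_mult_less_top Int_absorb1 sets.sets_into_space less_top)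
    finally show "(\<integral>\<^sup>+x. f x \<partial>M) \<noteq> \<infinity>" by simp
    fix B assume "B \<in> sets M"
    then show "(\<integral>\<^sup>+x. (ennreal l * indicator W x) * indicator B x \<partial>M) \<le> (\<integral>\<^sup>+x. f x * indicator B x \<partial>M)"
      using lo[of B] by (simp add: int emP)
  qed auto
  \<comment> \<open>Clipping changes the density only on a null set and turns the bounds into
    pointwise ones on \<open>W\<close>.\<close>
  define \<rho> where "\<rho> x = (if x \<in> W then max l (min u (enn2real (f x))) else 0)" for x
  have [measurable]: "\<rho> \<in> borel_measurable M" unfolding \<rho>_def by measurable
  have "AE x in M. f x = ennreal (\<rho> x)"
    using up dn AE_space
  proof eventually_elim
    case (elim x)
    show ?case
    proof (cases "x \<in> W")
      case True
      then have b: "f x \<le> ennreal u" "ennreal l \<le> f x" using elim by auto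
      then have "f x = ennreal (enn2real (f x))" by (simp add: ennreal_enn2real_if) (metis ennreal_neq_top neq_top_trans)
      then have "enn2real (f x) \<le> u" "l \<le> enn2real (f x)"
        using b lu by (metis ennreal_le_iff order_trans, metis ennreal_le_iff enn2real_nonneg)
      then show ?thesis using True \<open>f x = ennreal (enn2real (f x))\<close> by (simp add: \<rho>_def)
    next
      case False
      then show ?thesis using elim by (simp add: \<rho>_def)
    qed
  qed
  then have "density M f = density M (\<lambda>x. ennreal (\<rho> x))"
    by (intro density_cong) auto
  then show thesis
    using lu P by (intro that[of \<rho>]) (auto simp: \<rho>_def)
qed


subsection \<open>Comparing product measures\<close>

lemma (in prob_space) bounded_density:
  fixes r :: "'a \<Rightarrow> real"
  assumes [measurable]: "r \<in> borel_measurable M" and "prob_space (density M (\<lambda>x. ennreal (r x)))"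
    and r: "\<And>x. x \<in> space M \<Longrightarrow> 0 \<le> r x \<and> r x \<le> u"
  shows "integrable M r" "(\<integral>x. r x \<partial>M) = 1"
proof -
  show "integrable M r"
    using r by (auto intro!: integrable_const_bound[where B=u] AE_I2)
  have "(\<integral>\<^sup>+x. ennreal (r x) \<partial>M) = 1"
    using prob_space.emeasure_space_1[OF assms(2)] by (simp add: emeasure_density cong: nn_integral_cong)
  then show "(\<integral>x. r x \<partial>M) = 1"
    using r by (subst integral_eq_nn_integral) auto
qed

text \<open>Both densities integrate to 1, so a constant may be subtracted from the test function
  before the integrals are compared. What remains is the oscillation \<open>e\<close> times the
  difference of the densities on \<open>C\<close>. This is how privacy will enter: the test has
  oscillation at most \<epsilon> in each observation, and not merely range 1.\<close>

lemma nn_integral_density_add_le: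
  fixes \<rho> \<rho>' :: "'a \<Rightarrow> real"
  assumes "prob_space \<mu>"
    and [measurable]: "\<rho> \<in> borel_measurable \<mu>" "\<rho>' \<in> borel_measurable \<mu>" "C \<in> sets \<mu>" "g \<in> borel_measurable \<mu>"
    and prob: "prob_space (density \<mu> (\<lambda>x. ennreal (\<rho> x)))" "prob_space (density \<mu> (\<lambda>x. ennreal (\<rho>' x)))"
    and lu: "0 \<le> l" "\<And>x. x \<in> space \<mu> \<Longrightarrow> l \<le> \<rho> x \<and> \<rho> x \<le> u" "\<And>x. x \<in> space \<mu> \<Longrightarrow> l \<le> \<rho>' x \<and> \<rho>' x \<le> u"
    and off: "\<And>x. x \<in> space \<mu> \<Longrightarrow> x \<notin> C \<Longrightarrow> \<rho> x = \<rho>' x"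
    and g1: "\<And>x. x \<in> space \<mu> \<Longrightarrow> g x \<le> 1" and "0 \<le> e"
    and osc: "\<And>x y. x \<in> space \<mu> \<Longrightarrow> y \<in> space \<mu> \<Longrightarrow> g x \<le> g y + ennreal e"
  shows "(\<integral>\<^sup>+x. g x \<partial>density \<mu> (\<lambda>x. ennreal (\<rho> x)))
    \<le> (\<integral>\<^sup>+x. g x \<partial>density \<mu> (\<lambda>x. ennreal (\<rho>' x))) + ennreal ((u - l) * measure \<mu> C * e)"
proof -
  let ?N = "density \<mu> (\<lambda>x. ennreal (\<rho> x))" and ?N' = "density \<mu> (\<lambda>x. ennreal (\<rho>' x))"
  interpret prob_space \<mu> by fact
  obtain y where y: "y \<in> space \<mu>" using not_empty by blast
  define h where "h x = enn2real (g x)" for x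
  have [measurable]: "h \<in> borel_measurable \<mu>" by (simp add: h_def[abs_def])
  have gh: "g x = ennreal (h x)" if "x \<in> space \<mu>" for x
    unfolding h_def using g1[OF that] by (intro ennreal_enn2real[symmetric] le_less_trans[OF _ ennreal_one_less_top])
  have h01: "0 \<le> h x" "x \<in> space \<mu> \<Longrightarrow> h x \<le> 1" for x
    using g1[of x] by (auto simp: h_def dest: enn2real_mono)
  have hosc: "\<bar>h x - h y\<bar> \<le> e" if "x \<in> space \<mu>" for x
    using osc[OF that y] osc[OF y that] that y \<open>0 \<le> e\<close> h01
    by (simp add: gh ennreal_plus[symmetric] ennreal_le_iff del: ennreal_plus)
  have "0 \<le> \<rho> x" "0 \<le> \<rho>' x" if "x \<in> space \<mu>" for x
    using lu(1) lu(2)[OF that] lu(3)[OF that] by auto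
  then have i: "integrable \<mu> \<rho>" "integrable \<mu> \<rho>'" and one: "(\<integral>x. \<rho> x \<partial>\<mu>) = 1" "(\<integral>x. \<rho>' x \<partial>\<mu>) = 1"
    using bounded_density[OF _ prob(1), of u] bounded_density[OF _ prob(2), of u] lu by auto
  have ih: "integrable \<mu> (\<lambda>x. \<rho> x * h x)" "integrable \<mu> (\<lambda>x. \<rho>' x * h x)"
  proof -
    have "\<bar>r x * h x\<bar> \<le> u" if "x \<in> space \<mu>" "l \<le> r x \<and> r x \<le> u" for x and r :: "'a \<Rightarrow> real"
      using that h01[of x] lu(1) mult_mono[of "r x" u "h x" 1] by (simp add: abs_mult)
    then show "integrable \<mu> (\<lambda>x. \<rho> x * h x)" "integrable \<mu> (\<lambda>x. \<rho>' x * h x)"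
      using lu by (auto intro!: integrable_const_bound[where B=u])
  qed
  have eq: "(\<integral>\<^sup>+x. g x \<partial>density \<mu> (\<lambda>x. ennreal (r x))) = ennreal (\<integral>x. r x * h x \<partial>\<mu>)"
    if [measurable]: "r \<in> borel_measurable \<mu>" and l: "\<And>x. x \<in> space \<mu> \<Longrightarrow> l \<le> r x \<and> r x \<le> u"
    and "integrable \<mu> (\<lambda>x. r x * h x)" for r :: "'a \<Rightarrow> real"
  proof -
    have "(\<integral>\<^sup>+x. g x \<partial>density \<mu> (\<lambda>x. ennreal (r x))) = (\<integral>\<^sup>+x. ennreal (r x * h x) \<partial>\<mu>)"
      by (subst nn_integral_density) (auto intro!: nn_integral_cong simp: gh ennreal_mult'' h01)
    also have "\<dots> = ennreal (\<integral>x. r x * h x \<partial>\<mu>)"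
      using that h01 lu(1) by (intro nn_integral_eq_integral) (auto intro!: AE_I2 mult_nonneg_nonneg intro: order_trans[OF lu(1)])
    finally show ?thesis .
  qed
  have le: "\<rho> x * h x - \<rho>' x * h x - h y * (\<rho> x - \<rho>' x) \<le> (u - l) * e * indicator C x" if "x \<in> space \<mu>" for x
  proof (cases "x \<in> C")
    case True
    have "(\<rho> x - \<rho>' x) * (h x - h y) \<le> \<bar>\<rho> x - \<rho>' x\<bar> * \<bar>h x - h y\<bar>" by (metis abs_ge_self abs_mult)
    also have "\<dots> \<le> (u - l) * e"
      using hosc[OF that] lu(2)[OF that] lu(3)[OF that] by (intro mult_mono) auto
    finally show ?thesis using True by (simp add: algebra_simps)
  next
    case False
    then show ?thesis using off[OF that False] by simp
  qed
  have "(\<integral>x. \<rho> x * h x \<partial>\<mu>) - (\<integral>x. \<rho>' x * h x \<partial>\<mu>)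
      = (\<integral>x. \<rho> x * h x - \<rho>' x * h x - h y * (\<rho> x - \<rho>' x) \<partial>\<mu>)"
    using i ih one by simp
  also have "\<dots> \<le> (\<integral>x. (u - l) * e * indicator C x \<partial>\<mu>)"
  proof (rule integral_mono)
    have "integrable \<mu> (indicat_real C)" by (rule integrable_real_indicator) (auto simp: less_top[symmetric])
    then show "integrable \<mu> (\<lambda>x. (u - l) * e * indicator C x)" by simp
  qed (use le i ih in auto)
  also have "\<dots> = (u - l) * measure \<mu> C * e" by simp
  finally have "(\<integral>x. \<rho> x * h x \<partial>\<mu>) \<le> (\<integral>x. \<rho>' x * h x \<partial>\<mu>) + (u - l) * measure \<mu> C * e" by simp
  moreover have "0 \<le> (u - l) * measure \<mu> C * e"
    using lu(2)[OF y] \<open>0 \<le> e\<close> by auto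
  moreover have "0 \<le> (\<integral>x. \<rho>' x * h x \<partial>\<mu>)"
    using lu h01 by (intro integral_nonneg_AE AE_I2 mult_nonneg_nonneg) (auto intro: order_trans)
  ultimately show ?thesis
    using lu ih by (simp add: eq ennreal_plus[symmetric] ennreal_leI del: ennreal_plus)
qed

text \<open>Cauchy-Schwarz for the factors g \<surd>\<rho>' and \<rho>/\<surd>\<rho>'. The integral
  of \<rho>^2/\<rho>' is 1 plus the chi-square divergence, which lives on \<open>C\<close>
  only.\<close>

lemma nn_integral_density_sq_le:
  fixes \<rho> \<rho>' :: "'a \<Rightarrow> real"
  assumes "prob_space \<mu>"
    and [measurable]: "\<rho> \<in> borel_measurable \<mu>" "\<rho>' \<in> borel_measurable \<mu>" "C \<in> sets \<mu>" "g \<in> borel_measurable \<mu>"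
    and prob: "prob_space (density \<mu> (\<lambda>x. ennreal (\<rho> x)))" "prob_space (density \<mu> (\<lambda>x. ennreal (\<rho>' x)))"
    and lu: "0 < l" "\<And>x. x \<in> space \<mu> \<Longrightarrow> l \<le> \<rho> x \<and> \<rho> x \<le> u" "\<And>x. x \<in> space \<mu> \<Longrightarrow> l \<le> \<rho>' x \<and> \<rho>' x \<le> u"
    and off: "\<And>x. x \<in> space \<mu> \<Longrightarrow> x \<notin> C \<Longrightarrow> \<rho> x = \<rho>' x"
  shows "(\<integral>\<^sup>+x. g x \<partial>density \<mu> (\<lambda>x. ennreal (\<rho> x)))\<^sup>2
    \<le> ennreal (1 + (u - l)\<^sup>2 / l * measure \<mu> C) * (\<integral>\<^sup>+x. (g x)\<^sup>2 \<partial>density \<mu> (\<lambda>x. ennreal (\<rho>' x)))"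
proof -
  let ?N = "density \<mu> (\<lambda>x. ennreal (\<rho> x))" and ?N' = "density \<mu> (\<lambda>x. ennreal (\<rho>' x))"
  interpret prob_space \<mu> by fact
  have pos: "0 < \<rho> x" "0 < \<rho>' x" if "x \<in> space \<mu>" for x using lu that by force+
  have "0 \<le> \<rho> x" "0 \<le> \<rho>' x" if "x \<in> space \<mu>" for x using pos[OF that] by auto
  then have i: "integrable \<mu> \<rho>" "integrable \<mu> \<rho>'" and one: "(\<integral>x. \<rho> x \<partial>\<mu>) = 1" "(\<integral>x. \<rho>' x \<partial>\<mu>) = 1"
    using bounded_density[OF _ prob(1), of u] bounded_density[OF _ prob(2), of u] lu by auto
  have ic: "integrable \<mu> (indicat_real C)" by (rule integrable_real_indicator) (auto simp: less_top[symmetric])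
  define q where "q x = \<rho> x / sqrt (\<rho>' x)" for x
  have [measurable]: "q \<in> borel_measurable \<mu>" by (simp add: q_def[abs_def])
  have "(\<integral>\<^sup>+x. g x \<partial>?N) = (\<integral>\<^sup>+x. (g x * ennreal (sqrt (\<rho>' x))) * ennreal (q x) \<partial>\<mu>)"
  proof (subst nn_integral_density, simp, simp, rule nn_integral_cong)
    fix x assume "x \<in> space \<mu>"
    from pos[OF this] have "\<rho> x = sqrt (\<rho>' x) * q x" "0 \<le> q x" by (auto simp: q_def)
    then have "ennreal (\<rho> x) = ennreal (sqrt (\<rho>' x)) * ennreal (q x)"
      using pos[OF \<open>x \<in> space \<mu>\<close>] by (simp add: ennreal_mult)
    then show "ennreal (\<rho> x) * g x = (g x * ennreal (sqrt (\<rho>' x))) * ennreal (q x)" by (simp add: ac_simps)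
  qed
  then have "(\<integral>\<^sup>+x. g x \<partial>?N)\<^sup>2
    \<le> (\<integral>\<^sup>+x. (g x * ennreal (sqrt (\<rho>' x)))\<^sup>2 \<partial>\<mu>) * (\<integral>\<^sup>+x. (ennreal (q x))\<^sup>2 \<partial>\<mu>)"
    by (simp add: Cauchy_Schwarz_nn_integral)
  also have "(\<integral>\<^sup>+x. (g x * ennreal (sqrt (\<rho>' x)))\<^sup>2 \<partial>\<mu>) = (\<integral>\<^sup>+x. (g x)\<^sup>2 \<partial>?N')"
    using pos by (subst nn_integral_density)
      (auto intro!: nn_integral_cong simp: power_mult_distrib ennreal_power less_imp_le mult.commute)
  also have "(\<integral>\<^sup>+x. (ennreal (q x))\<^sup>2 \<partial>\<mu>) \<le> (\<integral>\<^sup>+x. ennreal (2 * \<rho> x - \<rho>' x + (u - l)\<^sup>2 / l * indicator C x) \<partial>\<mu>)"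
  proof (rule nn_integral_mono)
    fix x assume x: "x \<in> space \<mu>"
    \<comment> \<open>The part 2\<rho> - \<rho>' integrates to 1, which isolates the divergence in
      the last summand.\<close>
    have "(q x)\<^sup>2 = 2 * \<rho> x - \<rho>' x + (\<rho> x - \<rho>' x)\<^sup>2 / \<rho>' x"
      using pos[OF x] by (simp add: q_def power_divide) (simp add: field_simps power2_eq_square)
    also have "(\<rho> x - \<rho>' x)\<^sup>2 / \<rho>' x \<le> (u - l)\<^sup>2 / l * indicator C x"
    proof (cases "x \<in> C")
      case True
      have "\<bar>\<rho> x - \<rho>' x\<bar> \<le> u - l" using lu(2,3)[OF x] by auto
      then have "(\<rho> x - \<rho>' x)\<^sup>2 \<le> (u - l)\<^sup>2" by (simp add: abs_le_square_iff[symmetric])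
      then show ?thesis using True lu(1) lu(3)[OF x] by (simp add: frac_le)
    qed (use off x in simp)
    finally show "(ennreal (q x))\<^sup>2 \<le> ennreal (2 * \<rho> x - \<rho>' x + (u - l)\<^sup>2 / l * indicator C x)"
      using pos[OF x] by (simp add: ennreal_power q_def ennreal_leI)
  qed
  also have "\<dots> = ennreal (\<integral>x. 2 * \<rho> x - \<rho>' x + (u - l)\<^sup>2 / l * indicator C x \<partial>\<mu>)"
  proof (rule nn_integral_eq_integral)
    show "AE x in \<mu>. 0 \<le> 2 * \<rho> x - \<rho>' x + (u - l)\<^sup>2 / l * indicator C x"
    proof (rule AE_I2)
      fix x assume x: "x \<in> space \<mu>"
      show "0 \<le> 2 * \<rho> x - \<rho>' x + (u - l)\<^sup>2 / l * indicator C x"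
      proof (cases "x \<in> C")
        case True
        \<comment> \<open>The worst case on \<open>C\<close> is \<rho> = l, \<rho>' = u; completing
          the square shows that the majorant is still nonnegative there.\<close>
        have "(u - l)\<^sup>2 / l + 2 * l - u = ((u - 3/2 * l)\<^sup>2 + 3/4 * l\<^sup>2) / l"
          using lu(1) by (simp add: field_simps power2_eq_square)
        also have "\<dots> \<ge> 0" using lu(1) by simp
        finally show ?thesis using True lu(2,3)[OF x] by auto
      qed (use off[OF x] pos[OF x] in simp)
    qed
  next
    show "integrable \<mu> (\<lambda>x. 2 * \<rho> x - \<rho>' x + (u - l)\<^sup>2 / l * indicator C x)"
      using i ic by (intro Bochner_Integration.integrable_add Bochner_Integration.integrable_diff integrable_mult_right) auto
  qed
  also have "(\<integral>x. 2 * \<rho> x - \<rho>' x + (u - l)\<^sup>2 / l * indicator C x \<partial>\<mu>) = 1 + (u - l)\<^sup>2 / l * measure \<mu> C"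
  proof -
    have "(\<integral>x. (2 * \<rho> x - \<rho>' x) + (u - l)\<^sup>2 / l * indicator C x \<partial>\<mu>)
      = (\<integral>x. 2 * \<rho> x - \<rho>' x \<partial>\<mu>) + (\<integral>x. (u - l)\<^sup>2 / l * indicator C x \<partial>\<mu>)"
      using i ic by (intro Bochner_Integration.integral_add Bochner_Integration.integrable_diff integrable_mult_right) auto
    then show ?thesis
      using i one by simp
  qed
  finally have "(\<integral>\<^sup>+x. g x \<partial>?N)\<^sup>2
    \<le> (\<integral>\<^sup>+x. (g x)\<^sup>2 \<partial>?N') * ennreal (1 + (u - l)\<^sup>2 / l * measure \<mu> C)"
    by (simp add: mult_left_mono)
  then show ?thesis by (simp only: mult.commute)
qed

lemma measurable_PiM_update:
  fixes G :: "('i \<Rightarrow> 'a) \<Rightarrow> ennreal"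
  assumes G: "G \<in> borel_measurable (PiM (insert i I) (\<lambda>_. N))"
  shows "(\<lambda>(x, y). G (x(i := y))) \<in> borel_measurable (PiM I (\<lambda>_. N) \<Otimes>\<^sub>M N)"
    and "x \<in> space (PiM I (\<lambda>_. N)) \<Longrightarrow> (\<lambda>y. G (x(i := y))) \<in> borel_measurable N"
proof -
  show *: "(\<lambda>(x, y). G (x(i := y))) \<in> borel_measurable (PiM I (\<lambda>_. N) \<Otimes>\<^sub>M N)"
    using measurable_compose[OF measurable_add_dim G] by (simp add: case_prod_unfold)
  show "x \<in> space (PiM I (\<lambda>_. N)) \<Longrightarrow> (\<lambda>y. G (x(i := y))) \<in> borel_measurable N"
    using measurable_compose[OF measurable_Pair1' *] by simp
qed

text \<open>Hybrid argument: the coordinates change their law one at a time, each at cost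
  \<open>t\<close>. Averaging over a coordinate preserves both the bound 1 and the oscillation
  \<open>e\<close> in the other coordinates, so the induction continues.\<close>

lemma nn_integral_PiM_add_le:
  fixes G :: "('i \<Rightarrow> 'a) \<Rightarrow> ennreal"
  assumes "prob_space N" "prob_space N'" and sets: "sets N' = sets N" and "finite I"
    and step: "\<And>g. g \<in> borel_measurable N \<Longrightarrow> (\<And>x. x \<in> space N \<Longrightarrow> g x \<le> 1) \<Longrightarrow>
      (\<And>x y. x \<in> space N \<Longrightarrow> y \<in> space N \<Longrightarrow> g x \<le> g y + e) \<Longrightarrow>
      (\<integral>\<^sup>+x. g x \<partial>N) \<le> (\<integral>\<^sup>+x. g x \<partial>N') + t"
    and "G \<in> borel_measurable (PiM I (\<lambda>_. N))"
    and "\<And>x. x \<in> space (PiM I (\<lambda>_. N)) \<Longrightarrow> G x \<le> 1"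
    and "\<And>x i y. x \<in> space (PiM I (\<lambda>_. N)) \<Longrightarrow> i \<in> I \<Longrightarrow> y \<in> space N \<Longrightarrow> G x \<le> G (x(i := y)) + e"
  shows "(\<integral>\<^sup>+x. G x \<partial>PiM I (\<lambda>_. N)) \<le> (\<integral>\<^sup>+x. G x \<partial>PiM I (\<lambda>_. N')) + of_nat (card I) * t"
  using \<open>finite I\<close> assms(6-)
proof (induction I arbitrary: G)
  case empty
  then show ?case by (simp add: PiM_empty nn_integral_count_space_finite)
next
  case (insert i I)
  let ?Q = "PiM I (\<lambda>_. N)" and ?Q' = "PiM I (\<lambda>_. N')"
  interpret N: prob_space N by fact
  interpret N': prob_space N' by fact
  interpret product_prob_space "\<lambda>_. N" by standard
  interpret N'prod: product_prob_space "\<lambda>_. N'" by standard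
  interpret PN: prob_space "?Q" by (intro prob_space_PiM N.prob_space_axioms)
  have spN: "space N' = space N" using sets by (rule sets_eq_imp_space_eq)
  have sPi: "sets (PiM J (\<lambda>_. N')) = sets (PiM J (\<lambda>_. N))" for J :: "'i set"
    using sets by (intro sets_PiM_cong) auto
  have mG[measurable]: "G \<in> borel_measurable (PiM (insert i I) (\<lambda>_. N))" by fact
  have mG': "G \<in> borel_measurable (PiM (insert i I) (\<lambda>_. N'))"
    using mG by (subst measurable_cong_sets[OF sPi refl])
  have sp: "x(i := y) \<in> space (PiM (insert i I) (\<lambda>_. N))"
    if "x \<in> space (?Q)" "y \<in> space N" for x y
    using that by (auto simp: space_PiM PiE_def extensional_def Pi_def)
  note upd = measurable_PiM_update(1)[OF mG] and mx = measurable_PiM_update(2)[OF mG]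
  have mx': "(\<lambda>y. G (x(i := y))) \<in> borel_measurable N'" if "x \<in> space (?Q)" for x
    using mx[OF that] by (subst measurable_cong_sets[OF sets refl])
  \<comment> \<open>The new coordinate is averaged under the target law \<open>N'\<close>, after its
    replacement has been paid for by \<open>step\<close>.\<close>
  define F where "F x = (\<integral>\<^sup>+y. G (x(i := y)) \<partial>N')" for x
  have mF: "F \<in> borel_measurable (?Q)"
  proof -
    have "sets (?Q \<Otimes>\<^sub>M N') = sets (?Q \<Otimes>\<^sub>M N)"
      using sets by (intro sets_pair_measure_cong) auto
    then have "(\<lambda>(x, y). G (x(i := y))) \<in> borel_measurable (?Q \<Otimes>\<^sub>M N')"
      using upd by (subst measurable_cong_sets[OF _ refl])
    then show ?thesis
      unfolding F_def using N'.borel_measurable_nn_integral[of "\<lambda>x y. G (x(i := y))"] by simp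
  qed
  have "(\<integral>\<^sup>+x. G x \<partial>PiM (insert i I) (\<lambda>_. N)) = (\<integral>\<^sup>+x. \<integral>\<^sup>+y. G (x(i := y)) \<partial>N \<partial>?Q)"
    using insert.hyps by (intro product_nn_integral_insert) auto
  also have "\<dots> \<le> (\<integral>\<^sup>+x. F x + t \<partial>?Q)"
  proof (rule nn_integral_mono)
    fix x assume x: "x \<in> space (?Q)"
    show "(\<integral>\<^sup>+y. G (x(i := y)) \<partial>N) \<le> F x + t"
      unfolding F_def
    proof (rule step[OF mx[OF x]])
      show "G (x(i := y)) \<le> 1" if "y \<in> space N" for y using insert.prems(2) sp[OF x that] .
      show "G (x(i := y)) \<le> G (x(i := z)) + e" if "y \<in> space N" "z \<in> space N" for y z
        using insert.prems(3)[OF sp[OF x that(1)], of i z] that(2) by (simp only: fun_upd_upd insertI1)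
    qed
  qed
  also have "\<dots> = (\<integral>\<^sup>+x. F x \<partial>?Q) + t"
    using mF by (simp add: nn_integral_add PN.emeasure_space_1)
  also have "(\<integral>\<^sup>+x. F x \<partial>?Q) \<le> (\<integral>\<^sup>+x. F x \<partial>?Q') + of_nat (card I) * t"
  proof (rule insert.IH[OF mF])
    fix x assume x: "x \<in> space (?Q)"
    have "F x \<le> (\<integral>\<^sup>+y. 1 \<partial>N')" unfolding F_def
      using insert.prems(2)[OF sp[OF x]] spN by (intro nn_integral_mono) (simp only:)
    then show "F x \<le> 1" by (simp add: N'.emeasure_space_1)
    fix j z assume j: "j \<in> I" and z: "z \<in> space N"
    have xj: "x(j := z) \<in> space (?Q)"
      using x j z by (auto simp: space_PiM PiE_def extensional_def Pi_def)
    have "F x \<le> (\<integral>\<^sup>+y. G (x(j := z, i := y)) + e \<partial>N')"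
      unfolding F_def
    proof (rule nn_integral_mono)
      fix y assume "y \<in> space N'"
      then have y: "y \<in> space N" using spN by simp
      have "i \<noteq> j" using insert.hyps j by auto
      then show "G (x(i := y)) \<le> G (x(j := z, i := y)) + e"
        using insert.prems(3)[OF sp[OF x y], of j z] j z
        by (simp only: fun_upd_twist[OF \<open>i \<noteq> j\<close>] insertI2)
    qed
    also have "\<dots> = F (x(j := z)) + e"
      unfolding F_def using mx'[OF xj] by (simp add: nn_integral_add N'.emeasure_space_1)
    finally show "F x \<le> F (x(j := z)) + e" .
  qed
  also have "(\<integral>\<^sup>+x. F x \<partial>?Q') = (\<integral>\<^sup>+x. G x \<partial>PiM (insert i I) (\<lambda>_. N'))"
    unfolding F_def using insert.hyps mG' by (intro N'prod.product_nn_integral_insert[symmetric]) auto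
  finally show ?case using insert.hyps by (simp add: algebra_simps)
qed

text \<open>One plus the chi-square divergence is multiplicative over products. The new coordinate
  is averaged under \<open>N\<close> before the induction hypothesis is used, so that
  \<open>step\<close> can be applied to the squared average inside the remaining integral.\<close>

lemma nn_integral_PiM_sq_le:
  fixes G :: "('i \<Rightarrow> 'a) \<Rightarrow> ennreal"
  assumes "prob_space N" "prob_space N'" and sets: "sets N' = sets N" and "finite I"
    and step: "\<And>g. g \<in> borel_measurable N \<Longrightarrow> (\<integral>\<^sup>+x. g x \<partial>N)\<^sup>2 \<le> c * (\<integral>\<^sup>+x. (g x)\<^sup>2 \<partial>N')"
    and "G \<in> borel_measurable (PiM I (\<lambda>_. N))"
  shows "(\<integral>\<^sup>+x. G x \<partial>PiM I (\<lambda>_. N))\<^sup>2 \<le> c ^ card I * (\<integral>\<^sup>+x. (G x)\<^sup>2 \<partial>PiM I (\<lambda>_. N'))"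
  using \<open>finite I\<close> assms(6-)
proof (induction I arbitrary: G)
  case empty
  then show ?case by (simp add: PiM_empty nn_integral_count_space_finite)
next
  case (insert i I)
  let ?Q = "PiM I (\<lambda>_. N)" and ?Q' = "PiM I (\<lambda>_. N')"
  interpret N: prob_space N by fact
  interpret N': prob_space N' by fact
  interpret product_prob_space "\<lambda>_. N" by standard
  interpret N'prod: product_prob_space "\<lambda>_. N'" by standard
  have sPi: "sets (PiM J (\<lambda>_. N')) = sets (PiM J (\<lambda>_. N))" for J :: "'i set"
    using sets by (intro sets_PiM_cong) auto
  have mG[measurable]: "G \<in> borel_measurable (PiM (insert i I) (\<lambda>_. N))" by fact
  have mG': "G \<in> borel_measurable (PiM (insert i I) (\<lambda>_. N'))"
    using mG by (subst measurable_cong_sets[OF sPi refl])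
  note upd = measurable_PiM_update(1)[OF mG] and mx = measurable_PiM_update(2)[OF mG]
  define F where "F x = (\<integral>\<^sup>+y. G (x(i := y)) \<partial>N)" for x
  have mF: "F \<in> borel_measurable (?Q)"
    unfolding F_def using N.borel_measurable_nn_integral[of "\<lambda>x y. G (x(i := y))"] upd by simp
  have mH: "(\<lambda>x. \<integral>\<^sup>+y. (G (x(i := y)))\<^sup>2 \<partial>N') \<in> borel_measurable (?Q')"
  proof -
    have s: "sets (?Q' \<Otimes>\<^sub>M N') = sets (?Q \<Otimes>\<^sub>M N)"
      using sets sPi by (intro sets_pair_measure_cong) auto
    have "(\<lambda>(x, y). (G (x(i := y)))\<^sup>2) \<in> borel_measurable (?Q \<Otimes>\<^sub>M N)"
      using upd by (simp add: case_prod_unfold)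
    then have "(\<lambda>(x, y). (G (x(i := y)))\<^sup>2) \<in> borel_measurable (?Q' \<Otimes>\<^sub>M N')"
      by (subst measurable_cong_sets[OF s refl])
    then show ?thesis
      using N'.borel_measurable_nn_integral[of "\<lambda>x y. (G (x(i := y)))\<^sup>2"] by simp
  qed
  have "(\<integral>\<^sup>+x. G x \<partial>PiM (insert i I) (\<lambda>_. N))\<^sup>2 = (\<integral>\<^sup>+x. F x \<partial>?Q)\<^sup>2"
    unfolding F_def using insert.hyps by (subst product_nn_integral_insert) auto
  also have "\<dots> \<le> c ^ card I * (\<integral>\<^sup>+x. (F x)\<^sup>2 \<partial>?Q')"
    by (rule insert.IH[OF mF])
  also have "(\<integral>\<^sup>+x. (F x)\<^sup>2 \<partial>?Q') \<le> (\<integral>\<^sup>+x. c * (\<integral>\<^sup>+y. (G (x(i := y)))\<^sup>2 \<partial>N') \<partial>?Q')"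
    unfolding F_def using sets_eq_imp_space_eq[OF sPi] by (intro nn_integral_mono step mx) auto
  also have "\<dots> = c * (\<integral>\<^sup>+x. (\<integral>\<^sup>+y. (G (x(i := y)))\<^sup>2 \<partial>N') \<partial>?Q')"
    by (rule nn_integral_cmult[OF mH])
  also have "(\<integral>\<^sup>+x. (\<integral>\<^sup>+y. (G (x(i := y)))\<^sup>2 \<partial>N') \<partial>?Q') = (\<integral>\<^sup>+x. (G x)\<^sup>2 \<partial>PiM (insert i I) (\<lambda>_. N'))"
    using insert.hyps mG' by (intro N'prod.product_nn_integral_insert[symmetric]) auto
  finally show ?case using insert.hyps by (simp add: mult.assoc mult.left_commute mult_left_mono)
qed


subsection \<open>Partial derivatives and lattices of bumps\<close>

lemma Omega_tilde_iff: "x \<in> Omega_tilde \<longleftrightarrow> (\<forall>i. -1 \<le> x $ i \<and> x $ i \<le> 2)"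
  by (simp add: Omega_tilde_def mem_box_cart)

lemma Omega_iff: "x \<in> Omega \<longleftrightarrow> (\<forall>i. 0 \<le> x $ i \<and> x $ i \<le> 1)"
  by (simp add: Omega_def mem_box_cart)

text \<open>The admissible increments form an interval of length 3 that contains 0. Hence the
  derivative along a coordinate is unique on the faces of the cube too, where it is
  one-sided.\<close>

lemma partial_eq:
  fixes f :: "real ^ 'd \<Rightarrow> real"
  assumes x: "x \<in> Omega_tilde" and f: "(f has_derivative f') (at x within Omega_tilde)"
  shows "partial i f x = f' (axis i 1)"
proof -
  define g where "g s = x + s *\<^sub>R axis i 1" for s :: real
  define S where "S = {s. g s \<in> Omega_tilde}"
  have S: "S = {-1 - x $ i .. 2 - x $ i}"
  proof -
    have "g s \<in> Omega_tilde \<longleftrightarrow> -1 \<le> x $ i + s \<and> x $ i + s \<le> 2" for s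
      using x by (auto simp: Omega_tilde_iff g_def axis_def)
    then have "S = {s. -1 \<le> x $ i + s \<and> x $ i + s \<le> 2}" unfolding S_def by presburger
    also have "\<dots> = {-1 - x $ i .. 2 - x $ i}" by (intro set_eqI iffI) simp_all
    finally show ?thesis .
  qed
  have g: "(g has_vector_derivative axis i 1) (at 0 within S)"
    unfolding g_def by (auto intro!: derivative_eq_intros)
  have "g ` S \<subseteq> Omega_tilde" by (auto simp: S_def)
  from has_derivative_subset[OF f this]
  have "(f has_derivative f') (at (g 0) within g ` S)" by (simp add: g_def)
  from vector_derivative_diff_chain_within[OF g this]
  have "((f \<circ> g) has_vector_derivative f' (axis i 1)) (at 0 within S)" .
  moreover have "-1 - x $ i < 2 - x $ i" "0 \<in> {-1 - x $ i .. 2 - x $ i}"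
    using x by (auto simp: Omega_tilde_iff)
  ultimately have "vector_derivative (f \<circ> g) (at 0 within S) = f' (axis i 1)"
    unfolding S by (intro vector_derivative_within_closed_interval)
  then show ?thesis
    by (simp add: partial_def S_def g_def[abs_def] o_def)
qed

lemma has_derivative_cong_on:
  assumes "\<And>x. x \<in> S \<Longrightarrow> f x = g x" "x \<in> S"
  shows "(f has_derivative f') (at x within S) \<longleftrightarrow> (g has_derivative f') (at x within S)"
  using assms by (metis has_derivative_transform)

text \<open>Iterated partial derivatives are known in closed form only on the cube, and this
  suffices for the next differentiation.\<close>

lemma partial_cong:
  assumes "\<And>y. y \<in> Omega_tilde \<Longrightarrow> f y = g y" "x \<in> Omega_tilde"
  shows "partial i f x = partial i g x"
proof -
  have "((\<lambda>s. f (x + s *\<^sub>R axis i 1)) has_derivative d) (at 0 within {s. x + s *\<^sub>R axis i 1 \<in> Omega_tilde}) \<longleftrightarrow>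
    ((\<lambda>s. g (x + s *\<^sub>R axis i 1)) has_derivative d) (at 0 within {s. x + s *\<^sub>R axis i 1 \<in> Omega_tilde})" for d
    using assms by (intro has_derivative_cong_on) auto
  then show ?thesis by (simp add: partial_def vector_derivative_def has_vector_derivative_def)
qed

section \<open>Multi-indices as lists of coordinates\<close>

lemma ex_list_with_counts:
  fixes b :: "'d::finite \<Rightarrow> nat"
  shows "\<exists>xs. \<forall>i. count_list xs i = b i"
proof -
  have "\<exists>xs. \<forall>i. count_list xs i = (if i \<in> set us then b i else 0)" if "distinct us" for us
    using that
  proof (induction us)
    case (Cons u us)
    then obtain xs where "\<forall>i. count_list xs i = (if i \<in> set us then b i else 0)" by auto
    moreover have "count_list (replicate n u) i = (if i = u then n else 0)" for n i
      by (induction n) auto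
    ultimately show ?case using Cons.prems
      by (intro exI[of _ "replicate (b u) u @ xs"]) auto
  qed (auto intro: exI[of _ "[]"])
  moreover obtain us :: "'d list" where "distinct us" "set us = UNIV"
    using finite_distinct_list[of "UNIV :: 'd set"] by auto
  ultimately show ?thesis by (metis UNIV_I)
qed

text \<open>Later estimates depend on the chosen list only through its length, so the order of
  differentiation never has to be discussed.\<close>

lemma multi_partial_foldr:
  fixes b :: "'d::finite \<Rightarrow> nat"
  obtains xs where "length xs = mi_order b" "multi_partial b = foldr partial xs"
proof -
  define xs where "xs = (SOME xs. \<forall>i. count_list xs i = b i)"
  have "\<forall>i. count_list xs i = b i"
    unfolding xs_def by (rule someI_ex) (rule ex_list_with_counts)
  then have "mi_order b = length xs"
    using sum_count_set[of xs UNIV] by (simp add: mi_order_def)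
  then show thesis by (intro that[of xs]) (auto simp: multi_partial_def xs_def fun_eq_iff)
qed

section \<open>Sums of product bumps over the cells of a lattice\<close>

definition bump_sum :: "(nat \<Rightarrow> real \<Rightarrow> real) \<Rightarrow> nat \<Rightarrow> ('d::finite \<Rightarrow> nat) set \<Rightarrow> ('d \<Rightarrow> nat) \<Rightarrow> real ^ 'd \<Rightarrow> real"
  where "bump_sum c k \<theta> \<kappa> x = (\<Sum>j\<in>\<theta>. \<Prod>i\<in>UNIV. c (\<kappa> i) (real k * x $ i - real (j i)))"

definition cells :: "nat \<Rightarrow> ('d \<Rightarrow> nat) set"
  where "cells k = {j. \<forall>i. j i < k}"

definition cell :: "nat \<Rightarrow> ('d::finite \<Rightarrow> nat) \<Rightarrow> (real ^ 'd) set"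
  where "cell k j = cbox (\<chi> i. real (j i) / real k) (\<chi> i. (real (j i) + 1) / real k)"

lemma finite_cells [simp]: "finite (cells k :: ('d::finite \<Rightarrow> nat) set)"
  and card_cells: "card (cells k :: ('d::finite \<Rightarrow> nat) set) = k ^ CARD('d)"
proof -
  have eq: "cells k = PiE (UNIV :: 'd set) (\<lambda>_. {..<k})"
    by (auto simp: cells_def PiE_def)
  show "finite (cells k :: ('d::finite \<Rightarrow> nat) set)" unfolding eq by (rule finite_PiE) auto
  show "card (cells k :: ('d::finite \<Rightarrow> nat) set) = k ^ CARD('d)" unfolding eq by (simp add: card_PiE)
qed

text \<open>
  Here \<open>c m\<close> is the \<open>m\<close>-th derivative of the one-dimensional profile, \<open>k\<close> the number of cells per side
  and \<open>a\<close> the amplitude of the displacement. The index \<open>\<kappa>\<close> of \<open>bump_sum\<close> records how often each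
  coordinate has been differentiated; the factors \<open>k\<close> from the chain rule are kept outside.
\<close>

locale bump =
  fixes c :: "nat \<Rightarrow> real \<Rightarrow> real" and K :: nat and B \<beta> :: real and k :: nat and a :: real
  assumes K2: "2 \<le> K"
    and deriv: "\<And>m t. m < K \<Longrightarrow> (c m has_real_derivative c (Suc m) t) (at t)"
    and supp: "\<And>m t. m \<le> K \<Longrightarrow> t \<notin> {0<..<1} \<Longrightarrow> c m t = 0"
    and bound: "\<And>m t. m \<le> K \<Longrightarrow> \<bar>c m t\<bar> \<le> B"
    and B1: "1 \<le> B" and \<beta>0: "0 < \<beta>"
    and lower0: "\<And>t. t \<in> {1/8..3/8} \<Longrightarrow> \<beta> \<le> c 0 t"
    and lower1: "\<And>t. t \<in> {1/8..3/8} \<Longrightarrow> \<beta> \<le> c 1 t"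
    and k1: "1 \<le> k" and a0: "0 \<le> a"
begin

abbreviation D :: "('d::finite \<Rightarrow> nat) set \<Rightarrow> ('d \<Rightarrow> nat) \<Rightarrow> real ^ 'd \<Rightarrow> real"
  where "D \<equiv> bump_sum c k"

lemma cell_iff: "x \<in> cell k j \<longleftrightarrow> (\<forall>i. 0 \<le> real k * x $ i - real (j i) \<and> real k * x $ i - real (j i) \<le> 1)"
  using k1 by (simp add: cell_def mem_box_cart field_simps)

lemma prod_eq_0:
  assumes "\<And>i. \<kappa> i \<le> K" "real k * x $ i - real (j i) \<notin> {0<..<1}"
  shows "(\<Prod>i\<in>UNIV. c (\<kappa> i) (real k * x $ i - real (j i))) = 0"
  using assms by (auto simp: prod_zero_iff intro!: exI[of _ i] supp)

lemma D_insert: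
  assumes "finite \<theta>" "j \<notin> \<theta>"
  shows "D (insert j \<theta>) \<kappa> x = D {j} \<kappa> x + D \<theta> \<kappa> x"
  using assms by (simp add: bump_sum_def)

lemma D_single_outside:
  assumes "\<And>i. \<kappa> i \<le> K" "x \<notin> cell k j"
  shows "D {j} \<kappa> x = 0"
proof -
  obtain i where "\<not> (0 \<le> real k * x $ i - real (j i) \<and> real k * x $ i - real (j i) \<le> 1)"
    using assms(2) unfolding cell_iff by blast
  then have "real k * x $ i - real (j i) \<notin> {0<..<1}" by auto
  then show ?thesis using prod_eq_0[of \<kappa> x i j] assms(1) by (simp add: bump_sum_def)
qed

lemma D_insert_outside:
  assumes "\<And>i. \<kappa> i \<le> K" "x \<notin> cell k j" "finite \<theta>"
  shows "D (insert j \<theta>) \<kappa> x = D \<theta> \<kappa> x"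
  using D_insert[OF assms(3)] D_single_outside[OF assms(1,2)] by (cases "j \<in> \<theta>") (auto simp: insert_absorb)

text \<open>Distinct cells have indices that differ by a nonzero integer in some coordinate, so a
  rescaled coordinate cannot lie in the closed unit interval for one and in the open one for the
  other. Shared faces are harmless because the profile vanishes at 0 and 1.\<close>

lemma D_inside:
  assumes "\<And>i. \<kappa> i \<le> K" "x \<in> cell k j" "finite \<theta>"
  shows "D \<theta> \<kappa> x = (if j \<in> \<theta> then D {j} \<kappa> x else 0)"
proof -
  have z: "(\<Prod>i\<in>UNIV. c (\<kappa> i) (real k * x $ i - real (j' i))) = 0" if ne: "j' \<noteq> j" for j'
  proof -
    obtain i where i: "j' i \<noteq> j i" using ne by (metis ext)
    have "real k * x $ i - real (j' i) \<notin> {0<..<1}"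
    proof
      assume "real k * x $ i - real (j' i) \<in> {0<..<1}"
      moreover have "0 \<le> real k * x $ i - real (j i) \<and> real k * x $ i - real (j i) \<le> 1"
        using assms(2) by (simp add: cell_iff)
      ultimately have "\<bar>real (j' i) - real (j i)\<bar> < 1" by auto
      then show False using i by linarith
    qed
    then show ?thesis using prod_eq_0 assms(1) by blast
  qed
  show ?thesis
  proof (cases "j \<in> \<theta>")
    case True
    then have "D \<theta> \<kappa> x = D {j} \<kappa> x + D (\<theta> - {j}) \<kappa> x"
      using D_insert[of "\<theta> - {j}" j] assms(3) by (simp add: insert_absorb)
    also have "D (\<theta> - {j}) \<kappa> x = 0"
      unfolding bump_sum_def using z by (intro sum.neutral) auto
    finally show ?thesis using True by simp
  next
    case False
    then have "D \<theta> \<kappa> x = 0" unfolding bump_sum_def by (intro sum.neutral ballI z) blast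
    then show ?thesis using False by simp
  qed
qed

lemma B_power_ge_1: "1 \<le> B ^ n" by (simp add: B1)

text \<open>At most one bump is nonzero at any point, hence no factor for the number of cells in
  \<open>\<theta>\<close>.\<close>

lemma D_bound:
  assumes "\<And>i. \<kappa> i \<le> K" "finite \<theta>"
  shows "\<bar>D \<theta> \<kappa> (x :: real ^ 'd)\<bar> \<le> B ^ CARD('d)"
proof (cases "\<exists>j. x \<in> cell k j \<and> j \<in> \<theta>")
  case True
  then obtain j where "x \<in> cell k j" "j \<in> \<theta>" by blast
  then have "\<bar>D \<theta> \<kappa> x\<bar> = (\<Prod>i\<in>UNIV. \<bar>c (\<kappa> i) (real k * x $ i - real (j i))\<bar>)"
    using D_inside[OF assms(1) _ assms(2), of x j] by (simp add: bump_sum_def abs_prod)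
  also have "\<dots> \<le> (\<Prod>i\<in>(UNIV :: 'd set). B)" using assms(1) bound by (intro prod_mono) auto
  finally show ?thesis by simp
next
  case False
  have "D \<theta> \<kappa> x = (\<Sum>j\<in>\<theta>. D {j} \<kappa> x)" by (simp add: bump_sum_def)
  also have "\<dots> = 0"
  proof (intro sum.neutral ballI)
    fix j assume "j \<in> \<theta>"
    then have "x \<notin> cell k j" using False by blast
    then show "D {j} \<kappa> x = 0" using D_single_outside[of \<kappa> x j] assms(1) by simp
  qed
  finally show ?thesis using B_power_ge_1[of "CARD('d)"] by simp
qed

text \<open>All cells lie in the unit cube and every bump vanishes on the faces of its cell. For
  this reason the perturbed map will fix the boundary and the outside of
  \<open>Omega\<close>.\<close>

lemma D_eq_0_boundary:
  assumes "\<And>i. \<kappa> i \<le> K" "\<theta> \<subseteq> cells k" "\<not> (\<forall>i. 0 < x $ i \<and> x $ i < 1)"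
  shows "D \<theta> \<kappa> x = 0"
proof -
  obtain i where i: "\<not> (0 < x $ i \<and> x $ i < 1)" using assms(3) by blast
  have "(\<Prod>i\<in>UNIV. c (\<kappa> i) (real k * x $ i - real (j i))) = 0" if "j \<in> \<theta>" for j
  proof (rule prod_eq_0[OF assms(1)])
    show "real k * x $ i - real (j i) \<notin> {0<..<1}"
    proof
      assume *: "real k * x $ i - real (j i) \<in> {0<..<1}"
      have "j i < k" using that assms(2) by (auto simp: cells_def)
      then have "real (j i) + 1 \<le> real k" by linarith
      moreover from * have "real (j i) < real k * x $ i" "real k * x $ i < real (j i) + 1" by auto
      ultimately have lt: "0 < real k * x $ i" "real k * x $ i < real k * 1" by linarith+
      from mult_left_less_imp_less[OF lt(2)] lt(1) show False using i by (auto simp: zero_less_mult_iff)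
    qed
  qed
  then show ?thesis unfolding bump_sum_def by (intro sum.neutral ballI)
qed

text \<open>Bump sums are closed under differentiation: a derivative in direction i raises
  \<open>\<kappa> i\<close> by one and releases a factor k.\<close>

lemma D_has_derivative:
  fixes x :: "real ^ 'd"
  assumes "\<And>i. \<kappa> i < K"
  shows "(D \<theta> \<kappa> has_derivative (\<lambda>h. \<Sum>i\<in>UNIV. h $ i * (real k * D \<theta> (\<kappa>(i := Suc (\<kappa> i))) x))) (at x within S)"
proof -
  have 1: "((\<lambda>x :: real ^ 'd. c (\<kappa> i) (real k * x $ i - real (j i))) has_derivative
      (\<lambda>h. h $ i * (real k * c (Suc (\<kappa> i)) (real k * x $ i - real (j i))))) (at x within S)" for i :: 'd and j
  proof -
    have "((\<lambda>x :: real ^ 'd. real k * x $ i - real (j i)) has_derivative (\<lambda>h. real k * h $ i)) (at x within S)"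
      by (rule has_derivative_eq_rhs)
        (rule derivative_intros bounded_linear_imp_has_derivative bounded_linear_vec_nth | simp)+
    from has_derivative_compose[OF this deriv[OF assms, unfolded has_field_derivative_def]]
    show ?thesis by (rule has_derivative_eq_rhs) (auto simp: fun_eq_iff ac_simps)
  qed
  have "(D \<theta> \<kappa> has_derivative (\<lambda>h. \<Sum>j\<in>\<theta>. \<Sum>i\<in>UNIV.
     (h $ i * (real k * c (Suc (\<kappa> i)) (real k * x $ i - real (j i)))) *
      (\<Prod>l\<in>UNIV - {i}. c (\<kappa> l) (real k * x $ l - real (j l))))) (at x within S)"
    unfolding bump_sum_def[abs_def] by (intro has_derivative_sum has_derivative_prod 1)
  moreover have "(\<Prod>l\<in>UNIV. c ((\<kappa>(i := Suc (\<kappa> i))) l) (real k * x $ l - real (j l)))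
     = c (Suc (\<kappa> i)) (real k * x $ i - real (j i)) * (\<Prod>l\<in>UNIV - {i}. c (\<kappa> l) (real k * x $ l - real (j l)))" for i j
    by (subst prod.remove[of _ i]) (auto intro!: prod.cong)
  ultimately show ?thesis
    by (elim has_derivative_eq_rhs)
      (auto simp: fun_eq_iff bump_sum_def sum_distrib_left mult.assoc intro: sum.swap)
qed

lemma D_continuous_on:
  fixes S :: "(real ^ 'd) set"
  assumes "\<And>i. \<kappa> i < K"
  shows "continuous_on S (D \<theta> \<kappa>)"
  unfolding continuous_on_eq_continuous_within
proof
  fix x :: "real ^ 'd"
  show "continuous (at x within S) (D \<theta> \<kappa>)"
    by (rule has_derivative_continuous[OF D_has_derivative[of \<kappa>]]) (rule assms)
qed

lemma D_lipschitz:
  fixes x y :: "real ^ 'd"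
  assumes "\<And>i. \<kappa> i < K" "finite \<theta>"
  shows "\<bar>D \<theta> \<kappa> x - D \<theta> \<kappa> y\<bar> \<le> real k * B ^ CARD('d) * (\<Sum>i\<in>UNIV. \<bar>x $ i - y $ i\<bar>)"
proof -
  define p where "p t = y + t *\<^sub>R (x - y)" for t :: real
  define g' where "g' t = (\<Sum>i\<in>UNIV. (x - y) $ i * (real k * D \<theta> (\<kappa>(i := Suc (\<kappa> i))) (p t)))" for t
  have "((\<lambda>t. D \<theta> \<kappa> (p t)) has_real_derivative g' t) (at t)" for t
  proof -
    have "(p has_derivative (\<lambda>s. s *\<^sub>R (x - y))) (at t)"
      unfolding p_def[abs_def] by (auto intro!: derivative_eq_intros)
    from has_derivative_compose[OF this D_has_derivative[OF assms(1)]]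
    show ?thesis unfolding has_field_derivative_def
      by (rule has_derivative_eq_rhs) (auto simp: fun_eq_iff g'_def sum_distrib_left sum_distrib_right ac_simps)
  qed
  then obtain t where "D \<theta> \<kappa> (p 1) - D \<theta> \<kappa> (p 0) = (1 - 0) * g' t"
    using MVT2[of 0 1 "\<lambda>t. D \<theta> \<kappa> (p t)" g'] by auto
  then have "\<bar>D \<theta> \<kappa> x - D \<theta> \<kappa> y\<bar> = \<bar>g' t\<bar>" by (simp add: p_def)
  also have "\<dots> \<le> (\<Sum>i\<in>UNIV. \<bar>(x - y) $ i\<bar> * (real k * B ^ CARD('d)))"
    unfolding g'_def
  proof (rule order_trans[OF sum_abs], rule sum_mono)
    fix i
    have "\<bar>D \<theta> (\<kappa>(i := Suc (\<kappa> i))) (p t)\<bar> \<le> B ^ CARD('d)"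
      using assms by (intro D_bound) (auto simp: Suc_le_eq less_imp_le)
    then show "\<bar>(x - y) $ i * (real k * D \<theta> (\<kappa>(i := Suc (\<kappa> i))) (p t))\<bar> \<le> \<bar>(x - y) $ i\<bar> * (real k * B ^ CARD('d))"
      by (simp add: abs_mult mult_left_mono)
  qed
  finally show ?thesis by (simp add: sum_distrib_left ac_simps)
qed

lemma affine_D_has_derivative:
  fixes x :: "real ^ 'd"
  assumes "\<And>i. \<kappa> i < K"
  shows "((\<lambda>x. b + v \<bullet> x + r * D \<theta> \<kappa> x) has_derivative
    (\<lambda>h. v \<bullet> h + r * (\<Sum>i\<in>UNIV. h $ i * (real k * D \<theta> (\<kappa>(i := Suc (\<kappa> i))) x)))) (at x within S)"
  by (rule has_derivative_eq_rhs, (rule derivative_intros D_has_derivative[OF assms])+) auto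

lemma partial_affine_D:
  fixes x :: "real ^ 'd"
  assumes "\<And>i. \<kappa> i < K" "x \<in> Omega_tilde"
  shows "partial i (\<lambda>x. b + v \<bullet> x + r * D \<theta> \<kappa> x) x = v $ i + r * real k * D \<theta> (\<kappa>(i := Suc (\<kappa> i))) x"
proof -
  have "(\<Sum>l\<in>UNIV. axis i 1 $ l * (real k * D \<theta> (\<kappa>(l := Suc (\<kappa> l))) x)) = real k * D \<theta> (\<kappa>(i := Suc (\<kappa> i))) x"
    by (subst sum.remove[of _ i]) (auto simp: axis_def intro!: sum.neutral)
  then show ?thesis
    using partial_eq[OF assms(2) affine_D_has_derivative[of \<kappa>], of i b v r \<theta>] assms(1)
    by (simp add: inner_axis mult.assoc)
qed

text \<open>The induction needs a class that is stable under \<open>partial\<close>, whose values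
  are controlled only on the cube. Functions agreeing there with an affine part plus a bump sum form
  such a class; each differentiation uses up one of the K available orders.\<close>

lemma times_differentiable_affine_D:
  fixes f :: "real ^ 'd \<Rightarrow> real"
  assumes "\<And>x. x \<in> Omega_tilde \<Longrightarrow> f x = b + v \<bullet> x + r * D \<theta> \<kappa> x" "\<And>i. \<kappa> i + m \<le> K"
  shows "times_differentiable m f"
  using assms
proof (induction m arbitrary: f b v r \<kappa>)
  case (Suc m)
  have \<kappa>: "\<kappa> i < K" for i using Suc.prems(2)[of i] by simp
  have "f differentiable_on Omega_tilde"
    unfolding differentiable_on_def differentiable_def
  proof
    fix x :: "real ^ 'd" assume x: "x \<in> Omega_tilde"
    show "\<exists>f'. (f has_derivative f') (at x within Omega_tilde)"
      by (rule exI, rule iffD2[OF has_derivative_cong_on[OF Suc.prems(1) x]])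
        (use affine_D_has_derivative[of \<kappa>] \<kappa> in blast)+
  qed
  moreover have "times_differentiable m (partial i f)" for i
  proof (rule Suc.IH)
    fix x :: "real ^ 'd" assume "x \<in> Omega_tilde"
    then show "partial i f x = v $ i + 0 \<bullet> x + (r * real k) * D \<theta> (\<kappa>(i := Suc (\<kappa> i))) x"
      using partial_cong[of f "\<lambda>x. b + v \<bullet> x + r * D \<theta> \<kappa> x" x i] Suc.prems(1) partial_affine_D[OF \<kappa>]
      by simp
  next
    fix l
    show "(\<kappa>(i := Suc (\<kappa> i))) l + m \<le> K" using Suc.prems(2)[of l] by (cases "l = i") auto
  qed
  ultimately show ?case by simp
qed simp

text \<open>The perturbed and the unperturbed function share the same \<open>b'\<close> and
  \<open>v'\<close>, so their derivatives differ exactly by one bump sum. This makes a comparison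
  with the norm of the identity possible, with no need to compute that norm.\<close>

lemma foldr_partial_affine_D:
  fixes v :: "real ^ 'd"
  assumes "\<And>i. \<kappa> i + length xs \<le> K"
  shows "\<exists>b' v' \<kappa>'. (\<forall>i. \<kappa>' i \<le> \<kappa> i + length xs) \<and> (\<forall>x\<in>Omega_tilde.
      foldr partial xs (\<lambda>x. b + v \<bullet> x) x = b' + v' \<bullet> x \<and>
      foldr partial xs (\<lambda>x. b + v \<bullet> x + r * D \<theta> \<kappa> x) x = b' + v' \<bullet> x + r * real k ^ length xs * D \<theta> \<kappa>' x)"
  using assms
proof (induction xs)
  case Nil
  show ?case by (intro exI[of _ b] exI[of _ v] exI[of _ \<kappa>]) auto
next
  case (Cons y ys)
  have "\<kappa> i + length ys \<le> K" for i using Cons.prems[of i] by simp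
  from Cons.IH[OF this] obtain b' v' \<kappa>' where 1: "\<And>i. \<kappa>' i \<le> \<kappa> i + length ys"
    and 2: "\<And>x. x \<in> Omega_tilde \<Longrightarrow> foldr partial ys (\<lambda>x. b + v \<bullet> x) x = b' + v' \<bullet> x"
     "\<And>x. x \<in> Omega_tilde \<Longrightarrow> foldr partial ys (\<lambda>x. b + v \<bullet> x + r * D \<theta> \<kappa> x) x
        = b' + v' \<bullet> x + r * real k ^ length ys * D \<theta> \<kappa>' x" by blast
  have \<kappa>': "\<kappa>' i < K" for i using 1[of i] Cons.prems[of i] by simp
  have "\<forall>i. (\<kappa>'(y := Suc (\<kappa>' y))) i \<le> \<kappa> i + length (y # ys)"
    using 1 by (auto simp: le_SucI)
  moreover have "foldr partial (y # ys) (\<lambda>x. b + v \<bullet> x) x = v' $ y + 0 \<bullet> x" if "x \<in> Omega_tilde" for x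
    using partial_cong[OF 2(1) that, where i=y] partial_affine_D[OF \<kappa>' that, where i=y and b=b' and v=v' and r=0 and \<theta>=\<theta>] by simp
  moreover have "foldr partial (y # ys) (\<lambda>x. b + v \<bullet> x + r * D \<theta> \<kappa> x) x
      = v' $ y + 0 \<bullet> x + r * real k ^ length (y # ys) * D \<theta> (\<kappa>'(y := Suc (\<kappa>' y))) x" if "x \<in> Omega_tilde" for x
    using partial_cong[OF 2(2) that, where i=y] partial_affine_D[OF \<kappa>' that, where i=y and b=b' and v=v' and r="r * real k ^ length ys" and \<theta>=\<theta>]
    by (simp add: ac_simps)
  ultimately show ?case by blast
qed

end

section \<open>The displacement and its Hoelder norm\<close>

definition unit_index :: "'d \<Rightarrow> 'd \<Rightarrow> nat"
  where "unit_index i = (\<lambda>_. 0)(i := Suc 0)"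

context bump
begin

text \<open>The gradient of a/k times the undifferentiated bump sum. The k from the chain rule
  cancels, so \<open>a\<close> is the amplitude of the displacement at every scale.\<close>

definition shift :: "('d::finite \<Rightarrow> nat) set \<Rightarrow> real ^ 'd \<Rightarrow> real ^ 'd"
  where "shift \<theta> x = (\<chi> i. a * D \<theta> (unit_index i) x)"

definition tmap :: "('d::finite \<Rightarrow> nat) set \<Rightarrow> real ^ 'd \<Rightarrow> real ^ 'd"
  where "tmap \<theta> x = x + shift \<theta> x"

lemma unit_index_less: "unit_index i l < K"
  using K2 by (simp add: unit_index_def)

lemma unit_index_le: "unit_index i l \<le> K"
  using unit_index_less by (rule less_imp_le)

text \<open>Interpolation: the Lipschitz bound is the better one at distances below the cell size,
  the supremum bound above it.\<close>

lemma D_hoelder: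
  fixes x y :: "real ^ 'd"
  assumes "\<And>i. \<kappa> i < K" "finite \<theta>" "x \<noteq> y" "0 \<le> s" "s \<le> 1"
  shows "\<bar>D \<theta> \<kappa> x - D \<theta> \<kappa> y\<bar> \<le> 2 * real CARD('d) * B ^ CARD('d) * (real k * norm (x - y)) powr s"
proof -
  define r where "r = real k * norm (x - y)"
  have r: "0 < r" using k1 assms(3) by (simp add: r_def)
  have d1: "1 \<le> real CARD('d)" by (simp add: Suc_leI)
  have B: "1 \<le> B ^ CARD('d)" by (rule B_power_ge_1)
  have 1: "\<bar>D \<theta> \<kappa> x - D \<theta> \<kappa> y\<bar> \<le> real CARD('d) * B ^ CARD('d) * r"
  proof -
    have "(\<Sum>i\<in>UNIV. \<bar>x $ i - y $ i\<bar>) \<le> (\<Sum>i\<in>(UNIV :: 'd set). norm (x - y))"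
      by (intro sum_mono) (metis component_le_norm_cart vector_minus_component)
    then have "real k * B ^ CARD('d) * (\<Sum>i\<in>UNIV. \<bar>x $ i - y $ i\<bar>) \<le> real k * B ^ CARD('d) * (real CARD('d) * norm (x - y))"
      using B by (intro mult_left_mono) auto
    then show ?thesis using D_lipschitz[of \<kappa> \<theta> x y] assms(1,2) by (simp add: r_def ac_simps)
  qed
  have 2: "\<bar>D \<theta> \<kappa> x - D \<theta> \<kappa> y\<bar> \<le> 2 * B ^ CARD('d)"
    using D_bound[of \<kappa> \<theta> x] D_bound[of \<kappa> \<theta> y] assms(1,2) by (smt (verit) less_imp_le)
  show ?thesis
  proof (cases "r \<le> 1")
    case True
    have "r powr 1 \<le> r powr s" using r True assms by (intro powr_mono') auto
    then have "real CARD('d) * B ^ CARD('d) * r \<le> real CARD('d) * B ^ CARD('d) * r powr s"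
      using B r by (intro mult_left_mono) auto
    also have "\<dots> \<le> 2 * real CARD('d) * B ^ CARD('d) * r powr s"
      using B by (intro mult_right_mono) auto
    finally show ?thesis using 1 unfolding r_def by linarith
  next
    case False
    then have "1 \<le> r powr s" using assms by (intro ge_one_powr_ge_zero) auto
    then have "1 \<le> real CARD('d) * r powr s" using d1 mult_mono[of 1 "real CARD('d)" 1 "r powr s"] by simp
    then have "(2 * B ^ CARD('d)) * 1 \<le> (2 * B ^ CARD('d)) * (real CARD('d) * r powr s)"
      using B by (intro mult_left_mono) auto
    then show ?thesis using 2 by (simp add: r_def ac_simps)
  qed
qed

lemma tmap_component:
  "(\<lambda>z. tmap \<theta> z $ i) = (\<lambda>z. 0 + axis i 1 \<bullet> z + a * D \<theta> (unit_index i) z)"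
  by (simp add: tmap_def shift_def inner_axis' fun_eq_iff)

text \<open>The number of terms in the norm times the bound for one term. It depends neither on k
  nor on a, so it is available before the scale is chosen; the \<open>itself\<close> argument
  carries the dimension.\<close>

definition holder_const :: "real \<Rightarrow> 'd::finite itself \<Rightarrow> real"
  where "holder_const \<alpha> _ = real CARD('d) * (real (card {b :: 'd \<Rightarrow> nat. real (mi_order b) \<le> \<alpha>}) +
    real (card {b :: 'd \<Rightarrow> nat. int (mi_order b) = \<lfloor>\<alpha>\<rfloor>})) * (2 * real CARD('d) * B ^ CARD('d))"

text \<open>Every supremum in the norm grows by at most the same amount \<open>E\<close>: a
  derivative of order m costs k^m, and a Hoelder quotient of exponent s costs a further k^s. In both
  cases the total power is at most \<alpha>.\<close>

lemma holder_norm_tmap_le: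
  fixes \<theta> :: "('d::finite \<Rightarrow> nat) set"
  assumes "1 < \<alpha>" "nat \<lfloor>\<alpha>\<rfloor> + 2 \<le> K" "finite \<theta>"
  shows "holder_norm \<alpha> (tmap \<theta>) \<le> holder_norm \<alpha> (\<lambda>x :: real ^ 'd. x) +
    ennreal (holder_const \<alpha> TYPE('d) * (a * real k powr \<alpha>))"
proof -
  let ?T = "\<lambda>b i. multi_partial b (\<lambda>z. tmap \<theta> z $ i)"
  let ?I = "\<lambda>b i. multi_partial b (\<lambda>z :: real ^ 'd. z $ i)"
  define E where "E = 2 * real CARD('d) * B ^ CARD('d) * (a * real k powr \<alpha>)"
  have B: "1 \<le> B ^ CARD('d)" by (rule B_power_ge_1)
  have d1: "1 \<le> real CARD('d)" by (simp add: Suc_leI)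
  have E0: "0 \<le> E" using B a0 by (simp add: E_def)
  have form: "\<exists>\<kappa>'. (\<forall>l. \<kappa>' l < K) \<and> (\<forall>x\<in>Omega_tilde. ?T b i x
      = ?I b i x + a * real k ^ mi_order b * D \<theta> \<kappa>' x)"
    if "mi_order b \<le> nat \<lfloor>\<alpha>\<rfloor>" for b :: "'d \<Rightarrow> nat" and i
  proof -
    obtain xs where xs: "length xs = mi_order b" "multi_partial b = foldr partial xs" by (rule multi_partial_foldr)
    \<comment> \<open>Strict inequality: beyond the \<lfloor>\<alpha>\<rfloor> derivatives of the
      gradient, one more is used by the Lipschitz part of the Hoelder bound.\<close>
    have le: "unit_index i l + length xs < K" for l
      using assms(2) that xs(1) by (auto simp: unit_index_def)
    then have "\<And>l. unit_index i l + length xs \<le> K" by (simp add: less_imp_le)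
    from foldr_partial_affine_D[of "unit_index i", OF this, of 0 "axis i 1" a \<theta>]
    obtain b' v' \<kappa>' where 1: "\<And>l. \<kappa>' l \<le> unit_index i l + length xs" and
      2: "\<And>x. x \<in> Omega_tilde \<Longrightarrow> foldr partial xs (\<lambda>x. 0 + axis i 1 \<bullet> x) x = b' + v' \<bullet> x"
       "\<And>x. x \<in> Omega_tilde \<Longrightarrow> foldr partial xs (\<lambda>x. 0 + axis i 1 \<bullet> x + a * D \<theta> (unit_index i) x) x
         = b' + v' \<bullet> x + a * real k ^ length xs * D \<theta> \<kappa>' x" by blast
    have "(\<lambda>z :: real ^ 'd. z $ i) = (\<lambda>z. 0 + axis i 1 \<bullet> z)" by (simp add: inner_axis')
    moreover have "\<kappa>' l < K" for l using 1[of l] le[of l] by linarith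
    ultimately show ?thesis
      using 2 unfolding xs(2) tmap_component xs(1)[symmetric]
      by (intro exI[of _ \<kappa>']) auto
  qed
  have ord: "mi_order b \<le> nat \<lfloor>\<alpha>\<rfloor>" if "real (mi_order b) \<le> \<alpha>" for b :: "'d \<Rightarrow> nat"
    using that by (simp add: le_nat_floor)
  have first: "(SUP x\<in>Omega_tilde. ennreal \<bar>?T b i x\<bar>)
      \<le> (SUP x\<in>Omega_tilde. ennreal \<bar>?I b i x\<bar>) + ennreal E"
    if b: "real (mi_order b) \<le> \<alpha>" for b i
  proof (rule SUP_least)
    fix x :: "real ^ 'd" assume x: "x \<in> Omega_tilde"
    obtain \<kappa>' where \<kappa>': "\<And>l. \<kappa>' l < K" and
      eq: "?T b i x = ?I b i x + a * real k ^ mi_order b * D \<theta> \<kappa>' x"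
      using form[OF ord[OF b], of i] x by blast
    have "real k ^ mi_order b \<le> real k powr \<alpha>"
      using k1 b by (simp add: powr_realpow[symmetric] powr_mono)
    moreover have "\<bar>D \<theta> \<kappa>' x\<bar> \<le> 2 * real CARD('d) * B ^ CARD('d)"
    proof -
      have "\<bar>D \<theta> \<kappa>' x\<bar> \<le> B ^ CARD('d)" using \<kappa>' assms(3) by (intro D_bound) (auto intro: less_imp_le)
      also have "\<dots> \<le> 2 * real CARD('d) * B ^ CARD('d)"
        using d1 B mult_right_mono[of 1 "2 * real CARD('d)" "B ^ CARD('d)"] by linarith
      finally show ?thesis .
    qed
    ultimately have "(a * real k ^ mi_order b) * \<bar>D \<theta> \<kappa>' x\<bar> \<le> (a * real k powr \<alpha>) * (2 * real CARD('d) * B ^ CARD('d))"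
      using a0 by (intro mult_mono) auto
    moreover have "\<bar>a * real k ^ mi_order b * D \<theta> \<kappa>' x\<bar> = (a * real k ^ mi_order b) * \<bar>D \<theta> \<kappa>' x\<bar>"
      using a0 by (simp add: abs_mult)
    ultimately have "\<bar>?T b i x\<bar> \<le> \<bar>?I b i x\<bar> + E"
      unfolding eq E_def by (simp add: ac_simps)
    then have "ennreal \<bar>?T b i x\<bar> \<le> ennreal \<bar>?I b i x\<bar> + ennreal E"
      using E0 by (simp add: ennreal_plus[symmetric] ennreal_leI del: ennreal_plus)
    also have "\<dots> \<le> (SUP x\<in>Omega_tilde. ennreal \<bar>?I b i x\<bar>) + ennreal E"
      using x by (intro add_right_mono SUP_upper)
    finally show "ennreal \<bar>?T b i x\<bar>
      \<le> (SUP x\<in>Omega_tilde. ennreal \<bar>?I b i x\<bar>) + ennreal E" .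
  qed
  define \<Delta> where "\<Delta> = {(x :: real ^ 'd, y). x \<in> Omega_tilde \<and> y \<in> Omega_tilde \<and> x \<noteq> y}"
  define s where "s = \<alpha> - of_int \<lfloor>\<alpha>\<rfloor>"
  have s: "0 \<le> s" "s \<le> 1" unfolding s_def by linarith+
  define q where "q b f = (\<lambda>(x :: real ^ 'd, y). ennreal (\<bar>multi_partial b f x - multi_partial b f y\<bar> / norm (x - y) powr s))" for b f
  have second: "(SUP z\<in>\<Delta>. q b (\<lambda>z. tmap \<theta> z $ i) z) \<le> (SUP z\<in>\<Delta>. q b (\<lambda>z. z $ i) z) + ennreal E"
    if b: "int (mi_order b) = \<lfloor>\<alpha>\<rfloor>" for b i
  proof (rule SUP_least)
    fix z assume z: "z \<in> \<Delta>"
    obtain x y where z': "z = (x, y)" by (cases z)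
    have xy: "x \<in> Omega_tilde" "y \<in> Omega_tilde" "x \<noteq> y" using z by (auto simp: z' \<Delta>_def)
    have "mi_order b \<le> nat \<lfloor>\<alpha>\<rfloor>" using b by simp
    from form[OF this, of i] obtain \<kappa>' where \<kappa>': "\<And>l. \<kappa>' l < K" and
      eq: "\<And>x. x \<in> Omega_tilde \<Longrightarrow> ?T b i x = ?I b i x + a * real k ^ mi_order b * D \<theta> \<kappa>' x"
      by blast
    define n where "n = norm (x - y) powr s"
    have n: "0 < n" using xy by (simp add: n_def)
    have "real k ^ mi_order b * real k powr s = real k powr \<alpha>"
    proof -
      have "real k powr \<alpha> = real k powr (of_int \<lfloor>\<alpha>\<rfloor> + s)" by (simp add: s_def)
      also have "\<dots> = real k powr real (mi_order b) * real k powr s" using b by (simp add: powr_add) (metis of_int_of_nat_eq)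
      finally show ?thesis using k1 by (simp add: powr_realpow)
    qed
    then have kk: "a * real k ^ mi_order b * (2 * real CARD('d) * B ^ CARD('d) * (real k * norm (x - y)) powr s) = E * n"
      unfolding E_def n_def powr_mult using k1 by (simp add: powr_mult ac_simps)
    have "\<bar>a * real k ^ mi_order b * (D \<theta> \<kappa>' x - D \<theta> \<kappa>' y)\<bar> = a * real k ^ mi_order b * \<bar>D \<theta> \<kappa>' x - D \<theta> \<kappa>' y\<bar>"
      using a0 by (simp add: abs_mult)
    also have "\<dots> \<le> a * real k ^ mi_order b * (2 * real CARD('d) * B ^ CARD('d) * (real k * norm (x - y)) powr s)"
      using a0 s xy \<kappa>' assms(3) by (intro mult_left_mono D_hoelder) auto
    finally have "\<bar>a * real k ^ mi_order b * (D \<theta> \<kappa>' x - D \<theta> \<kappa>' y)\<bar> \<le> E * n" unfolding kk .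
    moreover have "?T b i x - ?T b i y
       = (?I b i x - ?I b i y) + a * real k ^ mi_order b * (D \<theta> \<kappa>' x - D \<theta> \<kappa>' y)"
      using eq xy by (simp add: algebra_simps)
    ultimately have "\<bar>?T b i x - ?T b i y\<bar>
      \<le> \<bar>?I b i x - ?I b i y\<bar> + E * n" by linarith
    then have "\<bar>?T b i x - ?T b i y\<bar> / n
      \<le> \<bar>?I b i x - ?I b i y\<bar> / n + E" using n by (simp add: field_simps)
    then have "q b (\<lambda>z. tmap \<theta> z $ i) z \<le> q b (\<lambda>z. z $ i) z + ennreal E"
      using E0 n unfolding q_def z' n_def[symmetric] prod.case
      by (simp add: ennreal_plus[symmetric] ennreal_leI del: ennreal_plus)
    also have "\<dots> \<le> (SUP z\<in>\<Delta>. q b (\<lambda>z. z $ i) z) + ennreal E"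
      using z by (intro add_right_mono SUP_upper)
    finally show "q b (\<lambda>z. tmap \<theta> z $ i) z \<le> (SUP z\<in>\<Delta>. q b (\<lambda>z. z $ i) z) + ennreal E" .
  qed
  have hn: "holder_norm \<alpha> T = (\<Sum>i\<in>UNIV.
      (\<Sum>b | real (mi_order b) \<le> \<alpha>. SUP x\<in>Omega_tilde. ennreal \<bar>multi_partial b (\<lambda>z. T z $ i) x\<bar>) +
      (\<Sum>b | int (mi_order b) = \<lfloor>\<alpha>\<rfloor>. SUP z\<in>\<Delta>. q b (\<lambda>z. T z $ i) z))" for T :: "real ^ 'd \<Rightarrow> real ^ 'd"
    by (simp add: holder_norm_def \<Delta>_def q_def s_def)
  define N1 where "N1 = card {b :: 'd \<Rightarrow> nat. real (mi_order b) \<le> \<alpha>}"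
  define N2 where "N2 = card {b :: 'd \<Rightarrow> nat. int (mi_order b) = \<lfloor>\<alpha>\<rfloor>}"
  have "holder_norm \<alpha> (tmap \<theta>) \<le> (\<Sum>i\<in>UNIV.
      (\<Sum>b | real (mi_order b) \<le> \<alpha>. (SUP x\<in>Omega_tilde. ennreal \<bar>?I b i x\<bar>) + ennreal E) +
      (\<Sum>b | int (mi_order b) = \<lfloor>\<alpha>\<rfloor>. (SUP z\<in>\<Delta>. q b (\<lambda>z. z $ i) z) + ennreal E))"
    unfolding hn using first second by (intro sum_mono add_mono) auto
  also have "\<dots> = holder_norm \<alpha> (\<lambda>x :: real ^ 'd. x) + of_nat CARD('d) * ((of_nat N1 + of_nat N2) * ennreal E)"
    unfolding hn by (simp add: sum.distrib N1_def N2_def algebra_simps)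
  also have "of_nat CARD('d) * ((of_nat N1 + of_nat N2) * ennreal E) = ennreal (holder_const \<alpha> TYPE('d) * (a * real k powr \<alpha>))"
    using E0 by (simp add: ennreal_of_nat_eq_real_of_nat ennreal_plus[symmetric] ennreal_mult[symmetric] del: ennreal_plus)
      (simp add: holder_const_def E_def N1_def N2_def ac_simps)
  finally show ?thesis .
qed

end


subsection \<open>The perturbed transport maps\<close>

lemma sum_abs_le_infnorm:
  fixes x :: "real ^ 'd"
  shows "(\<Sum>i\<in>UNIV. \<bar>x $ i\<bar>) \<le> real CARD('d) * infnorm x"
  using sum_bounded_above[of UNIV "\<lambda>i. \<bar>x $ i\<bar>" "infnorm x"] by (simp add: component_le_infnorm_cart)

text \<open>The quadratic form of \<open>G\<close> is at most g times the squared 1-norm of v, hence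
  by Cauchy-Schwarz at most d g times the squared Euclidean norm, which r absorbs.\<close>

lemma psd_perturbed_scalar:
  fixes A :: "real ^ 'd ^ 'd"
  assumes A: "\<And>i j. A $ i $ j = (if i = j then r else 0) + G i j"
    and G: "\<And>i j. G i j = G j i" "\<And>i j. \<bar>G i j\<bar> \<le> g" and r: "real CARD('d) * g \<le> r"
  shows "psd A"
  unfolding psd_def
proof (intro conjI allI)
  show "transpose A = A" using G(1) by (auto simp: transpose_def vec_eq_iff A)
  fix v :: "real ^ 'd"
  have g0: "0 \<le> g" using G(2)[of undefined undefined] by linarith
  have "v \<bullet> (A *v v) = (\<Sum>i\<in>UNIV. v $ i * (\<Sum>j\<in>UNIV. A $ i $ j * v $ j))"
    by (simp add: inner_vec_def matrix_vector_mult_def)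
  also have "\<dots> = (\<Sum>i\<in>UNIV. r * (v $ i)\<^sup>2 + (\<Sum>j\<in>UNIV. v $ i * G i j * v $ j))"
  proof (rule sum.cong[OF refl])
    fix i
    have "(\<Sum>j\<in>UNIV. A $ i $ j * v $ j) = (\<Sum>j\<in>UNIV. (if i = j then r * v $ j else 0)) + (\<Sum>j\<in>UNIV. G i j * v $ j)"
      unfolding sum.distrib[symmetric] by (intro sum.cong refl) (simp add: A algebra_simps)
    then show "v $ i * (\<Sum>j\<in>UNIV. A $ i $ j * v $ j) = r * (v $ i)\<^sup>2 + (\<Sum>j\<in>UNIV. v $ i * G i j * v $ j)"
      by (simp add: distrib_left sum_distrib_left power2_eq_square mult.assoc mult.left_commute)
  qed
  also have "\<dots> = r * (\<Sum>i\<in>UNIV. (v $ i)\<^sup>2) + (\<Sum>i\<in>UNIV. \<Sum>j\<in>UNIV. v $ i * G i j * v $ j)"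
    by (simp add: sum.distrib sum_distrib_left)
  finally have eq: "v \<bullet> (A *v v) = r * (\<Sum>i\<in>UNIV. (v $ i)\<^sup>2) + (\<Sum>i\<in>UNIV. \<Sum>j\<in>UNIV. v $ i * G i j * v $ j)" .
  have "\<bar>\<Sum>i\<in>UNIV. \<Sum>j\<in>UNIV. v $ i * G i j * v $ j\<bar> \<le> (\<Sum>i\<in>UNIV. \<Sum>j\<in>UNIV. \<bar>v $ i\<bar> * g * \<bar>v $ j\<bar>)"
    using G(2) g0 by (intro order_trans[OF sum_abs] sum_mono) (auto simp: abs_mult intro!: mult_mono)
  also have "\<dots> = g * (\<Sum>i\<in>UNIV. \<bar>v $ i\<bar>)\<^sup>2"
    by (simp add: power2_eq_square sum_product sum_distrib_left sum_distrib_right ac_simps)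
  also have "\<dots> \<le> g * ((\<Sum>i\<in>UNIV. \<bar>v $ i\<bar>\<^sup>2) * real CARD('d))"
    using g0 by (intro mult_left_mono sum_squared_le_sum_of_squares) auto
  also have "\<dots> = (real CARD('d) * g) * (\<Sum>i\<in>UNIV. (v $ i)\<^sup>2)" by simp
  also have "\<dots> \<le> r * (\<Sum>i\<in>UNIV. (v $ i)\<^sup>2)"
    using r by (intro mult_right_mono sum_nonneg) auto
  finally show "0 \<le> v \<bullet> (A *v v)" unfolding eq by linarith
qed

text \<open>On a segment the function has a nondecreasing derivative, which reduces the claim to one
  real variable.\<close>

lemma convex_on_of_monotone_gradient:
  fixes f :: "'a::euclidean_space \<Rightarrow> real"
  assumes "convex S" and f: "\<And>x. (f has_derivative (\<lambda>h. g x \<bullet> h)) (at x)"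
    and mono: "\<And>x y. 0 \<le> (g x - g y) \<bullet> (x - y)"
  shows "convex_on S f"
proof (rule convex_onI[OF _ assms(1)])
  fix t :: real and x y :: 'a assume t: "0 < t" "t < 1"
  define p where "p s = x + s *\<^sub>R (y - x)" for s :: real
  have "convex_on UNIV (\<lambda>s. f (p s))"
  proof (rule convex_on_realI)
    show "((\<lambda>s. f (p s)) has_real_derivative g (p s) \<bullet> (y - x)) (at s)" for s
    proof -
      have "(p has_derivative (\<lambda>h. h *\<^sub>R (y - x))) (at s)"
        unfolding p_def[abs_def] by (auto intro!: derivative_eq_intros)
      from has_derivative_compose[OF this f] show ?thesis
        unfolding has_field_derivative_def by (rule has_derivative_eq_rhs) (simp add: fun_eq_iff)
    qed
    show "g (p s) \<bullet> (y - x) \<le> g (p s') \<bullet> (y - x)" if "s \<le> s'" for s s'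
    proof (cases "s = s'")
      case False
      have "0 \<le> (g (p s') - g (p s)) \<bullet> (p s' - p s)" by (rule mono)
      also have "p s' - p s = (s' - s) *\<^sub>R (y - x)" by (simp add: p_def algebra_simps)
      finally show ?thesis using that False by (simp add: inner_diff_left zero_le_mult_iff)
    qed simp
  qed simp
  from convex_onD[OF this, of t 0 1] t
  have "f (p t) \<le> (1 - t) * f (p 0) + t * f (p 1)" by simp
  then show "f ((1 - t) *\<^sub>R x + t *\<^sub>R y) \<le> (1 - t) * f x + t * f y"
    by (simp add: p_def algebra_simps)
qed

section \<open>Bijectivity, potential and Hessian of the perturbed identity\<close>

context bump
begin

text \<open>A Lipschitz constant, in the maximum norm, of the displacement.\<close>

definition \<eta> :: "'d::finite itself \<Rightarrow> real"
  where "\<eta> _ = real CARD('d) * (a * real k * B ^ CARD('d))"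

definition pot :: "('d::finite \<Rightarrow> nat) set \<Rightarrow> real ^ 'd \<Rightarrow> real"
  where "pot \<theta> x = x \<bullet> x / 2 + a / real k * D \<theta> (\<lambda>_. 0) x"

lemma eta_nonneg: "0 \<le> \<eta> TYPE('d::finite)"
  using a0 B1 by (simp add: \<eta>_def)

lemma shift_component_lipschitz:
  fixes x y :: "real ^ 'd"
  assumes "finite \<theta>"
  shows "\<bar>shift \<theta> x $ i - shift \<theta> y $ i\<bar> \<le> \<eta> TYPE('d) * infnorm (x - y)"
proof -
  have "\<bar>shift \<theta> x $ i - shift \<theta> y $ i\<bar> = a * \<bar>D \<theta> (unit_index i) x - D \<theta> (unit_index i) y\<bar>"
    using a0 by (simp add: shift_def abs_mult flip: right_diff_distrib)
  also have "\<dots> \<le> a * (real k * B ^ CARD('d) * (\<Sum>i\<in>UNIV. \<bar>x $ i - y $ i\<bar>))"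
    using a0 assms unit_index_less by (intro mult_left_mono D_lipschitz) auto
  also have "\<dots> \<le> a * (real k * B ^ CARD('d) * (real CARD('d) * infnorm (x - y)))"
    using a0 B1 sum_abs_le_infnorm[of "x - y"] by (intro mult_left_mono) auto
  finally show ?thesis by (simp add: \<eta>_def ac_simps)
qed

lemma shift_infnorm_lipschitz:
  fixes x y :: "real ^ 'd"
  assumes "finite \<theta>"
  shows "infnorm (shift \<theta> x - shift \<theta> y) \<le> \<eta> TYPE('d) * infnorm (x - y)"
  using shift_component_lipschitz[OF assms] by (simp add: infnorm_le_iff_cart)

text \<open>Passing from the maximum norm to the Euclidean norm costs a factor d, which explains the
  hypothesis on \<open>\<eta>\<close>. The contraction factor 1/2 serves for bijectivity and for
  monotonicity.\<close>

lemma shift_norm_lipschitz: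
  fixes x y :: "real ^ 'd"
  assumes "finite \<theta>" "2 * real CARD('d) * \<eta> TYPE('d) \<le> 1"
  shows "norm (shift \<theta> x - shift \<theta> y) \<le> norm (x - y) / 2"
proof -
  have "norm (shift \<theta> x - shift \<theta> y) \<le> (\<Sum>i\<in>UNIV. \<bar>(shift \<theta> x - shift \<theta> y) $ i\<bar>)"
    by (rule norm_le_l1_cart)
  also have "\<dots> \<le> real CARD('d) * infnorm (shift \<theta> x - shift \<theta> y)" by (rule sum_abs_le_infnorm)
  also have "\<dots> \<le> real CARD('d) * (\<eta> TYPE('d) * norm (x - y))"
    using shift_infnorm_lipschitz[OF assms(1), of x y] eta_nonneg infnorm_le_norm[of "x - y"]
    by (intro mult_left_mono) (auto intro: order_trans mult_left_mono)
  also have "\<dots> = (2 * real CARD('d) * \<eta> TYPE('d)) * (norm (x - y) / 2)" by simp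
  also have "\<dots> \<le> norm (x - y) / 2" using mult_right_mono[OF assms(2), of "norm (x - y) / 2"] by simp
  finally show ?thesis .
qed

lemma tmap_outside:
  assumes "\<theta> \<subseteq> cells k" "\<not> (\<forall>i. 0 < x $ i \<and> x $ i < 1)"
  shows "tmap \<theta> x = x"
proof -
  have "D \<theta> (unit_index i) x = 0" for i
    by (rule D_eq_0_boundary[of "unit_index i"]) (simp_all only: assms unit_index_le not_False_eq_True)
  then show ?thesis by (simp add: tmap_def shift_def vec_eq_iff)
qed

lemma tmap_infnorm_le:
  fixes x y :: "real ^ 'd"
  assumes "finite \<theta>"
  shows "infnorm (tmap \<theta> x - tmap \<theta> y) \<le> (1 + \<eta> TYPE('d)) * infnorm (x - y)"
proof -
  have "tmap \<theta> x - tmap \<theta> y = (x - y) + (shift \<theta> x - shift \<theta> y)" by (simp add: tmap_def)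
  then have "infnorm (tmap \<theta> x - tmap \<theta> y) \<le> infnorm (x - y) + infnorm (shift \<theta> x - shift \<theta> y)"
    by (simp only: infnorm_triangle)
  then show ?thesis
    using shift_infnorm_lipschitz[OF assms, of x y] by (simp only: distrib_right mult_1)
qed

lemma tmap_infnorm_ge:
  fixes x y :: "real ^ 'd"
  assumes "finite \<theta>"
  shows "(1 - \<eta> TYPE('d)) * infnorm (x - y) \<le> infnorm (tmap \<theta> x - tmap \<theta> y)"
proof -
  have "x - y = (tmap \<theta> x - tmap \<theta> y) + (shift \<theta> y - shift \<theta> x)" by (simp add: tmap_def)
  then have "infnorm (x - y) \<le> infnorm (tmap \<theta> x - tmap \<theta> y) + infnorm (shift \<theta> y - shift \<theta> x)"
    by (metis infnorm_triangle)
  then show ?thesis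
    using shift_infnorm_lipschitz[OF assms, of y x] unfolding infnorm_sub[of y x]
    by (simp only: left_diff_distrib mult_1)
qed

lemma tmap_monotone:
  fixes x y :: "real ^ 'd"
  assumes "finite \<theta>" "2 * real CARD('d) * \<eta> TYPE('d) \<le> 1"
  shows "(norm (x - y))\<^sup>2 / 2 \<le> (tmap \<theta> x - tmap \<theta> y) \<bullet> (x - y)"
proof -
  have "(tmap \<theta> x - tmap \<theta> y) \<bullet> (x - y) = (norm (x - y))\<^sup>2 + (shift \<theta> x - shift \<theta> y) \<bullet> (x - y)"
    by (simp add: tmap_def power2_norm_eq_inner algebra_simps)
  moreover have "\<bar>(shift \<theta> x - shift \<theta> y) \<bullet> (x - y)\<bar> \<le> norm (x - y) / 2 * norm (x - y)"
    using Cauchy_Schwarz_ineq2[of "shift \<theta> x - shift \<theta> y" "x - y"] shift_norm_lipschitz[OF assms, of x y]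
    by (meson mult_right_mono norm_ge_zero order_trans)
  ultimately show ?thesis by (simp add: power2_eq_square)
qed

text \<open>Solving tmap x = y means finding a fixed point of the contraction x -> y - shift
  x.\<close>

lemma tmap_bij:
  assumes "finite \<theta>" "2 * real CARD('d) * \<eta> TYPE('d) \<le> 1"
  shows "bij (tmap \<theta> :: real ^ 'd \<Rightarrow> real ^ 'd)"
proof -
  have "\<exists>!x. tmap \<theta> x = y" for y :: "real ^ 'd"
  proof -
    have "\<exists>!x. y - shift \<theta> x = x"
      using shift_norm_lipschitz[OF assms]
      by (intro banach_fix_type[of "1/2"]) (auto simp: dist_norm norm_minus_commute)
    moreover have "y - shift \<theta> x = x \<longleftrightarrow> tmap \<theta> x = y" for x by (auto simp: tmap_def algebra_simps)
    ultimately show ?thesis by simp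
  qed
  then show ?thesis by (simp add: bij_iff)
qed

text \<open>Points outside \<open>Omega\<close> are fixed. If the image of x lies outside, it is its
  own image, and injectivity makes it equal to x.\<close>

lemma tmap_Omega_iff:
  fixes x :: "real ^ 'd"
  assumes "\<theta> \<subseteq> cells k" "2 * real CARD('d) * \<eta> TYPE('d) \<le> 1"
  shows "tmap \<theta> x \<in> Omega \<longleftrightarrow> x \<in> Omega"
proof -
  have fin: "finite \<theta>" using assms(1) by (rule finite_subset) simp
  have *: "tmap \<theta> x = x" if "x \<notin> Omega" for x :: "real ^ 'd"
  proof (rule tmap_outside[OF assms(1)])
    show "\<not> (\<forall>i. 0 < x $ i \<and> x $ i < 1)" using that by (meson Omega_iff less_imp_le)
  qed
  show ?thesis
    using *[of x] *[of "tmap \<theta> x"] bij_is_inj[OF tmap_bij[OF fin assms(2)]] by (metis injD)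
qed

lemma continuous_on_tmap: "continuous_on S (tmap \<theta>)"
  unfolding tmap_def[abs_def] shift_def
  by (intro continuous_intros continuous_on_vec_lambda D_continuous_on) (rule unit_index_less)

text \<open>Strong monotonicity of the map makes its inverse Lipschitz with constant 2.\<close>

lemma continuous_on_inv_tmap:
  fixes S :: "(real ^ 'd) set"
  assumes "finite \<theta>" "2 * real CARD('d) * \<eta> TYPE('d) \<le> 1"
  shows "continuous_on S (inv (tmap \<theta>))"
proof -
  have "norm (inv (tmap \<theta>) x - inv (tmap \<theta>) y) \<le> 2 * norm (x - y)" for x y :: "real ^ 'd"
  proof -
    define x' y' where "x' = inv (tmap \<theta>) x" and "y' = inv (tmap \<theta>) y"
    have xy: "x = tmap \<theta> x'" "y = tmap \<theta> y'"
      using bij_is_surj[OF tmap_bij[OF assms]] by (simp_all add: x'_def y'_def surj_f_inv_f)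
    have "(norm (x' - y'))\<^sup>2 / 2 \<le> norm (x - y) * norm (x' - y')"
      using tmap_monotone[OF assms, of x' y'] norm_cauchy_schwarz[of "x - y" "x' - y'"] by (simp add: xy)
    then have "norm (x' - y') * norm (x' - y') \<le> (2 * norm (x - y)) * norm (x' - y')"
      by (simp add: power2_eq_square)
    then have "norm (x' - y') \<le> 2 * norm (x - y)"
      by (cases "norm (x' - y') = 0") (auto simp: mult_le_cancel_right)
    then show ?thesis by (simp add: x'_def y'_def)
  qed
  then have "2-lipschitz_on S (inv (tmap \<theta>))" by (intro lipschitz_onI) (auto simp: dist_norm)
  then show ?thesis by (rule lipschitz_on_continuous_on)
qed

lemma pot_has_derivative:
  "(pot \<theta> has_derivative (\<lambda>h. tmap \<theta> x \<bullet> h)) (at x within S)"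
proof -
  have "((\<lambda>x. x \<bullet> x / 2) has_derivative (\<lambda>h. x \<bullet> h)) (at x within S)"
    by (auto intro!: derivative_eq_intros simp: inner_commute)
  moreover have "((\<lambda>x. a / real k * D \<theta> (\<lambda>_. 0) x) has_derivative
     (\<lambda>h. a / real k * (\<Sum>i\<in>UNIV. h $ i * (real k * D \<theta> ((\<lambda>_. 0)(i := Suc 0)) x)))) (at x within S)"
    using D_has_derivative[of "\<lambda>_. 0" \<theta> x S] K2 by (intro has_derivative_mult_right) auto
  ultimately have "(pot \<theta> has_derivative (\<lambda>h. x \<bullet> h + a / real k * (\<Sum>i\<in>UNIV. h $ i * (real k * D \<theta> ((\<lambda>_. 0)(i := Suc 0)) x)))) (at x within S)"
    unfolding pot_def[abs_def] by (rule has_derivative_add)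
  moreover have "x \<bullet> h + a / real k * (\<Sum>i\<in>UNIV. h $ i * (real k * D \<theta> ((\<lambda>_. 0)(i := Suc 0)) x)) = tmap \<theta> x \<bullet> h" for h
  proof -
    have "shift \<theta> x \<bullet> h = (\<Sum>i\<in>UNIV. a * D \<theta> (unit_index i) x * h $ i)" by (simp add: shift_def inner_vec_def)
    also have "\<dots> = (\<Sum>i\<in>UNIV. a / real k * (h $ i * (real k * D \<theta> (unit_index i) x)))"
      using k1 by (intro sum.cong) auto
    finally show ?thesis by (simp add: tmap_def inner_add_left sum_distrib_left unit_index_def)
  qed
  ultimately show ?thesis by simp
qed

lemma pot_convex:
  fixes S :: "(real ^ 'd) set"
  assumes "finite \<theta>" "2 * real CARD('d) * \<eta> TYPE('d) \<le> 1" "convex S"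
  shows "convex_on S (pot \<theta>)"
  using pot_has_derivative
  by (rule convex_on_of_monotone_gradient[OF assms(3)]) (rule order_trans[OF _ tmap_monotone[OF assms(1,2)]], simp)

text \<open>Symmetry is visible in the formula: the index \<open>\<kappa> i j\<close> only counts
  derivatives and forgets their order.\<close>

lemma pot_hessian:
  fixes x :: "real ^ 'd"
  assumes "x \<in> Omega_tilde" "finite \<theta>"
  shows "\<exists>G. (\<forall>i j. hessian (pot \<theta>) x $ i $ j = (if i = j then 1 else 0) + G i j) \<and>
    (\<forall>i j. G i j = G j i) \<and> (\<forall>i j. \<bar>G i j\<bar> \<le> a * real k * B ^ CARD('d))"
proof -
  define \<kappa> where "\<kappa> i j = (unit_index j)(i := Suc (unit_index j i))" for i j :: 'd
  have 1: "partial j (pot \<theta>) z = tmap \<theta> z $ j" if "z \<in> Omega_tilde" for j and z :: "real ^ 'd"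
    using partial_eq[OF that pot_has_derivative] by (simp add: inner_axis)
  have "hessian (pot \<theta>) x $ i $ j = (if i = j then 1 else 0) + a * real k * D \<theta> (\<kappa> i j) x" for i j
  proof -
    have "hessian (pot \<theta>) x $ i $ j = partial i (\<lambda>z. tmap \<theta> z $ j) x"
      unfolding hessian_def using partial_cong[OF 1 assms(1), where i=i] by simp
    also have "\<dots> = axis j 1 $ i + a * real k * D \<theta> (\<kappa> i j) x"
      unfolding tmap_component \<kappa>_def by (rule partial_affine_D[of "unit_index j", OF _ assms(1)]) (rule unit_index_less)
    finally show ?thesis by (simp add: axis_def)
  qed
  moreover have "\<kappa> i j = \<kappa> j i" for i j by (auto simp: \<kappa>_def unit_index_def fun_eq_iff)
  then have "a * real k * D \<theta> (\<kappa> i j) x = a * real k * D \<theta> (\<kappa> j i) x" for i j by simp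
  moreover have "\<bar>D \<theta> (\<kappa> i j) x\<bar> \<le> B ^ CARD('d)" for i j
    using K2 assms(2) by (intro D_bound) (auto simp: \<kappa>_def unit_index_def)
  then have "\<bar>a * real k * D \<theta> (\<kappa> i j) x\<bar> \<le> a * real k * B ^ CARD('d)" for i j
    using a0 by (simp add: abs_mult mult_left_mono)
  ultimately show ?thesis by (intro exI[of _ "\<lambda>i j. a * real k * D \<theta> (\<kappa> i j) x"]) blast
qed

text \<open>The Hessian differs from the identity by a symmetric matrix of quadratic form at most
  1/2, while M > 2 leaves room 1 - 1/M > 1/2 below and M - 1 > 1 above. Coordinates on the enlarged
  cube are at most 2, so the displacement may use up M - 2.\<close>

lemma tmap_in_transport_maps:
  fixes P :: "(real ^ 'd) measure"
  assumes "finite \<theta>" "2 < M" "2 * real CARD('d) * \<eta> TYPE('d) \<le> 1" "a * B ^ CARD('d) \<le> M - 2"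
    and P: "measure (pushforward P (tmap \<theta>)) Omega = 1"
  shows "tmap \<theta> \<in> transport_maps M P"
proof -
  have d1: "1 \<le> real CARD('d)" by (simp add: Suc_leI)
  then have "\<eta> TYPE('d) \<le> real CARD('d) * \<eta> TYPE('d)"
    using mult_right_mono[OF d1 eta_nonneg] by simp
  then have \<eta>: "\<eta> TYPE('d) \<le> 1/2" using assms(3) by linarith
  have "(tmap \<theta>) differentiable_on (Omega_tilde :: (real ^ 'd) set)"
  proof -
    have "(\<lambda>x. tmap \<theta> x $ i) differentiable (at x within Omega_tilde)" for x :: "real ^ 'd" and i
      unfolding tmap_component differentiable_def
      by (rule exI, rule affine_D_has_derivative[of "unit_index i"]) (rule unit_index_less)
    then show ?thesis unfolding differentiable_on_def differentiable_componentwise_within[of "tmap \<theta>"]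
      by (auto simp: Basis_vec_def inner_axis)
  qed
  moreover have "infnorm (tmap \<theta> x) \<le> M" if "x \<in> Omega_tilde" for x :: "real ^ 'd"
    unfolding infnorm_le_iff_cart
  proof
    fix i
    have "\<bar>x $ i\<bar> \<le> 2" using that by (auto simp: Omega_tilde_iff abs_le_iff) (smt (verit))
    moreover have "\<bar>shift \<theta> x $ i\<bar> \<le> a * B ^ CARD('d)"
    proof -
      have "\<bar>D \<theta> (unit_index i) x\<bar> \<le> B ^ CARD('d)" by (rule D_bound[of "unit_index i", OF unit_index_le assms(1)])
      then show ?thesis using a0 by (simp add: shift_def abs_mult mult_left_mono)
    qed
    ultimately show "\<bar>tmap \<theta> x $ i\<bar> \<le> M" using assms(4) by (simp add: tmap_def)
  qed
  moreover have "convex_on Omega_tilde (pot \<theta> :: real ^ 'd \<Rightarrow> real)"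
    by (rule pot_convex[OF assms(1,3)]) (simp add: Omega_tilde_def convex_box)
  moreover have "loewner_le (mat (1 / M)) (hessian (pot \<theta>) x) \<and> loewner_le (hessian (pot \<theta>) x) (mat M)"
    if x: "x \<in> Omega_tilde" for x :: "real ^ 'd"
  proof -
    obtain G where G: "\<And>i j. hessian (pot \<theta>) x $ i $ j = (if i = j then 1 else 0) + G i j"
      "\<And>i j. G i j = G j i" "\<And>i j. \<bar>G i j\<bar> \<le> a * real k * B ^ CARD('d)"
      using pot_hessian[OF x assms(1)] by blast
    have M: "1 / M \<le> 1/2" using assms(2) by (simp add: field_simps)
    show ?thesis
      unfolding loewner_le_def
    proof
      show "psd (hessian (pot \<theta>) x - mat (1 / M))"
        by (rule psd_perturbed_scalar[where r="1 - 1/M" and G=G, OF _ G(2,3)])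
          (use M \<eta> in \<open>auto simp: G(1) mat_def \<eta>_def\<close>)
      show "psd (mat M - hessian (pot \<theta>) x)"
        by (rule psd_perturbed_scalar[where r="M - 1" and G="\<lambda>i j. - G i j" and g="a * real k * B ^ CARD('d)"])
          (use assms(2) \<eta> G in \<open>auto simp: G(1) mat_def \<eta>_def\<close>)
    qed
  qed
  ultimately show ?thesis
    unfolding transport_maps_def using P pot_has_derivative[of \<theta> _ Omega_tilde] by blast
qed

end


subsection \<open>The source measures\<close>

text \<open>A convex function lies below its chord, here the one from 1 at h = 0 to 2^n at h = 1.
  This is the origin of the factor 2^d in the density bounds.\<close>

lemma power_one_plus_le:
  fixes h :: real
  assumes "0 \<le> h" "h \<le> 1"
  shows "(1 + h) ^ n \<le> 1 + (2 ^ n - 1) * h"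
proof (induction n)
  case (Suc n)
  have "(1 + h) ^ Suc n \<le> (1 + h) * (1 + (2 ^ n - 1) * h)"
    using Suc assms by (simp add: mult_left_mono)
  also have "\<dots> = 1 + 2 ^ n * h + (2 ^ n - 1) * (h * h)" by (simp add: algebra_simps)
  also have "\<dots> \<le> 1 + 2 ^ n * h + (2 ^ n - 1) * (h * 1)"
    using assms by (intro add_left_mono mult_left_mono) auto
  finally show ?case by (simp add: algebra_simps)
qed simp

definition uniform_Omega :: "(real ^ 'd) measure"
  where "uniform_Omega = density lborel (indicator Omega)"

lemma Omega_borel [measurable]: "Omega \<in> sets borel"
  and Omega_tilde_borel [measurable]: "Omega_tilde \<in> sets borel"
  by (simp_all add: Omega_def Omega_tilde_def)

lemma emeasure_lborel_Omega: "emeasure lborel (Omega :: (real ^ 'd) set) = 1"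
  unfolding Omega_def by (subst emeasure_cube[where s=1]) auto

lemma norm_le_of_Omega:
  fixes x :: "real ^ 'd"
  assumes "x \<in> Omega"
  shows "norm x \<le> real CARD('d)"
proof -
  have "\<bar>x $ i\<bar> \<le> 1" for i using assms by (simp add: Omega_iff)
  then have "(\<Sum>i\<in>UNIV. \<bar>x $ i\<bar>) \<le> (\<Sum>i\<in>(UNIV :: 'd set). 1)" by (intro sum_mono)
  then show ?thesis using norm_le_l1_cart[of x] by simp
qed

lemma emeasure_uniform_Omega: "B \<in> sets borel \<Longrightarrow> emeasure uniform_Omega B = emeasure lborel (B \<inter> Omega)"
  unfolding uniform_Omega_def by (subst emeasure_restricted) (simp_all add: Int_commute)

lemma sets_uniform_Omega [simp, measurable_cong]: "sets uniform_Omega = sets borel"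
  by (simp add: uniform_Omega_def)

lemma space_uniform_Omega [simp]: "space uniform_Omega = UNIV"
  by (simp add: uniform_Omega_def)

lemma Omega_subset_tilde: "Omega \<subseteq> Omega_tilde"
proof
  fix x :: "real ^ 'd"
  assume "x \<in> Omega"
  then have "0 \<le> x $ i \<and> x $ i \<le> 1" for i by (simp add: Omega_def mem_box_cart)
  then have "-1 \<le> x $ i \<and> x $ i \<le> 2" for i by (smt (verit))
  then show "x \<in> Omega_tilde" by (simp add: Omega_tilde_iff)
qed

section \<open>Two-sided bounds for the source densities\<close>

context bump
begin

definition source :: "('d::finite \<Rightarrow> nat) set \<Rightarrow> (real ^ 'd) measure"
  where "source \<theta> = distr uniform_Omega borel (inv (tmap \<theta>))"

text \<open>Chosen so that the density bounds stay between 1/2 and 3/2; since d <= 2^d it also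
  implies the contraction condition on \<open>\<eta>\<close>.\<close>

definition small :: "'d::finite itself \<Rightarrow> bool"
  where "small _ \<longleftrightarrow> 2 * 2 ^ CARD('d) * \<eta> TYPE('d) \<le> 1"

text \<open>A linear minorant of (1-\<eta>)^d; \<open>dens_hi\<close> is the corresponding majorant
  of (1+\<eta>)^d. The symmetric form makes their difference a plain multiple of \<eta>.\<close>

definition dens_lo :: "'d::finite itself \<Rightarrow> real"
  where "dens_lo _ = 1 - 2 ^ CARD('d) * \<eta> TYPE('d)"

definition dens_hi :: "'d::finite itself \<Rightarrow> real"
  where "dens_hi _ = 1 + 2 ^ CARD('d) * \<eta> TYPE('d)"

lemma small_imp:
  assumes "small TYPE('d::finite)"
  shows "2 * real CARD('d) * \<eta> TYPE('d) \<le> 1" "\<eta> TYPE('d) \<le> 1/2"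
    "1/2 \<le> dens_lo TYPE('d)" "dens_hi TYPE('d) \<le> 3/2" "dens_lo TYPE('d) \<le> dens_hi TYPE('d)"
proof -
  have e: "0 \<le> \<eta> TYPE('d)" by (rule eta_nonneg)
  have "real CARD('d) \<le> 2 ^ CARD('d)" using of_nat_less_two_power[of "CARD('d)"] by simp
  from mult_right_mono[OF this e] show 1: "2 * real CARD('d) * \<eta> TYPE('d) \<le> 1"
    using assms by (simp add: small_def)
  have "1 \<le> real CARD('d)" by (simp add: Suc_leI)
  from mult_right_mono[OF this e] 1 show "\<eta> TYPE('d) \<le> 1/2" by simp
  show "1/2 \<le> dens_lo TYPE('d)" "dens_hi TYPE('d) \<le> 3/2" "dens_lo TYPE('d) \<le> dens_hi TYPE('d)"
    using assms e by (auto simp: small_def dens_lo_def dens_hi_def)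
qed

lemma sets_source: "sets (source \<theta>) = sets borel"
  by (simp add: source_def)

lemma measurable_tmap [measurable]: "tmap \<theta> \<in> borel_measurable borel"
  by (intro borel_measurable_continuous_onI continuous_on_tmap)

context
  fixes \<theta> :: "('d::finite \<Rightarrow> nat) set"
  assumes \<theta>: "\<theta> \<subseteq> cells k" and small: "small TYPE('d)"
begin

lemma finite_\<theta>: "finite \<theta>"
  using \<theta> by (rule finite_subset) simp

lemma measurable_inv_tmap [measurable]: "inv (tmap \<theta>) \<in> borel_measurable borel"
  by (intro borel_measurable_continuous_onI continuous_on_inv_tmap finite_\<theta> small_imp(1) small)

lemma bij_tmap: "bij (tmap \<theta>)"
  by (rule tmap_bij[OF finite_\<theta> small_imp(1)[OF small]])

lemma tmap_image_eq_vimage: "tmap \<theta> ` E = inv (tmap \<theta>) -` E"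
  using bij_tmap by (simp add: bij_vimage_eq_inv_image bij_imp_bij_inv inv_inv_eq)

lemma sets_tmap_image [measurable]: "E \<in> sets borel \<Longrightarrow> tmap \<theta> ` E \<in> sets borel"
  unfolding tmap_image_eq_vimage using measurable_sets[OF measurable_inv_tmap, of E] by simp

lemma tmap_image_Omega: "tmap \<theta> ` (E \<inter> Omega) = tmap \<theta> ` E \<inter> Omega"
  using tmap_Omega_iff[OF \<theta> small_imp(1)[OF small]] by auto

lemma emeasure_source:
  assumes [measurable]: "E \<in> sets borel"
  shows "emeasure (source \<theta>) E = emeasure lborel (tmap \<theta> ` (E \<inter> Omega))"
  unfolding source_def tmap_image_Omega
  by (subst emeasure_distr) (auto simp: emeasure_uniform_Omega tmap_image_eq_vimage measurable_sets_borel[OF measurable_inv_tmap])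

lemma emeasure_source_le:
  assumes [measurable]: "E \<in> sets borel"
  shows "emeasure (source \<theta>) E \<le> ennreal (dens_hi TYPE('d)) * emeasure lborel (E \<inter> Omega)"
proof -
  have e: "0 \<le> \<eta> TYPE('d)" "\<eta> TYPE('d) \<le> 1" using eta_nonneg small_imp(2)[OF small] by auto
  have "emeasure (source \<theta>) E \<le> ennreal ((1 + \<eta> TYPE('d)) ^ CARD('d)) * emeasure lborel (E \<inter> Omega)"
    unfolding emeasure_source[OF assms]
  proof (rule emeasure_lipschitz_image_le[where p=0 and q=1])
    show "E \<inter> Omega \<subseteq> cbox (vec 0) (vec 1)" by (simp add: Omega_def)
  qed (use e tmap_infnorm_le[OF finite_\<theta>] in auto)
  also have "(1 + \<eta> TYPE('d)) ^ CARD('d) \<le> dens_hi TYPE('d)"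
    using power_one_plus_le[OF e, of "CARD('d)"] e by (simp add: dens_hi_def algebra_simps)
  finally show ?thesis by (simp add: mult_right_mono ennreal_leI)
qed

text \<open>The covering bound is applied to the inverse map, with Lipschitz constant 1/(1-\<eta>);
  Bernoulli's inequality makes the resulting factor linear.\<close>

lemma emeasure_source_ge:
  assumes [measurable]: "E \<in> sets borel"
  shows "ennreal (dens_lo TYPE('d)) * emeasure lborel (E \<inter> Omega) \<le> emeasure (source \<theta>) E"
proof -
  define h where "h = \<eta> TYPE('d)"
  have e: "0 \<le> h" "h \<le> 1/2" using eta_nonneg small_imp(2)[OF small] by (auto simp: h_def)
  have inv: "inv (tmap \<theta>) ` tmap \<theta> ` (E \<inter> Omega) = E \<inter> Omega"
    using bij_is_inj[OF bij_tmap] by (simp add: image_image)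
  have "emeasure lborel (inv (tmap \<theta>) ` tmap \<theta> ` (E \<inter> Omega))
    \<le> ennreal ((1 / (1 - h)) ^ CARD('d)) * emeasure lborel (tmap \<theta> ` (E \<inter> Omega))"
  proof (rule emeasure_lipschitz_image_le[where p=0 and q=1])
    show "tmap \<theta> ` (E \<inter> Omega) \<subseteq> cbox (vec 0) (vec 1)"
      unfolding tmap_image_Omega by (simp add: Omega_def)
    show "inv (tmap \<theta>) ` tmap \<theta> ` (E \<inter> Omega) \<in> sets borel" unfolding inv by simp
    fix x y
    have "(1 - h) * infnorm (inv (tmap \<theta>) x - inv (tmap \<theta>) y) \<le> infnorm (x - y)"
      using tmap_infnorm_ge[OF finite_\<theta>, of "inv (tmap \<theta>) x" "inv (tmap \<theta>) y"] bij_is_surj[OF bij_tmap]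
      by (simp add: surj_f_inv_f h_def)
    then show "infnorm (inv (tmap \<theta>) x - inv (tmap \<theta>) y) \<le> 1 / (1 - h) * infnorm (x - y)"
      using e by (simp add: field_simps)
  qed (use e in auto)
  then have 1: "emeasure lborel (E \<inter> Omega) \<le> ennreal ((1 / (1 - h)) ^ CARD('d)) * emeasure (source \<theta>) E"
    unfolding inv emeasure_source[OF assms] .
  have "1 + real CARD('d) * (- h) \<le> (1 + - h) ^ CARD('d)"
    using e by (intro Bernoulli_inequality) auto
  moreover have "real CARD('d) * h \<le> 2 ^ CARD('d) * h"
    using e of_nat_less_two_power[of "CARD('d)", where 'a=real] by (intro mult_right_mono) auto
  ultimately have "dens_lo TYPE('d) \<le> (1 - h) ^ CARD('d)" by (simp add: dens_lo_def h_def)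
  then have "ennreal (dens_lo TYPE('d)) * emeasure lborel (E \<inter> Omega)
    \<le> ennreal ((1 - h) ^ CARD('d)) * (ennreal ((1 / (1 - h)) ^ CARD('d)) * emeasure (source \<theta>) E)"
    using 1 by (intro mult_mono ennreal_leI) auto
  also have "\<dots> = emeasure (source \<theta>) E"
    using e by (simp add: mult.assoc[symmetric] ennreal_mult'[symmetric] power_mult_distrib[symmetric])
  finally show ?thesis .
qed

lemma pushforward_source: "pushforward (source \<theta>) (tmap \<theta>) = uniform_Omega"
proof (rule measure_eqI)
  fix E :: "(real ^ 'd) set" assume "E \<in> sets (pushforward (source \<theta>) (tmap \<theta>))"
  then have [measurable]: "E \<in> sets borel" by (simp add: pushforward_def)
  have [measurable]: "tmap \<theta> -` E \<in> sets borel" using measurable_sets[OF measurable_tmap[of \<theta>], of E] by simp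
  have s: "sets (source \<theta>) = sets borel" by (simp add: source_def)
  have "emeasure (pushforward (source \<theta>) (tmap \<theta>)) E = emeasure (restrict_space (source \<theta>) Omega_tilde) (tmap \<theta> -` E \<inter> Omega_tilde)"
    unfolding pushforward_def
    by (subst emeasure_distr) (auto intro!: measurable_restrict_space1 simp: space_restrict_space source_def)
  also have "\<dots> = emeasure (source \<theta>) (tmap \<theta> -` E \<inter> Omega_tilde)"
    by (subst emeasure_restrict_space) (auto simp: source_def)
  also have "\<dots> = emeasure lborel (tmap \<theta> ` (tmap \<theta> -` E \<inter> Omega))"
    using Omega_subset_tilde by (subst emeasure_source) (auto simp: Int_assoc Int_absorb1 intro!: arg_cong[where f="\<lambda>X. emeasure lborel (tmap \<theta> ` X)"])
  also have "tmap \<theta> ` (tmap \<theta> -` E \<inter> Omega) = E \<inter> Omega"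
    unfolding tmap_image_Omega using bij_is_surj[OF bij_tmap] by (simp add: surj_image_vimage_eq)
  finally show "emeasure (pushforward (source \<theta>) (tmap \<theta>)) E = emeasure uniform_Omega E"
    by (simp add: emeasure_uniform_Omega)
qed (simp add: pushforward_def)

lemma source_density:
  "\<exists>\<rho>. \<rho> \<in> borel_measurable borel \<and> source \<theta> = density lborel (\<lambda>x. ennreal (\<rho> x)) \<and>
    (\<forall>x\<in>Omega. dens_lo TYPE('d) \<le> \<rho> x \<and> \<rho> x \<le> dens_hi TYPE('d))"
proof (rule density_between_exists[of lborel "source \<theta>" Omega "dens_lo TYPE('d)" "dens_hi TYPE('d)"])
  show "emeasure lborel (Omega :: (real ^ 'd) set) \<noteq> \<infinity>" by (simp add: emeasure_lborel_Omega)
  show "0 \<le> dens_lo TYPE('d)" "dens_lo TYPE('d) \<le> dens_hi TYPE('d)" using small_imp[OF small] by auto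
  fix \<rho> :: "real ^ 'd \<Rightarrow> real"
  assume "\<rho> \<in> borel_measurable lborel" "source \<theta> = density lborel (\<lambda>x. ennreal (\<rho> x))"
    "\<And>x. x \<in> Omega \<Longrightarrow> dens_lo TYPE('d) \<le> \<rho> x \<and> \<rho> x \<le> dens_hi TYPE('d)"
  then show ?thesis by (intro exI[of _ \<rho>]) simp
qed (simp_all add: emeasure_source_le emeasure_source_ge lborel.sigma_finite_measure_axioms sets_source)

lemma prob_space_source: "prob_space (source \<theta>)"
  unfolding source_def
proof (rule prob_space.prob_space_distr)
  show "prob_space (uniform_Omega :: (real ^ 'd) measure)"
    by (rule prob_spaceI) (simp add: emeasure_uniform_Omega emeasure_lborel_Omega)
qed simp

lemma measure_source_Omega: "measure (source \<theta>) Omega = 1"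
proof -
  have "emeasure (source \<theta>) Omega = emeasure lborel (Omega :: (real ^ 'd) set)"
    using tmap_image_Omega[of UNIV] bij_is_surj[OF bij_tmap] by (simp add: emeasure_source)
  then show ?thesis by (simp add: measure_def emeasure_lborel_Omega)
qed

lemma source_in_measure_class:
  assumes "2 < M"
  shows "source \<theta> \<in> measure_class M"
proof -
  obtain \<rho> where \<rho>: "\<rho> \<in> borel_measurable borel" "source \<theta> = density lborel (\<lambda>x. ennreal (\<rho> x))"
    "\<And>x. x \<in> Omega \<Longrightarrow> dens_lo TYPE('d) \<le> \<rho> x \<and> \<rho> x \<le> dens_hi TYPE('d)"
    using source_density by blast
  have "1 / M \<le> \<rho> x \<and> \<rho> x \<le> M" if "x \<in> Omega" for x
  proof -
    have "1 / M \<le> 1/2" using assms by (simp add: field_simps)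
    then show ?thesis using \<rho>(3)[OF that] small_imp[OF small] assms by linarith
  qed
  then show ?thesis
    unfolding measure_class_def using \<rho>(1,2) prob_space_source measure_source_Omega by blast
qed

text \<open>The source density is at least 1/2 on \<open>Omega\<close>. Passing to Lebesgue measure
  gives all patterns one common loss.\<close>

lemma sq_dist_source_ge:
  assumes [measurable]: "S \<in> borel_measurable (restrict_space borel Omega)"
  shows "ennreal (1/2) * sq_dist lborel (tmap \<theta>) S \<le> sq_dist (source \<theta>) (tmap \<theta>) S"
proof -
  obtain \<rho> where [measurable]: "\<rho> \<in> borel_measurable borel" and \<rho>: "source \<theta> = density lborel (\<lambda>x. ennreal (\<rho> x))"
    "\<And>x. x \<in> Omega \<Longrightarrow> dens_lo TYPE('d) \<le> \<rho> x \<and> \<rho> x \<le> dens_hi TYPE('d)"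
    using source_density by blast
  have "(\<lambda>x. ennreal ((norm (tmap \<theta> x - S x))\<^sup>2)) \<in> borel_measurable (restrict_space borel Omega)"
  proof -
    have "(\<lambda>x. tmap \<theta> x - S x) \<in> borel_measurable (restrict_space borel Omega)"
      by (intro borel_measurable_diff assms measurable_restrict_space1 measurable_tmap)
    then show ?thesis by measurable
  qed
  then have m[measurable]: "(\<lambda>x. ennreal ((norm (tmap \<theta> x - S x))\<^sup>2) * indicator Omega x) \<in> borel_measurable borel"
    by (subst (asm) borel_measurable_restrict_space_iff_ennreal) auto
  have "ennreal (1/2) * sq_dist lborel (tmap \<theta>) S = (\<integral>\<^sup>+x. ennreal (1/2) * (ennreal ((norm (tmap \<theta> x - S x))\<^sup>2) * indicator Omega x) \<partial>lborel)"
    unfolding sq_dist_def using m by (subst nn_integral_cmult) auto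
  also have "\<dots> \<le> (\<integral>\<^sup>+x. ennreal (\<rho> x) * (ennreal ((norm (tmap \<theta> x - S x))\<^sup>2) * indicator Omega x) \<partial>lborel)"
  proof (rule nn_integral_mono)
    fix x
    show "ennreal (1/2) * (ennreal ((norm (tmap \<theta> x - S x))\<^sup>2) * indicator Omega x)
       \<le> ennreal (\<rho> x) * (ennreal ((norm (tmap \<theta> x - S x))\<^sup>2) * indicator Omega x)"
    proof (cases "x \<in> Omega")
      case True
      then have "ennreal (1/2) \<le> ennreal (\<rho> x)"
        using \<rho>(2)[OF True] small_imp(3)[OF small] by (intro ennreal_leI) linarith
      then show ?thesis by (intro mult_right_mono) auto
    qed simp
  qed
  also have "\<dots> = sq_dist (source \<theta>) (tmap \<theta>) S"
    unfolding sq_dist_def \<rho>(1) using m by (subst nn_integral_density) auto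
  finally show ?thesis .
qed

end

section \<open>Pairs of patterns that differ in one cell\<close>

lemma cell_borel [measurable]: "cell k j \<in> sets borel"
  by (simp add: cell_def)

lemma tmap_insert_outside:
  assumes "x \<notin> cell k j" "finite \<theta>"
  shows "tmap (insert j \<theta>) x = tmap \<theta> x"
proof -
  have "D (insert j \<theta>) (unit_index i) x = D \<theta> (unit_index i) x" for i
    by (rule D_insert_outside[of "unit_index i", OF unit_index_le assms])
  then show ?thesis by (simp add: tmap_def shift_def)
qed

lemma restrict_space_density_lborel:
  fixes f :: "real ^ 'd \<Rightarrow> ennreal"
  assumes [measurable]: "f \<in> borel_measurable borel"
  shows "restrict_space (density lborel f) Omega = density (restrict_space lborel Omega) f"
proof (rule measure_eqI)
  show "sets (restrict_space (density lborel f) Omega) = sets (density (restrict_space lborel Omega) f)"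
    by (simp add: sets_restrict_space)
  fix X assume "X \<in> sets (restrict_space (density lborel f) Omega)"
  then have X: "X \<subseteq> Omega" "X \<in> sets borel" by (auto simp: sets_restrict_space_iff)
  have X': "X \<in> sets (restrict_space lborel Omega)" using X by (simp add: sets_restrict_space_iff)
  have "emeasure (restrict_space (density lborel f) Omega) X = (\<integral>\<^sup>+x. f x * indicator X x \<partial>lborel)"
    using X by (subst emeasure_restrict_space) (auto simp: emeasure_density)
  also have "\<dots> = (\<integral>\<^sup>+x. f x * indicator X x * indicator Omega x \<partial>lborel)"
    using X by (intro nn_integral_cong) (auto simp: indicator_def)
  also have "\<dots> = (\<integral>\<^sup>+x. f x * indicator X x \<partial>restrict_space lborel Omega)"
    by (subst nn_integral_restrict_space) auto
  also have "\<dots> = emeasure (density (restrict_space lborel Omega) f) X"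
    using X' by (subst emeasure_density) (auto intro!: measurable_restrict_space1)
  finally show "emeasure (restrict_space (density lborel f) Omega) X = emeasure (density (restrict_space lborel Omega) f) X" .
qed

text \<open>Two independently chosen Radon-Nikodym densities agree off the cell only almost
  everywhere. The second one is therefore spliced from \<open>\<rho>2\<close> on the cell and
  \<open>\<rho>1\<close> elsewhere; this is again a density of the second source because the two
  maps coincide off the cell.\<close>

lemma source_pair_density:
  fixes \<theta> :: "('d::finite \<Rightarrow> nat) set"
  assumes \<theta>: "insert j \<theta> \<subseteq> cells k" and small: "small TYPE('d)"
  shows "\<exists>\<rho> \<rho>'. \<rho> \<in> borel_measurable (restrict_space lborel Omega) \<and> \<rho>' \<in> borel_measurable (restrict_space lborel Omega) \<and>
    restrict_space (source \<theta>) Omega = density (restrict_space lborel Omega) (\<lambda>x. ennreal (\<rho> x)) \<and>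
    restrict_space (source (insert j \<theta>)) Omega = density (restrict_space lborel Omega) (\<lambda>x. ennreal (\<rho>' x)) \<and>
    (\<forall>x\<in>Omega. dens_lo TYPE('d) \<le> \<rho> x \<and> \<rho> x \<le> dens_hi TYPE('d)) \<and>
    (\<forall>x\<in>Omega. dens_lo TYPE('d) \<le> \<rho>' x \<and> \<rho>' x \<le> dens_hi TYPE('d)) \<and>
    (\<forall>x. x \<notin> cell k j \<longrightarrow> \<rho> x = \<rho>' x)"
proof -
  have \<theta>': "\<theta> \<subseteq> cells k" using \<theta> by auto
  have fin: "finite \<theta>" using \<theta>' by (rule finite_subset) simp
  obtain \<rho>1 where [measurable]: "\<rho>1 \<in> borel_measurable borel" and \<rho>1: "source \<theta> = density lborel (\<lambda>x. ennreal (\<rho>1 x))"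
    "\<forall>x\<in>Omega. dens_lo TYPE('d) \<le> \<rho>1 x \<and> \<rho>1 x \<le> dens_hi TYPE('d)"
    using source_density[OF \<theta>' small] by blast
  obtain \<rho>2 where [measurable]: "\<rho>2 \<in> borel_measurable borel" and \<rho>2: "source (insert j \<theta>) = density lborel (\<lambda>x. ennreal (\<rho>2 x))"
    "\<forall>x\<in>Omega. dens_lo TYPE('d) \<le> \<rho>2 x \<and> \<rho>2 x \<le> dens_hi TYPE('d)"
    using source_density[OF \<theta> small] by blast
  define \<rho>' where "\<rho>' x = (if x \<in> cell k j then \<rho>2 x else \<rho>1 x)" for x
  have [measurable]: "\<rho>' \<in> borel_measurable borel" unfolding \<rho>'_def by measurable
  have eq: "source (insert j \<theta>) = density lborel (\<lambda>x. ennreal (\<rho>' x))"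
  proof (rule measure_eqI)
    fix X assume "X \<in> sets (source (insert j \<theta>))"
    then have [measurable]: "X \<in> sets borel" by (simp add: sets_source)
    let ?C = "cell k j"
    have "emeasure (source (insert j \<theta>)) (X - ?C) = emeasure (source \<theta>) (X - ?C)"
    proof -
      have "tmap (insert j \<theta>) ` ((X - ?C) \<inter> Omega) = tmap \<theta> ` ((X - ?C) \<inter> Omega)"
        using tmap_insert_outside[OF _ fin] by (intro image_cong) auto
      then show ?thesis by (simp add: emeasure_source[OF \<theta> small] emeasure_source[OF \<theta>' small])
    qed
    moreover have "emeasure (source (insert j \<theta>)) X = emeasure (source (insert j \<theta>)) (X \<inter> ?C) + emeasure (source (insert j \<theta>)) (X - ?C)"
      by (subst plus_emeasure) (auto simp: sets_source intro!: arg_cong[where f="emeasure _"])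
    ultimately have "emeasure (source (insert j \<theta>)) X = emeasure (source (insert j \<theta>)) (X \<inter> ?C) + emeasure (source \<theta>) (X - ?C)"
      by simp
    also have "\<dots> = (\<integral>\<^sup>+x. ennreal (\<rho>2 x) * indicator (X \<inter> ?C) x \<partial>lborel) + (\<integral>\<^sup>+x. ennreal (\<rho>1 x) * indicator (X - ?C) x \<partial>lborel)"
      unfolding \<rho>1(1) \<rho>2(1) by (simp add: emeasure_density)
    also have "\<dots> = (\<integral>\<^sup>+x. ennreal (\<rho>2 x) * indicator (X \<inter> ?C) x + ennreal (\<rho>1 x) * indicator (X - ?C) x \<partial>lborel)"
      by (subst nn_integral_add) auto
    also have "\<dots> = (\<integral>\<^sup>+x. ennreal (\<rho>' x) * indicator X x \<partial>lborel)"
      by (intro nn_integral_cong) (auto simp: \<rho>'_def indicator_def)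
    also have "\<dots> = emeasure (density lborel (\<lambda>x. ennreal (\<rho>' x))) X" by (simp add: emeasure_density)
    finally show "emeasure (source (insert j \<theta>)) X = emeasure (density lborel (\<lambda>x. ennreal (\<rho>' x))) X" .
  qed (simp add: sets_source)
  show ?thesis
  proof (rule exI[of _ \<rho>1], rule exI[of _ \<rho>'], intro conjI)
    show "\<rho>1 \<in> borel_measurable (restrict_space lborel Omega)" by (auto intro!: measurable_restrict_space1)
    show "\<rho>' \<in> borel_measurable (restrict_space lborel Omega)" by (auto intro!: measurable_restrict_space1)
    show "restrict_space (source \<theta>) Omega = density (restrict_space lborel Omega) (\<lambda>x. ennreal (\<rho>1 x))"
      unfolding \<rho>1(1) by (rule restrict_space_density_lborel) simp
    show "restrict_space (source (insert j \<theta>)) Omega = density (restrict_space lborel Omega) (\<lambda>x. ennreal (\<rho>' x))"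
      unfolding eq by (rule restrict_space_density_lborel) simp
    show "\<forall>x\<in>Omega. dens_lo TYPE('d) \<le> \<rho>1 x \<and> \<rho>1 x \<le> dens_hi TYPE('d)" by (rule \<rho>1(2))
    show "\<forall>x\<in>Omega. dens_lo TYPE('d) \<le> \<rho>' x \<and> \<rho>' x \<le> dens_hi TYPE('d)"
      using \<rho>1(2) \<rho>2(2) by (simp add: \<rho>'_def)
    show "\<forall>x. x \<notin> cell k j \<longrightarrow> \<rho>1 x = \<rho>' x" by (simp add: \<rho>'_def)
  qed
qed

lemma prob_space_restrict_lborel_Omega: "prob_space (restrict_space lborel (Omega :: (real ^ 'd) set))"
  by (rule prob_spaceI) (simp add: emeasure_restrict_space space_restrict_space emeasure_lborel_Omega)

lemma prob_space_restrict_source: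
  fixes \<theta> :: "('d::finite \<Rightarrow> nat) set"
  assumes "\<theta> \<subseteq> cells k" "small TYPE('d)"
  shows "prob_space (restrict_space (source \<theta>) Omega)"
proof -
  interpret prob_space "source \<theta>" by (rule prob_space_source[OF assms])
  show ?thesis
    using measure_source_Omega[OF assms]
    by (intro prob_spaceI) (simp add: emeasure_restrict_space space_restrict_space sets_source emeasure_eq_measure)
qed

lemma cell_subset_Omega:
  assumes "j \<in> cells k"
  shows "cell k j \<subseteq> Omega"
proof
  fix x assume x: "x \<in> cell k j"
  have "0 \<le> x $ i \<and> x $ i \<le> 1" for i
  proof -
    have "0 \<le> real k * x $ i" "real k * x $ i \<le> real (j i) + 1" using x by (auto simp: cell_iff) (smt (verit) of_nat_0_le_iff, smt (verit))
    moreover have "j i < k" using assms by (simp add: cells_def)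
    then have "real (j i) + 1 \<le> real k" by linarith
    ultimately have "0 \<le> real k * x $ i" "real k * x $ i \<le> real k * 1" by linarith+
    then show ?thesis using k1 mult_left_le_imp_le[of "real k" "x $ i" 1] by (auto simp: zero_le_mult_iff)
  qed
  then show "x \<in> Omega" by (simp add: Omega_iff)
qed

lemma measure_cell:
  fixes j :: "'d::finite \<Rightarrow> nat"
  assumes "j \<in> cells k"
  shows "measure (restrict_space lborel Omega) (cell k j) = (1 / real k) ^ CARD('d)"
proof -
  have "emeasure (restrict_space lborel Omega) (cell k j) = emeasure lborel (cell k j)"
    using cell_subset_Omega[OF assms] by (simp add: emeasure_restrict_space)
  also have "\<dots> = ennreal ((1 / real k) ^ CARD('d))"
    unfolding cell_def using k1 by (intro emeasure_cube) (auto simp: field_simps)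
  finally show ?thesis by (simp add: measure_def)
qed

end


subsection \<open>Two-point testing\<close>

lemma half_le_of_le_add_half:
  fixes e f :: ennreal
  assumes "e \<le> 1" "e \<le> f + ennreal (1/2)"
  shows "ennreal (1/2) \<le> (1 - e) + f"
proof -
  have "ennreal (1/2) + ennreal (1/2) = 1" by (subst ennreal_plus[symmetric]) auto
  also have "\<dots> = (1 - e) + e" using assms(1) by (simp add: diff_add_cancel_ennreal)
  also have "\<dots> \<le> (1 - e) + (f + ennreal (1/2))" using assms(2) by (rule add_left_mono)
  also have "\<dots> = ennreal (1/2) + ((1 - e) + f)" by (simp only: ac_simps)
  finally show ?thesis unfolding ennreal_add_left_cancel_le by auto
qed

text \<open>From 2e <= e^2 + 1.\<close>

lemma le_add_half_of_sq_le:
  fixes e f :: ennreal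
  assumes "e \<le> 1" "e\<^sup>2 \<le> 2 * f"
  shows "e \<le> f + ennreal (1/2)"
proof -
  obtain e' where e': "e = ennreal e'" "0 \<le> e'"
    using assms(1) by (metis ennreal_cases ennreal_one_neq_top top.extremum_uniqueI)
  have "2 * e' \<le> e'\<^sup>2 + 1" using sum_squares_bound[of e' 1] by simp
  then have "ennreal (2 * e') \<le> ennreal (e'\<^sup>2 + 1)" by (rule ennreal_leI)
  then have "2 * e \<le> e\<^sup>2 + 1" using e' by (simp add: ennreal_mult ennreal_power)
  also have "\<dots> \<le> 2 * f + 1" using assms(2) by (rule add_right_mono)
  also have "\<dots> = 2 * (f + ennreal (1/2))"
  proof -
    have "2 * ennreal (1/2) = ennreal (2 * (1/2))" by (subst ennreal_mult) auto
    then show ?thesis by (simp only: distrib_left) simp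
  qed
  finally show ?thesis by (subst (asm) ennreal_mult_le_mult_iff) auto
qed

lemma nn_integral_one_minus:
  fixes g :: "'a \<Rightarrow> ennreal"
  assumes "prob_space Q" "g \<in> borel_measurable Q" "\<And>x. x \<in> space Q \<Longrightarrow> g x \<le> 1"
  shows "(\<integral>\<^sup>+x. g x \<partial>Q) \<le> 1" "(\<integral>\<^sup>+x. 1 - g x \<partial>Q) = 1 - (\<integral>\<^sup>+x. g x \<partial>Q)"
proof -
  interpret prob_space Q by fact
  have "(\<integral>\<^sup>+x. g x \<partial>Q) \<le> (\<integral>\<^sup>+x. 1 \<partial>Q)" using assms(3) by (intro nn_integral_mono) auto
  then show *: "(\<integral>\<^sup>+x. g x \<partial>Q) \<le> 1" by (simp add: emeasure_space_1)
  then have "(\<integral>\<^sup>+x. g x \<partial>Q) \<noteq> \<infinity>" by (auto simp: top_unique)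
  then show "(\<integral>\<^sup>+x. 1 - g x \<partial>Q) = 1 - (\<integral>\<^sup>+x. g x \<partial>Q)"
    using assms by (subst nn_integral_diff) (auto simp: emeasure_space_1)
qed

text \<open>The second factor carries the observations whose law is the same under both hypotheses.\<close>

lemma two_point_bound:
  fixes g :: "('i \<Rightarrow> 'a) \<times> 'b \<Rightarrow> ennreal"
  assumes "prob_space N" "prob_space N'" "prob_space W" and sets: "sets N' = sets N" and "finite I"
    and g: "g \<in> borel_measurable (PiM I (\<lambda>_. N) \<Otimes>\<^sub>M W)"
    and g1: "\<And>x. x \<in> space (PiM I (\<lambda>_. N) \<Otimes>\<^sub>M W) \<Longrightarrow> g x \<le> 1"
    and cases: "(\<exists>c. c ^ card I \<le> 2 \<and>
        (\<forall>h\<in>borel_measurable N. (\<integral>\<^sup>+x. h x \<partial>N)\<^sup>2 \<le> c * (\<integral>\<^sup>+x. (h x)\<^sup>2 \<partial>N')))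
      \<or> (\<exists>e t. 0 \<le> t \<and> real (card I) * t \<le> 1/2 \<and>
        (\<forall>h\<in>borel_measurable N. (\<forall>x\<in>space N. h x \<le> 1) \<longrightarrow> (\<forall>x\<in>space N. \<forall>y\<in>space N. h x \<le> h y + e) \<longrightarrow>
          (\<integral>\<^sup>+x. h x \<partial>N) \<le> (\<integral>\<^sup>+x. h x \<partial>N') + ennreal t) \<and>
        (\<forall>x\<in>space (PiM I (\<lambda>_. N)). \<forall>w\<in>space W. \<forall>i\<in>I. \<forall>y\<in>space N. g (x, w) \<le> g (x(i := y), w) + e))"
  shows "ennreal (1/2) \<le> (\<integral>\<^sup>+x. 1 - g x \<partial>(PiM I (\<lambda>_. N) \<Otimes>\<^sub>M W)) + (\<integral>\<^sup>+x. g x \<partial>(PiM I (\<lambda>_. N') \<Otimes>\<^sub>M W))"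
proof -
  interpret N: prob_space N by fact
  interpret N': prob_space N' by fact
  interpret W: prob_space W by fact
  let ?Q = "PiM I (\<lambda>_. N)" and ?Q' = "PiM I (\<lambda>_. N')"
  interpret Q: prob_space ?Q by (intro prob_space_PiM N.prob_space_axioms)
  interpret Q': prob_space ?Q' by (intro prob_space_PiM N'.prob_space_axioms)
  interpret QW: pair_prob_space ?Q W by standard
  have sQ: "sets ?Q' = sets ?Q" using sets by (intro sets_PiM_cong) auto
  have sQW: "sets (?Q' \<Otimes>\<^sub>M W) = sets (?Q \<Otimes>\<^sub>M W)" using sQ by (intro sets_pair_measure_cong) auto
  have spQ: "space ?Q' = space ?Q" by (rule sets_eq_imp_space_eq[OF sQ])
  have g': "g \<in> borel_measurable (?Q' \<Otimes>\<^sub>M W)" using g by (subst measurable_cong_sets[OF sQW refl])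
  have gx: "(\<lambda>w. g (x, w)) \<in> borel_measurable W" if "x \<in> space ?Q" for x
    using measurable_Pair2[OF g that] .
  \<comment> \<open>Averaging over the common observations leaves a test on the first factor
    alone.\<close>
  define G where "G x = (\<integral>\<^sup>+w. g (x, w) \<partial>W)" for x
  have mG: "G \<in> borel_measurable ?Q" unfolding G_def by (rule W.borel_measurable_nn_integral_fst[OF g])
  have mG': "G \<in> borel_measurable ?Q'" using mG by (subst measurable_cong_sets[OF sQ refl])
  have int: "(\<integral>\<^sup>+x. g x \<partial>(?Q \<Otimes>\<^sub>M W)) = (\<integral>\<^sup>+x. G x \<partial>?Q)" "(\<integral>\<^sup>+x. g x \<partial>(?Q' \<Otimes>\<^sub>M W)) = (\<integral>\<^sup>+x. G x \<partial>?Q')"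
    unfolding G_def using W.nn_integral_fst[OF g] W.nn_integral_fst[OF g'] by auto
  have G1: "G x \<le> 1" if x: "x \<in> space ?Q" for x
  proof -
    have "G x \<le> (\<integral>\<^sup>+w. 1 \<partial>W)" unfolding G_def
      using g1 x by (intro nn_integral_mono) (auto simp: space_pair_measure)
    then show ?thesis by (simp add: W.emeasure_space_1)
  qed
  have one: "(\<integral>\<^sup>+x. G x \<partial>?Q) \<le> 1" "(\<integral>\<^sup>+x. 1 - g x \<partial>(?Q \<Otimes>\<^sub>M W)) = 1 - (\<integral>\<^sup>+x. G x \<partial>?Q)"
    using nn_integral_one_minus[OF QW.prob_space_axioms g g1] int by auto
  from cases show ?thesis
  proof (elim disjE exE conjE)
    fix c :: ennreal
    assume c: "c ^ card I \<le> 2" and "\<forall>h\<in>borel_measurable N. (\<integral>\<^sup>+x. h x \<partial>N)\<^sup>2 \<le> c * (\<integral>\<^sup>+x. (h x)\<^sup>2 \<partial>N')"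
    then have "(\<integral>\<^sup>+x. G x \<partial>?Q)\<^sup>2 \<le> c ^ card I * (\<integral>\<^sup>+x. (G x)\<^sup>2 \<partial>?Q')"
      by (intro nn_integral_PiM_sq_le[OF assms(1,2) sets \<open>finite I\<close> _ mG]) auto
    also have "\<dots> \<le> 2 * (\<integral>\<^sup>+x. G x \<partial>?Q')"
    proof (intro mult_mono c nn_integral_mono)
      fix x assume "x \<in> space ?Q'"
      \<comment> \<open>A test with values at most 1 dominates its square, so the second moment
        becomes the error probability itself.\<close>
      then show "(G x)\<^sup>2 \<le> G x" using G1[of x] spQ mult_left_mono[of "G x" 1 "G x"] by (simp add: power2_eq_square)
    qed auto
    finally show ?thesis unfolding one(2) int(2) by (intro half_le_of_le_add_half le_add_half_of_sq_le one(1))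
  next
    fix e and t :: real
    assume t: "0 \<le> t" "real (card I) * t \<le> 1/2"
      and h: "\<forall>h\<in>borel_measurable N. (\<forall>x\<in>space N. h x \<le> 1) \<longrightarrow> (\<forall>x\<in>space N. \<forall>y\<in>space N. h x \<le> h y + e) \<longrightarrow>
          (\<integral>\<^sup>+x. h x \<partial>N) \<le> (\<integral>\<^sup>+x. h x \<partial>N') + ennreal t"
      and osc: "\<forall>x\<in>space ?Q. \<forall>w\<in>space W. \<forall>i\<in>I. \<forall>y\<in>space N. g (x, w) \<le> g (x(i := y), w) + e"
    have "(\<integral>\<^sup>+x. G x \<partial>?Q) \<le> (\<integral>\<^sup>+x. G x \<partial>?Q') + of_nat (card I) * ennreal t"
    proof (rule nn_integral_PiM_add_le[OF assms(1,2) sets \<open>finite I\<close> _ mG G1])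
      show "(\<integral>\<^sup>+x. h x \<partial>N) \<le> (\<integral>\<^sup>+x. h x \<partial>N') + ennreal t"
        if "h \<in> borel_measurable N" "\<And>x. x \<in> space N \<Longrightarrow> h x \<le> 1"
          "\<And>x y. x \<in> space N \<Longrightarrow> y \<in> space N \<Longrightarrow> h x \<le> h y + e" for h
        using h that by blast
      fix x i y assume x: "x \<in> space ?Q" "i \<in> I" "y \<in> space N"
      have u: "x(i := y) \<in> space ?Q" using x by (auto simp: space_PiM PiE_def extensional_def Pi_def)
      have "G x \<le> (\<integral>\<^sup>+w. g (x(i := y), w) + e \<partial>W)"
        unfolding G_def using osc x by (intro nn_integral_mono) blast
      also have "\<dots> = G (x(i := y)) + e"
        unfolding G_def using gx[OF u] by (simp add: nn_integral_add W.emeasure_space_1)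
      finally show "G x \<le> G (x(i := y)) + e" .
    qed
    also have "of_nat (card I) * ennreal t = ennreal (real (card I) * t)"
      using t by (simp add: ennreal_of_nat_eq_real_of_nat ennreal_mult)
    also have "\<dots> \<le> ennreal (1/2)" using t(2) by (rule ennreal_leI)
    finally have "(\<integral>\<^sup>+x. G x \<partial>?Q) \<le> (\<integral>\<^sup>+x. G x \<partial>?Q') + ennreal (1/2)" by (simp add: add_left_mono)
    then show ?thesis unfolding one(2) int(2) by (rule half_le_of_le_add_half[OF one(1)])
  qed
qed


subsection \<open>Separation of the perturbed maps\<close>

text \<open>exp(-\<epsilon>) >= 1 - \<epsilon> and m <= 1. The additive form holds for every
  \<epsilon> > 0, so large \<epsilon> needs no separate treatment.\<close>

lemma private_additive:
  fixes m m' \<epsilon> :: real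
  assumes "m \<le> exp \<epsilon> * m'" "0 \<le> m" "m \<le> 1" "0 < \<epsilon>"
  shows "m \<le> m' + \<epsilon>"
proof -
  have "m * exp (- \<epsilon>) \<le> (exp \<epsilon> * m') * exp (- \<epsilon>)" using assms(1) by (intro mult_right_mono) auto
  also have "\<dots> = m'" by (simp add: exp_minus)
  finally have "m * exp (- \<epsilon>) \<le> m'" .
  moreover have "m * (1 - \<epsilon>) \<le> m * exp (- \<epsilon>)"
    using assms(2) exp_ge_add_one_self[of "- \<epsilon>"] by (intro mult_left_mono) auto
  moreover have "m * \<epsilon> \<le> 1 * \<epsilon>" using assms by (intro mult_right_mono) auto
  ultimately show ?thesis by (simp add: algebra_simps)
qed

lemma one_plus_power_le_2:
  fixes x :: real
  assumes "0 \<le> x" "real n * x \<le> 1/2"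
  shows "(1 + x) ^ n \<le> 2"
proof -
  have "(1 + x) ^ n \<le> exp x ^ n" using assms(1) by (intro power_mono) auto
  also have "\<dots> = exp (real n * x)" by (simp add: exp_of_nat_mult)
  also have "\<dots> \<le> exp (1/2)" using assms(2) by simp
  also have "\<dots> \<le> 1 + 1/2 + (1/2)\<^sup>2" by (rule exp_bound) auto
  also have "\<dots> \<le> 2" by (simp add: power2_eq_square)
  finally show ?thesis .
qed

lemma space_map_space: "space map_space = borel_measurable (restrict_space borel Omega)"
  unfolding map_space_def by (rule space_measure_of) auto

text \<open>The sublevel sets at finite levels are the balls that generate the
  sigma-algebra.\<close>

lemma measurable_sq_dist_map_space:
  fixes g :: "real ^ 'd \<Rightarrow> real ^ 'd"
  assumes g: "g \<in> borel_measurable (restrict_space borel Omega)" "sq_dist lborel g (\<lambda>_. 0) < \<infinity>"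
  shows "(\<lambda>S. sq_dist lborel g S) \<in> borel_measurable map_space"
proof (rule borel_measurableI_le)
  fix y :: ennreal
  have c: "sq_dist lborel g S = sq_dist lborel S g" for S by (simp add: sq_dist_def norm_minus_commute)
  show "{S \<in> space map_space. sq_dist lborel g S \<le> y} \<in> sets map_space"
  proof (cases y)
    case (real r)
    have "{S \<in> borel_measurable (restrict_space borel Omega). sq_dist lborel S g \<le> ennreal r} \<in> sets map_space"
      unfolding map_space_def
    proof (subst sets_measure_of)
      show "{S \<in> borel_measurable (restrict_space borel Omega). sq_dist lborel S g \<le> ennreal r} \<in>
        sigma_sets (borel_measurable (restrict_space borel Omega))
        {{T \<in> borel_measurable (restrict_space borel Omega). sq_dist lborel T g \<le> ennreal r} | g r.
         g \<in> borel_measurable (restrict_space borel Omega) \<and> sq_dist lborel g (\<lambda>_. 0) < \<infinity>}"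
        using g by (intro sigma_sets.Basic) blast
    qed auto
    then show ?thesis unfolding space_map_space c real .
  qed simp
qed

lemma measurable_sq_integrand:
  fixes f g :: "real ^ 'd \<Rightarrow> real ^ 'd"
  assumes "f \<in> borel_measurable (restrict_space borel Omega)" "g \<in> borel_measurable (restrict_space borel Omega)"
  shows "(\<lambda>x. ennreal ((norm (f x - g x))\<^sup>2) * indicator Omega x) \<in> borel_measurable borel"
proof -
  have "(\<lambda>x. f x - g x) \<in> borel_measurable (restrict_space borel Omega)"
    using assms by (rule borel_measurable_diff)
  then have "(\<lambda>x. ennreal ((norm (f x - g x))\<^sup>2)) \<in> borel_measurable (restrict_space borel Omega)"
    by measurable
  then show ?thesis by (subst (asm) borel_measurable_restrict_space_iff_ennreal) auto
qed

lemma norm_diff_sq_le: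
  fixes x y z :: "'a::real_normed_vector"
  shows "(norm (x - y))\<^sup>2 \<le> 2 * (norm (x - z))\<^sup>2 + 2 * (norm (y - z))\<^sup>2"
proof -
  have "norm (x - y) \<le> norm (x - z) + norm (y - z)"
    using norm_triangle_ineq4[of "x - z" "y - z"] by simp
  then have "(norm (x - y))\<^sup>2 \<le> (norm (x - z) + norm (y - z))\<^sup>2" by (intro power_mono) auto
  also have "\<dots> \<le> 2 * (norm (x - z))\<^sup>2 + 2 * (norm (y - z))\<^sup>2"
    using sum_squares_bound[of "norm (x - z)" "norm (y - z)"] by (simp add: power2_sum)
  finally show ?thesis .
qed

text \<open>Closed cells share faces; the open ones are disjoint and still contain every point that
  the bump displaces.\<close>

definition open_cell :: "nat \<Rightarrow> ('d::finite \<Rightarrow> nat) \<Rightarrow> (real ^ 'd) set"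
  where "open_cell k j = {x. \<forall>i. real k * x $ i - real (j i) \<in> {0<..<1}}"

context bump
begin

lemma open_cell_borel [measurable]: "open_cell k j \<in> sets borel"
proof -
  have "open_cell k j = (\<Inter>i\<in>UNIV. {x. 0 < real k * x $ i - real (j i) \<and> real k * x $ i - real (j i) < 1})"
    by (auto simp: open_cell_def)
  also have "open \<dots>"
    by (intro open_INT ballI open_Collect_conj open_Collect_less continuous_intros) auto
  finally show ?thesis by simp
qed

lemma open_cell_subset: "open_cell k j \<subseteq> cell k j"
  by (auto simp: open_cell_def cell_iff less_imp_le)

lemma disjoint_open_cells: "disjoint_family_on (open_cell k) J"
  unfolding disjoint_family_on_def
proof (intro ballI impI, rule ccontr)
  fix j j' :: "'a \<Rightarrow> nat" assume "j \<noteq> j'" "open_cell k j \<inter> open_cell k j' \<noteq> {}"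
  then obtain x where x: "x \<in> open_cell k j" "x \<in> open_cell k j'" by blast
  have "j i = j' i" for i
  proof -
    have "real k * x $ i - real (j i) \<in> {0<..<1}" "real k * x $ i - real (j' i) \<in> {0<..<1}"
      using x by (auto simp: open_cell_def)
    then have "\<bar>real (j i) - real (j' i)\<bar> < 1" by auto
    then show ?thesis by linarith
  qed
  then show False using \<open>j \<noteq> j'\<close> by auto
qed

lemma tmap_empty: "tmap {} x = x"
  by (simp add: tmap_def shift_def bump_sum_def vec_eq_iff)

lemma tmap_single_outside:
  assumes "x \<notin> open_cell k j"
  shows "tmap {j} x = x"
proof -
  obtain i where i: "real k * x $ i - real (j i) \<notin> {0<..<1}" using assms by (auto simp: open_cell_def)
  have "D {j} (unit_index l) x = 0" for l
    using prod_eq_0[of "unit_index l" x i j, OF unit_index_le i] by (simp add: bump_sum_def)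
  then show ?thesis by (simp add: tmap_def shift_def vec_eq_iff)
qed

lemma tmap_inside:
  assumes "x \<in> cell k j" "finite \<theta>"
  shows "tmap \<theta> x = (if j \<in> \<theta> then tmap {j} x else x)"
proof -
  have "D \<theta> (unit_index i) x = (if j \<in> \<theta> then D {j} (unit_index i) x else 0)" for i
    by (rule D_inside[of "unit_index i", OF unit_index_le assms])
  then show ?thesis by (simp add: tmap_def shift_def vec_eq_iff)
qed

text \<open>On the subcube below both \<open>c 0\<close> and \<open>c 1\<close> are at least \<open>\<beta>\<close>, hence so is every factor of the displacement.\<close>

lemma displacement_ge:
  fixes j :: "'d::finite \<Rightarrow> nat"
  shows "ennreal (a\<^sup>2 * \<beta> ^ (2 * CARD('d)) * (1 / (4 * real k)) ^ CARD('d))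
    \<le> (\<integral>\<^sup>+x. ennreal ((norm (x - tmap {j} x))\<^sup>2) * indicator (open_cell k j) x \<partial>lborel)"
proof -
  define q :: "(real ^ 'd) set" where "q = cbox (\<chi> i. (real (j i) + 1/8) / real k) (\<chi> i. (real (j i) + 3/8) / real k)"
  have q: "real k * x $ i - real (j i) \<in> {1/8..3/8}" if "x \<in> q" for x i
    using that k1 by (simp add: q_def mem_box_cart field_simps)
  have em: "emeasure lborel q = ennreal ((1 / (4 * real k)) ^ CARD('d))"
    unfolding q_def using k1 by (intro emeasure_cube) (auto simp: field_simps)
  have "a\<^sup>2 * \<beta> ^ (2 * CARD('d)) \<le> (norm (x - tmap {j} x))\<^sup>2" if "x \<in> q" for x
  proof -
    \<comment> \<open>One component of the displacement suffices; the constant picks an arbitrary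
      coordinate.\<close>
    define i where "i = (undefined :: 'd)"
    have "(\<Prod>l\<in>(UNIV :: 'd set). \<beta>) \<le> (\<Prod>l\<in>UNIV. c (unit_index i l) (real k * x $ l - real (j l)))"
      using q[OF that] lower0 lower1 \<beta>0 by (intro prod_mono) (auto simp: unit_index_def)
    then have "a * \<beta> ^ CARD('d) \<le> a * D {j} (unit_index i) x"
      using a0 by (intro mult_left_mono) (auto simp: bump_sum_def)
    also have "\<dots> = shift {j} x $ i" by (simp add: shift_def)
    also have "\<dots> \<le> norm (shift {j} x)" using component_le_norm_cart[of "shift {j} x" i] by linarith
    also have "\<dots> = norm (x - tmap {j} x)" by (simp add: tmap_def)
    finally have "(a * \<beta> ^ CARD('d))\<^sup>2 \<le> (norm (x - tmap {j} x))\<^sup>2"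
      using a0 \<beta>0 by (intro power_mono) auto
    then show ?thesis by (simp add: power_mult_distrib power_mult[symmetric] mult.commute)
  qed
  moreover have "q \<subseteq> open_cell k j"
  proof
    fix x assume "x \<in> q"
    from q[OF this] have "real k * x $ i - real (j i) \<in> {0<..<1}" for i
      by (rule subsetD[rotated]) auto
    then show "x \<in> open_cell k j" by (simp add: open_cell_def)
  qed
  ultimately have "(\<integral>\<^sup>+x. ennreal (a\<^sup>2 * \<beta> ^ (2 * CARD('d))) * indicator q x \<partial>lborel)
     \<le> (\<integral>\<^sup>+x. ennreal ((norm (x - tmap {j} x))\<^sup>2) * indicator (open_cell k j) x \<partial>lborel)"
    by (intro nn_integral_mono) (auto simp: indicator_def ennreal_leI)
  moreover have "(\<integral>\<^sup>+x. ennreal (a\<^sup>2 * \<beta> ^ (2 * CARD('d))) * indicator q x \<partial>lborel)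
     = ennreal (a\<^sup>2 * \<beta> ^ (2 * CARD('d)) * (1 / (4 * real k)) ^ CARD('d))"
    using \<beta>0 by (subst nn_integral_cmult_indicator) (auto simp: em q_def[symmetric] ennreal_mult[symmetric], simp add: q_def)
  ultimately show ?thesis by simp
qed

text \<open>A quarter of the lower bound on the squared distance between the two maps on a cell. The
  4 comes from |u - v|^2 <= 2|u - s|^2 + 2|v - s|^2, with s at least as far from the true map as
  from the other.\<close>

definition sep :: "'d::finite itself \<Rightarrow> real"
  where "sep _ = a\<^sup>2 * \<beta> ^ (2 * CARD('d)) * (1 / (4 * real k)) ^ CARD('d) / 4"

lemma sep_nonneg: "0 \<le> sep TYPE('d::finite)"
  using \<beta>0 by (simp add: sep_def)

text \<open>The event that the output is at least as close to the identity as to the map with only cell \<open>j\<close>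
  perturbed. Comparing the distances on all of \<open>Omega\<close> makes it measurable, and the comparison
  still only depends on the cell because both maps agree outside it.\<close>

definition near_id :: "('d::finite \<Rightarrow> nat) \<Rightarrow> (real ^ 'd \<Rightarrow> real ^ 'd) set"
  where "near_id j = {S \<in> space map_space. sq_dist lborel (tmap {}) S \<le> sq_dist lborel (tmap {j}) S}"

text \<open>The event that the test for cell j errs when the pattern is \<open>\<theta>\<close>. A
  tie counts as a decision that j is absent.\<close>

definition wrong :: "('d::finite \<Rightarrow> nat) set \<Rightarrow> ('d \<Rightarrow> nat) \<Rightarrow> (real ^ 'd \<Rightarrow> real ^ 'd) set"
  where "wrong \<theta> j = (if j \<in> \<theta> then near_id j else space map_space - near_id j)"

lemma tmap_in_map_space: "tmap \<theta> \<in> borel_measurable (restrict_space borel Omega)"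
  by (intro measurable_restrict_space1 measurable_tmap)

context
  assumes small: "small TYPE('d::finite)"
begin

lemma sq_dist_tmap_finite:
  fixes \<theta> :: "('d \<Rightarrow> nat) set"
  assumes "\<theta> \<subseteq> cells k"
  shows "sq_dist lborel (tmap \<theta>) (\<lambda>_. 0) < \<infinity>"
proof -
  have "norm (tmap \<theta> x) \<le> real CARD('d)" if "x \<in> Omega" for x
    using that tmap_Omega_iff[OF assms small_imp(1)[OF small]] by (intro norm_le_of_Omega) simp
  then have "sq_dist lborel (tmap \<theta>) (\<lambda>_. 0) \<le> (\<integral>\<^sup>+x. ennreal ((real CARD('d))\<^sup>2) * indicator (Omega :: (real ^ 'd) set) x \<partial>lborel)"
    unfolding sq_dist_def
    by (intro nn_integral_mono) (auto simp: indicator_def intro!: ennreal_leI power_mono)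
  also have "\<dots> = ennreal ((real CARD('d))\<^sup>2)" by (simp add: nn_integral_cmult_indicator emeasure_lborel_Omega)
  also have "\<dots> < \<infinity>" by simp
  finally show ?thesis .
qed

lemma near_id_sets:
  fixes j :: "'d \<Rightarrow> nat"
  assumes "j \<in> cells k"
  shows "near_id j \<in> sets map_space"
proof -
  have [measurable]: "(\<lambda>S. sq_dist lborel (tmap {}) S) \<in> borel_measurable (map_space :: (real ^ 'd \<Rightarrow> real ^ 'd) measure)"
    "(\<lambda>S. sq_dist lborel (tmap {j}) S) \<in> borel_measurable map_space"
    using assms by (auto intro!: measurable_sq_dist_map_space tmap_in_map_space sq_dist_tmap_finite)
  show ?thesis unfolding near_id_def by measurable
qed

lemma wrong_sets:
  fixes j :: "'d \<Rightarrow> nat"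
  assumes "j \<in> cells k"
  shows "wrong \<theta> j \<in> sets map_space"
  using near_id_sets[OF assms] by (auto simp: wrong_def)

text \<open>The contributions from outside the cell are equal for the two reference maps and cancel
  from the global comparison, provided that they are finite. On the cell the true map is one of the
  two and, on the event \<open>wrong\<close>, not the closer one.\<close>

lemma sq_dist_ge_local:
  fixes \<theta> :: "('d \<Rightarrow> nat) set"
  assumes \<theta>: "\<theta> \<subseteq> cells k" and j: "j \<in> cells k" and S: "S \<in> wrong \<theta> j"
    and fin: "sq_dist lborel (tmap \<theta>) S < \<infinity>"
  shows "ennreal (sep TYPE('d)) \<le> (\<integral>\<^sup>+x. (ennreal ((norm (tmap \<theta> x - S x))\<^sup>2) * indicator Omega x) * indicator (open_cell k j) x \<partial>lborel)"
proof -
  have finite: "finite \<theta>" using \<theta> by (rule finite_subset) simp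
  have Sm: "S \<in> borel_measurable (restrict_space borel Omega)"
    using S by (auto simp: wrong_def near_id_def space_map_space split: if_splits)
  define f where "f \<tau> x = ennreal ((norm (tmap \<tau> x - S x))\<^sup>2) * indicator Omega x" for \<tau> x
  have [measurable]: "f \<tau> \<in> borel_measurable borel" for \<tau>
    unfolding f_def[abs_def] by (intro measurable_sq_integrand tmap_in_map_space Sm)
  define L where "L \<tau> = (\<integral>\<^sup>+x. f \<tau> x * indicator (open_cell k j) x \<partial>lborel)" for \<tau>
  define O' where "O' \<tau> = (\<integral>\<^sup>+x. f \<tau> x * indicator (- open_cell k j) x \<partial>lborel)" for \<tau>
  have split: "sq_dist lborel (tmap \<tau>) S = L \<tau> + O' \<tau>" for \<tau>
  proof -
    have "sq_dist lborel (tmap \<tau>) S = (\<integral>\<^sup>+x. f \<tau> x * indicator (open_cell k j) x + f \<tau> x * indicator (- open_cell k j) x \<partial>lborel)"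
      unfolding sq_dist_def f_def[symmetric] by (intro nn_integral_cong) (auto simp: indicator_def)
    also have "\<dots> = L \<tau> + O' \<tau>" unfolding L_def O'_def by (rule nn_integral_add) auto
    finally show ?thesis .
  qed
  have O: "O' {j} = O' {}"
    unfolding O'_def f_def by (intro nn_integral_cong) (auto simp: tmap_single_outside tmap_empty indicator_def)
  \<comment> \<open>All maps send \<open>Omega\<close> into itself, so a finite distance to the true
    map is finite for the identity as well. Cancellation in \<open>ennreal\<close> depends on
    this.\<close>
  have "sq_dist lborel (tmap {}) S \<le> (\<integral>\<^sup>+x. 2 * f \<theta> x + ennreal (2 * (4 * (real CARD('d))\<^sup>2)) * indicator Omega x \<partial>lborel)"
    unfolding sq_dist_def
  proof (rule nn_integral_mono)
    fix x :: "real ^ 'd"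
    show "ennreal ((norm (tmap {} x - S x))\<^sup>2) * indicator Omega x \<le> 2 * f \<theta> x + ennreal (2 * (4 * (real CARD('d))\<^sup>2)) * indicator Omega x"
    proof (cases "x \<in> Omega")
      case True
      have "tmap \<theta> x \<in> Omega" using True tmap_Omega_iff[OF \<theta> small_imp(1)[OF small]] by simp
      then have "norm (x - tmap \<theta> x) \<le> 2 * real CARD('d)"
        using norm_le_of_Omega[OF True] norm_le_of_Omega[of "tmap \<theta> x"] norm_triangle_ineq4[of x "tmap \<theta> x"] by linarith
      then have "(norm (x - tmap \<theta> x))\<^sup>2 \<le> (2 * real CARD('d))\<^sup>2" by (intro power_mono) auto
      then have "(norm (x - S x))\<^sup>2 \<le> 2 * (norm (tmap \<theta> x - S x))\<^sup>2 + 2 * (4 * (real CARD('d))\<^sup>2)"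
        using norm_diff_sq_le[of x "S x" "tmap \<theta> x"] by (simp add: norm_minus_commute power_mult_distrib)
      then have "ennreal ((norm (x - S x))\<^sup>2) \<le> ennreal (2 * (norm (tmap \<theta> x - S x))\<^sup>2 + 2 * (4 * (real CARD('d))\<^sup>2))"
        by (rule ennreal_leI)
      also have "\<dots> = 2 * ennreal ((norm (tmap \<theta> x - S x))\<^sup>2) + ennreal (2 * (4 * (real CARD('d))\<^sup>2))"
        by (subst ennreal_plus) (auto simp: ennreal_mult)
      finally show ?thesis using True by (simp add: f_def tmap_empty)
    qed simp
  qed
  also have "\<dots> = 2 * sq_dist lborel (tmap \<theta>) S + ennreal (2 * (4 * (real CARD('d))\<^sup>2))"
    unfolding sq_dist_def f_def[symmetric]
    by (simp add: nn_integral_add nn_integral_cmult nn_integral_cmult_indicator emeasure_lborel_Omega)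
  also have "\<dots> < \<infinity>" using fin by (simp add: ennreal_mult_less_top)
  finally have fin0: "O' {} < \<infinity>" "L {} < \<infinity>" unfolding split by (auto simp: less_top)
  have cmp: "L {} \<le> L {j}" if "S \<in> near_id j"
    using that fin0 O by (auto simp: near_id_def split add.commute[of _ "O' {}"] ennreal_add_left_cancel_le less_top)
  have cmp': "L {j} \<le> L {}" if "S \<notin> near_id j"
  proof -
    have "sq_dist lborel (tmap {j}) S \<le> sq_dist lborel (tmap {}) S"
      using that Sm by (auto simp: near_id_def space_map_space)
    then show ?thesis using fin0 O by (auto simp: split add.commute[of _ "O' {}"] ennreal_add_left_cancel_le less_top)
  qed
  have L\<theta>: "L \<theta> = (if j \<in> \<theta> then L {j} else L {})"
  proof -
    have "tmap \<theta> x = (if j \<in> \<theta> then tmap {j} x else tmap {} x)" if "x \<in> open_cell k j" for x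
      using tmap_inside[OF subsetD[OF open_cell_subset that] finite] by (simp add: tmap_empty)
    then show ?thesis
      unfolding L_def f_def by (auto intro!: nn_integral_cong simp: indicator_def)
  qed
  have "ennreal (4 * sep TYPE('d)) \<le> (\<integral>\<^sup>+x. ennreal ((norm (x - tmap {j} x))\<^sup>2) * indicator (open_cell k j) x \<partial>lborel)"
    using displacement_ge[of j] by (simp add: sep_def)
  also have "\<dots> \<le> (\<integral>\<^sup>+x. 2 * (f {} x * indicator (open_cell k j) x) + 2 * (f {j} x * indicator (open_cell k j) x) \<partial>lborel)"
  proof (rule nn_integral_mono)
    fix x
    show "ennreal ((norm (x - tmap {j} x))\<^sup>2) * indicator (open_cell k j) x
      \<le> 2 * (f {} x * indicator (open_cell k j) x) + 2 * (f {j} x * indicator (open_cell k j) x)"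
    proof (cases "x \<in> open_cell k j")
      case True
      then have "x \<in> Omega" using open_cell_subset cell_subset_Omega[OF j] by blast
      have "ennreal ((norm (x - tmap {j} x))\<^sup>2) \<le> ennreal (2 * (norm (x - S x))\<^sup>2 + 2 * (norm (tmap {j} x - S x))\<^sup>2)"
        by (intro ennreal_leI norm_diff_sq_le)
      also have "\<dots> = 2 * ennreal ((norm (x - S x))\<^sup>2) + 2 * ennreal ((norm (tmap {j} x - S x))\<^sup>2)"
        by (subst ennreal_plus) (auto simp: ennreal_mult)
      finally show ?thesis using True \<open>x \<in> Omega\<close> by (simp add: f_def tmap_empty)
    qed simp
  qed
  also have "\<dots> = 2 * L {} + 2 * L {j}"
    unfolding L_def by (simp add: nn_integral_add nn_integral_cmult)
  also have "\<dots> \<le> 4 * L \<theta>"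
  proof -
    have "L {} \<le> L \<theta> \<and> L {j} \<le> L \<theta>"
      using S cmp cmp' by (auto simp: L\<theta> wrong_def split: if_splits)
    then have "2 * L {} + 2 * L {j} \<le> 2 * L \<theta> + 2 * L \<theta>" by (intro add_mono mult_left_mono) auto
    then show ?thesis by (simp add: distrib_right[symmetric])
  qed
  finally have "4 * ennreal (sep TYPE('d)) \<le> 4 * L \<theta>"
    using sep_nonneg[where ?'d='d] by (simp add: ennreal_mult)
  then have "ennreal (sep TYPE('d)) \<le> L \<theta>"
    by (simp add: ennreal_mult_le_mult_iff)
  then show ?thesis by (simp add: L_def f_def)
qed

text \<open>The open cells are disjoint, so the local errors add up to at most the total loss. The
  local bound presupposes finite loss; the infinite case is trivial.\<close>

lemma sq_dist_ge_sum:
  fixes \<theta> :: "('d \<Rightarrow> nat) set"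
  assumes \<theta>: "\<theta> \<subseteq> cells k" and S: "S \<in> space map_space"
  shows "(\<Sum>j\<in>cells k. ennreal (sep TYPE('d)) * indicator (wrong \<theta> j) S) \<le> sq_dist lborel (tmap \<theta>) S"
proof (cases "sq_dist lborel (tmap \<theta>) S < \<infinity>")
  case True
  have Sm: "S \<in> borel_measurable (restrict_space borel Omega)" using S by (simp add: space_map_space)
  define f where "f x = ennreal ((norm (tmap \<theta> x - S x))\<^sup>2) * indicator Omega x" for x
  have [measurable]: "f \<in> borel_measurable borel"
    unfolding f_def[abs_def] by (intro measurable_sq_integrand tmap_in_map_space Sm)
  have "(\<Sum>j\<in>cells k. ennreal (sep TYPE('d)) * indicator (wrong \<theta> j) S)
    \<le> (\<Sum>j\<in>cells k. \<integral>\<^sup>+x. f x * indicator (open_cell k j) x \<partial>lborel)"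
    using sq_dist_ge_local[OF \<theta> _ _ True] by (intro sum_mono) (auto simp: f_def indicator_def)
  also have "\<dots> = (\<integral>\<^sup>+x. (\<Sum>j\<in>cells k. f x * indicator (open_cell k j) x) \<partial>lborel)"
    by (subst nn_integral_sum) auto
  also have "\<dots> \<le> (\<integral>\<^sup>+x. f x \<partial>lborel)"
  proof (rule nn_integral_mono)
    fix x :: "real ^ 'd"
    have "(\<Sum>j\<in>cells k. f x * indicator (open_cell k j) x) = f x * (\<Sum>j\<in>cells k. indicator (open_cell k j) x)"
      by (simp add: sum_distrib_left)
    also have "(\<Sum>j\<in>cells k. indicator (open_cell k j) x) = (indicator (\<Union>j\<in>cells k. open_cell k j) x :: ennreal)"
      by (intro indicator_UN_disjoint[symmetric] disjoint_open_cells) simp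
    also have "f x * indicator (\<Union>j\<in>cells k. open_cell k j) x \<le> f x" by (auto simp: indicator_def)
    finally show "(\<Sum>j\<in>cells k. f x * indicator (open_cell k j) x) \<le> f x" .
  qed
  also have "\<dots> = sq_dist lborel (tmap \<theta>) S" by (simp add: sq_dist_def f_def)
  finally show ?thesis .
next
  case False
  then have "sq_dist lborel (tmap \<theta>) S = \<top>" by (simp add: less_top[symmetric])
  then show ?thesis by simp
qed

end

end


subsection \<open>Assouad's argument\<close>

lemma sum_Pow_split:
  fixes f :: "'a set \<Rightarrow> 'b::comm_monoid_add"
  assumes "finite J" "j \<in> J"
  shows "(\<Sum>\<theta>\<in>Pow J. f \<theta>) = (\<Sum>\<theta>\<in>Pow (J - {j}). f \<theta> + f (insert j \<theta>))"
proof -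
  have J: "Pow J = Pow (J - {j}) \<union> insert j ` Pow (J - {j})"
    using Pow_insert[of j "J - {j}"] assms(2) by (simp add: insert_absorb)
  have inj: "inj_on (insert j) (Pow (J - {j}))"
    by (rule inj_onI) (metis Diff_insert_absorb PowD insert_absorb insert_ident subset_Diff_insert)
  have "(\<Sum>\<theta>\<in>Pow J. f \<theta>) = (\<Sum>\<theta>\<in>Pow (J - {j}). f \<theta>) + (\<Sum>\<theta>\<in>insert j ` Pow (J - {j}). f \<theta>)"
    unfolding J using assms(1) by (intro sum.union_disjoint) auto
  also have "(\<Sum>\<theta>\<in>insert j ` Pow (J - {j}). f \<theta>) = (\<Sum>\<theta>\<in>Pow (J - {j}). f (insert j \<theta>))"
    using sum.reindex[OF inj, of f] by (simp add: o_def)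
  finally show ?thesis by (simp add: sum.distrib)
qed

lemma measure_private_le:
  assumes A: "A \<in> private_estimators n \<epsilon>" and "0 < \<epsilon>" and S: "S \<in> sets map_space"
    and D: "d \<in> space (dataset_space n)" "d' \<in> space (dataset_space n)" "hamming n d d' \<le> 1"
  shows "emeasure (A d) S \<le> emeasure (A d') S + ennreal \<epsilon>"
proof -
  have AM: "A \<in> dataset_space n \<rightarrow>\<^sub>M prob_algebra map_space" using A by (simp add: private_estimators_def)
  have p: "prob_space (A d)" "prob_space (A d')"
    using measurable_space[OF AM D(1)] measurable_space[OF AM D(2)] by (simp_all add: space_prob_algebra)
  interpret d: prob_space "A d" by fact
  interpret d': prob_space "A d'" by fact
  have "measure (A d) S \<le> exp \<epsilon> * measure (A d') S"
    using A D S unfolding private_estimators_def by blast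
  from private_additive[OF this] have "measure (A d) S \<le> measure (A d') S + \<epsilon>"
    using \<open>0 < \<epsilon>\<close> d.prob_le_1 by simp
  then show ?thesis
    using \<open>0 < \<epsilon>\<close> by (simp add: d.emeasure_eq_measure d'.emeasure_eq_measure ennreal_plus[symmetric] ennreal_leI del: ennreal_plus)
qed

context bump
begin

text \<open>The difference \<open>dens_hi\<close> - \<open>dens_lo\<close> times the volume of a
  cell, which bounds the L1 distance of the two source densities.\<close>

definition tv_bound :: "'d::finite itself \<Rightarrow> real"
  where "tv_bound _ = 2 * (2 ^ CARD('d) * \<eta> TYPE('d)) * (1 / real k) ^ CARD('d)"

text \<open>The squared difference of the density bounds, divided by the lower bound 1/2 for
  \<open>dens_lo\<close>, times the volume of a cell.\<close>

definition chi_bound :: "'d::finite itself \<Rightarrow> real"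
  where "chi_bound _ = 8 * (2 ^ CARD('d) * \<eta> TYPE('d))\<^sup>2 * (1 / real k) ^ CARD('d)"

definition law :: "nat \<Rightarrow> ('d::finite \<Rightarrow> nat) set \<Rightarrow> 'd dataset measure"
  where "law n \<theta> = data_law n (source \<theta>) (tmap \<theta>)"

context
  assumes small: "small TYPE('d::finite)"
begin

lemma law_eq:
  fixes \<theta> :: "('d \<Rightarrow> nat) set"
  assumes "\<theta> \<subseteq> cells k"
  shows "law n \<theta> = (\<Pi>\<^sub>M i\<in>{..<n}. restrict_space (source \<theta>) Omega) \<Otimes>\<^sub>M (\<Pi>\<^sub>M i\<in>{..<n}. restrict_space uniform_Omega Omega)"
  by (simp add: law_def data_law_def pushforward_source[OF assms small])

lemma sets_law:
  fixes \<theta> :: "('d \<Rightarrow> nat) set"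
  assumes "\<theta> \<subseteq> cells k"
  shows "sets (law n \<theta>) = sets (dataset_space n)"
  unfolding law_eq[OF assms] dataset_space_def
  by (intro sets_pair_measure_cong sets_PiM_cong refl) (simp_all add: sets_restrict_space sets_source)

text \<open>The probability that the mechanism outputs a map in \<open>E\<close> is itself a
  randomised test of the data. Privacy bounds its change by \<epsilon> when one source observation
  is replaced, as the total variation case requires; the chi-square case compares the densities. The
  target sample has the same law under both patterns.\<close>

lemma law_test:
  fixes \<theta> :: "('d \<Rightarrow> nat) set"
  assumes \<theta>: "insert j \<theta> \<subseteq> cells k" and A: "A \<in> private_estimators n \<epsilon>" and \<epsilon>: "0 < \<epsilon>"
    and E: "E \<in> sets map_space"
    and cond: "real n * chi_bound TYPE('d) \<le> 1/2 \<or> real n * (tv_bound TYPE('d) * \<epsilon>) \<le> 1/2"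
  shows "ennreal (1/2) \<le> (\<integral>\<^sup>+d. emeasure (A d) (space map_space - E) \<partial>law n \<theta>) + (\<integral>\<^sup>+d. emeasure (A d) E \<partial>law n (insert j \<theta>))"
proof -
  have \<theta>': "\<theta> \<subseteq> cells k" and j: "j \<in> cells k" using \<theta> by auto
  let ?N = "restrict_space (source \<theta>) Omega" and ?N' = "restrict_space (source (insert j \<theta>)) Omega"
  let ?W = "\<Pi>\<^sub>M i\<in>{..<n}. restrict_space (uniform_Omega :: (real ^ 'd) measure) Omega"
  let ?m = "restrict_space lborel (Omega :: (real ^ 'd) set)"
  have pN: "prob_space ?N" by (rule prob_space_restrict_source[OF \<theta>' small])
  have pN': "prob_space ?N'" by (rule prob_space_restrict_source[OF \<theta> small])
  have "prob_space (restrict_space (uniform_Omega :: (real ^ 'd) measure) Omega)"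
    by (rule prob_spaceI) (simp add: emeasure_restrict_space space_restrict_space emeasure_uniform_Omega emeasure_lborel_Omega)
  then have pW: "prob_space ?W" by (intro prob_space_PiM)
  have sN: "sets ?N' = sets ?N" by (simp add: sets_restrict_space sets_source)
  define g where "g d = emeasure (A d) E" for d
  have AM: "A \<in> dataset_space n \<rightarrow>\<^sub>M prob_algebra map_space" using A by (simp add: private_estimators_def)
  have sl: "sets (law n \<theta>) = sets (dataset_space n)" by (rule sets_law[OF \<theta>'])
  have spl: "space (law n \<theta>) = space (dataset_space n)" by (rule sets_eq_imp_space_eq[OF sl])
  have "g \<in> borel_measurable (dataset_space n)"
    unfolding g_def using measurable_compose[OF measurable_prob_algebraD[OF AM] measurable_emeasure_subprob_algebra[OF E]] .
  then have mg: "g \<in> borel_measurable (PiM {..<n} (\<lambda>_. ?N) \<Otimes>\<^sub>M ?W)"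
    unfolding law_eq[OF \<theta>', symmetric] by (subst measurable_cong_sets[OF sl refl])
  have Ad: "prob_space (A d)" "sets (A d) = sets map_space" if "d \<in> space (law n \<theta>)" for d
    using measurable_space[OF AM, of d] that by (auto simp: spl space_prob_algebra)
  have g1: "g d \<le> 1" if "d \<in> space (PiM {..<n} (\<lambda>_. ?N) \<Otimes>\<^sub>M ?W)" for d
    using Ad[of d] that unfolding law_eq[OF \<theta>', symmetric] g_def by (simp add: prob_space.measure_le_1)
  have compl: "(\<integral>\<^sup>+d. emeasure (A d) (space map_space - E) \<partial>law n \<theta>) = (\<integral>\<^sup>+d. 1 - g d \<partial>law n \<theta>)"
  proof (rule nn_integral_cong)
    fix d assume d: "d \<in> space (law n \<theta>)"
    interpret prob_space "A d" by (rule Ad(1)[OF d])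
    have "emeasure (A d) (space (A d) - E) = emeasure (A d) (space (A d)) - emeasure (A d) E"
      using Ad(2)[OF d] E by (intro emeasure_compl) auto
    then show "emeasure (A d) (space map_space - E) = 1 - g d"
      unfolding g_def sets_eq_imp_space_eq[OF Ad(2)[OF d], symmetric] by (simp only: emeasure_space_1)
  qed
  obtain \<rho> \<rho>' where [measurable]: "\<rho> \<in> borel_measurable ?m" "\<rho>' \<in> borel_measurable ?m"
    and N: "?N = density ?m (\<lambda>x. ennreal (\<rho> x))" "?N' = density ?m (\<lambda>x. ennreal (\<rho>' x))"
    and r: "\<forall>x\<in>Omega. dens_lo TYPE('d) \<le> \<rho> x \<and> \<rho> x \<le> dens_hi TYPE('d)"
       "\<forall>x\<in>Omega. dens_lo TYPE('d) \<le> \<rho>' x \<and> \<rho>' x \<le> dens_hi TYPE('d)"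
    and off: "\<forall>x. x \<notin> cell k j \<longrightarrow> \<rho> x = \<rho>' x"
    using source_pair_density[OF \<theta> small] by blast
  have C: "cell k j \<in> sets ?m"
    using cell_subset_Omega[OF j] by (simp add: sets_restrict_space_iff)
  have lo: "1/2 \<le> dens_lo TYPE('d)" by (rule small_imp(3)[OF small])
  define w where "w = 2 ^ CARD('d) * \<eta> TYPE('d)"
  have w0: "0 \<le> w" using eta_nonneg[where ?'d='d] by (simp add: w_def)
  have dd: "dens_hi TYPE('d) - dens_lo TYPE('d) = 2 * w" by (simp add: dens_hi_def dens_lo_def w_def)
  have "ennreal (1/2) \<le> (\<integral>\<^sup>+d. 1 - g d \<partial>(PiM {..<n} (\<lambda>_. ?N) \<Otimes>\<^sub>M ?W)) + (\<integral>\<^sup>+d. g d \<partial>(PiM {..<n} (\<lambda>_. ?N') \<Otimes>\<^sub>M ?W))"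
    using cond
  proof
    assume n: "real n * chi_bound TYPE('d) \<le> 1/2"
    define c where "c = 1 + (dens_hi TYPE('d) - dens_lo TYPE('d))\<^sup>2 / dens_lo TYPE('d) * measure ?m (cell k j)"
    have "(2 * w)\<^sup>2 / dens_lo TYPE('d) \<le> (2 * w)\<^sup>2 / (1/2)"
      using lo by (intro divide_left_mono) auto
    then have "(2 * w)\<^sup>2 / dens_lo TYPE('d) * (1 / real k) ^ CARD('d) \<le> 8 * w\<^sup>2 * (1 / real k) ^ CARD('d)"
      by (intro mult_right_mono) (auto simp: power_mult_distrib)
    then have c: "1 \<le> c" "c \<le> 1 + chi_bound TYPE('d)"
      using lo unfolding c_def dd measure_cell[OF j] chi_bound_def w_def[symmetric] by auto
    have "c ^ n \<le> (1 + chi_bound TYPE('d)) ^ n" using c by (intro power_mono) auto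
    also have "\<dots> \<le> 2" using n by (intro one_plus_power_le_2) (auto simp: chi_bound_def)
    finally have "ennreal c ^ card {..<n} \<le> 2" using c by (simp add: ennreal_power) (metis ennreal_leI ennreal_numeral)
    moreover have "(\<integral>\<^sup>+x. h x \<partial>?N)\<^sup>2 \<le> ennreal c * (\<integral>\<^sup>+x. (h x)\<^sup>2 \<partial>?N')" if "h \<in> borel_measurable ?N" for h
    proof -
      have h: "h \<in> borel_measurable ?m" using that by (simp add: N(1))
      show ?thesis
        unfolding N c_def
        by (rule nn_integral_density_sq_le[OF prob_space_restrict_lborel_Omega _ _ C h])
          (use r off lo pN pN' in \<open>auto simp: N space_restrict_space\<close>)
    qed
    ultimately show ?thesis
      by (intro two_point_bound[OF pN pN' pW sN _ mg g1] disjI1 exI[of _ "ennreal c"]) auto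
  next
    assume n: "real n * (tv_bound TYPE('d) * \<epsilon>) \<le> 1/2"
    have t: "(dens_hi TYPE('d) - dens_lo TYPE('d)) * measure ?m (cell k j) * \<epsilon> = tv_bound TYPE('d) * \<epsilon>"
      unfolding dd measure_cell[OF j] tv_bound_def w_def by simp
    have "(\<integral>\<^sup>+x. h x \<partial>?N) \<le> (\<integral>\<^sup>+x. h x \<partial>?N') + ennreal (tv_bound TYPE('d) * \<epsilon>)"
      if "h \<in> borel_measurable ?N" "\<forall>x\<in>space ?N. h x \<le> 1" "\<forall>x\<in>space ?N. \<forall>y\<in>space ?N. h x \<le> h y + ennreal \<epsilon>" for h
    proof -
      have h: "h \<in> borel_measurable ?m" using that by (simp add: N(1))
      show ?thesis
        unfolding N t[symmetric]
        by (rule nn_integral_density_add_le[OF prob_space_restrict_lborel_Omega _ _ C h, where l="dens_lo TYPE('d)" and u="dens_hi TYPE('d)"])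
          (use r off lo pN pN' that \<epsilon> in \<open>auto simp: N space_restrict_space\<close>)
    qed
    moreover have "g (x, v) \<le> g (x(i := y), v) + ennreal \<epsilon>"
      if "x \<in> space (PiM {..<n} (\<lambda>_. ?N))" "v \<in> space ?W" "i \<in> {..<n}" "y \<in> space ?N" for x v i y
    proof -
      have u: "x(i := y) \<in> space (PiM {..<n} (\<lambda>_. ?N))" using that by (auto simp: space_PiM PiE_def extensional_def Pi_def)
      have "(x, v) \<in> space (dataset_space n)" "(x(i := y), v) \<in> space (dataset_space n)"
        using that(1,2) u unfolding spl[symmetric] law_eq[OF \<theta>'] by (simp_all add: space_pair_measure)
      moreover have "hamming n (x, v) (x(i := y), v) \<le> 1"
      proof -
        have "card {l. l < n \<and> x l \<noteq> (x(i := y)) l} \<le> card {i}" by (intro card_mono) auto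
        then show ?thesis by (simp add: hamming_def)
      qed
      ultimately show ?thesis unfolding g_def by (rule measure_private_le[OF A \<epsilon> E])
    qed
    ultimately show ?thesis
      using n \<epsilon> eta_nonneg[where ?'d='d]
      by (intro two_point_bound[OF pN pN' pW sN _ mg g1] disjI2 exI[of _ "ennreal \<epsilon>"] exI[of _ "tv_bound TYPE('d) * \<epsilon>"] conjI) (auto simp: tv_bound_def)
  qed
  then show ?thesis unfolding compl unfolding law_eq[OF \<theta>'] law_eq[OF \<theta>] g_def by simp
qed

text \<open>The cellwise loss bound, averaged over output and data. The factor 1/2 is the price for
  replacing the source by Lebesgue measure in the loss.\<close>

lemma risk_ge_sum:
  fixes \<theta> :: "('d \<Rightarrow> nat) set"
  assumes \<theta>: "\<theta> \<subseteq> cells k" and A: "A \<in> private_estimators n \<epsilon>"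
  shows "(\<Sum>j\<in>cells k. ennreal (sep TYPE('d) / 2) * (\<integral>\<^sup>+d. emeasure (A d) (wrong \<theta> j) \<partial>law n \<theta>)) \<le> risk n A (source \<theta>) (tmap \<theta>)"
proof -
  have AM: "A \<in> dataset_space n \<rightarrow>\<^sub>M prob_algebra map_space" using A by (simp add: private_estimators_def)
  have sl: "sets (law n \<theta>) = sets (dataset_space n)" by (rule sets_law[OF \<theta>])
  have spl: "space (law n \<theta>) = space (dataset_space n)" by (rule sets_eq_imp_space_eq[OF sl])
  have m: "(\<lambda>d. emeasure (A d) (wrong \<theta> j)) \<in> borel_measurable (law n \<theta>)" if "j \<in> cells k" for j
  proof -
    have "(\<lambda>d. emeasure (A d) (wrong \<theta> j)) \<in> borel_measurable (dataset_space n)"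
      using measurable_compose[OF measurable_prob_algebraD[OF AM] measurable_emeasure_subprob_algebra[OF wrong_sets[OF small that]]] .
    then show ?thesis by (subst measurable_cong_sets[OF sl refl])
  qed
  have "(\<Sum>j\<in>cells k. ennreal (sep TYPE('d) / 2) * (\<integral>\<^sup>+d. emeasure (A d) (wrong \<theta> j) \<partial>law n \<theta>))
     = (\<integral>\<^sup>+d. (\<Sum>j\<in>cells k. ennreal (sep TYPE('d) / 2) * emeasure (A d) (wrong \<theta> j)) \<partial>law n \<theta>)"
    using m by (subst nn_integral_sum) (auto simp: nn_integral_cmult)
  also have "\<dots> \<le> (\<integral>\<^sup>+d. (\<integral>\<^sup>+S. sq_dist (source \<theta>) (tmap \<theta>) S \<partial>A d) \<partial>law n \<theta>)"
  proof (rule nn_integral_mono)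
    fix d assume "d \<in> space (law n \<theta>)"
    then have s: "sets (A d) = sets map_space"
      using measurable_space[OF AM, of d] by (auto simp: spl space_prob_algebra)
    have sp: "space (A d) = space map_space" by (rule sets_eq_imp_space_eq[OF s])
    have w: "wrong \<theta> j \<in> sets (A d)" if "j \<in> cells k" for j using wrong_sets[OF small that] s by simp
    have "(\<Sum>j\<in>cells k. ennreal (sep TYPE('d) / 2) * emeasure (A d) (wrong \<theta> j))
      = (\<integral>\<^sup>+S. (\<Sum>j\<in>cells k. ennreal (sep TYPE('d) / 2) * indicator (wrong \<theta> j) S) \<partial>A d)"
      using w by (subst nn_integral_sum) (auto simp: nn_integral_cmult_indicator)
    also have "\<dots> \<le> (\<integral>\<^sup>+S. sq_dist (source \<theta>) (tmap \<theta>) S \<partial>A d)"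
    proof (rule nn_integral_mono)
      fix S assume "S \<in> space (A d)"
      then have S: "S \<in> space map_space" by (simp add: sp)
      have "(\<Sum>j\<in>cells k. ennreal (sep TYPE('d) / 2) * indicator (wrong \<theta> j) S)
        = ennreal (1/2) * (\<Sum>j\<in>cells k. ennreal (sep TYPE('d)) * indicator (wrong \<theta> j) S)"
      proof -
        have "ennreal (sep TYPE('d) / 2) = ennreal (1/2) * ennreal (sep TYPE('d))"
          using sep_nonneg[where ?'d='d] by (subst ennreal_mult[symmetric]) auto
        then show ?thesis unfolding sum_distrib_left by (simp only: mult.assoc)
      qed
      also have "\<dots> \<le> ennreal (1/2) * sq_dist lborel (tmap \<theta>) S"
        by (intro mult_left_mono sq_dist_ge_sum[OF small \<theta> S]) simp
      also have "\<dots> \<le> sq_dist (source \<theta>) (tmap \<theta>) S"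
        using S by (intro sq_dist_source_ge[OF \<theta> small]) (simp add: space_map_space)
      finally show "(\<Sum>j\<in>cells k. ennreal (sep TYPE('d) / 2) * indicator (wrong \<theta> j) S) \<le> sq_dist (source \<theta>) (tmap \<theta>) S" .
    qed
    finally show "(\<Sum>j\<in>cells k. ennreal (sep TYPE('d) / 2) * emeasure (A d) (wrong \<theta> j)) \<le> (\<integral>\<^sup>+S. sq_dist (source \<theta>) (tmap \<theta>) S \<partial>A d)" .
  qed
  finally show ?thesis by (simp add: risk_def law_def)
qed

text \<open>Assouad's argument: average over all patterns and pair each one with its neighbour at a given cell.\<close>

lemma assouad_bound:
  fixes A :: "'d dataset \<Rightarrow> (real ^ 'd \<Rightarrow> real ^ 'd) measure" and X :: ennreal
  assumes A: "A \<in> private_estimators n \<epsilon>" and \<epsilon>: "0 < \<epsilon>"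
    and cond: "real n * chi_bound TYPE('d) \<le> 1/2 \<or> real n * (tv_bound TYPE('d) * \<epsilon>) \<le> 1/2"
    and X: "\<And>\<theta>. \<theta> \<subseteq> cells k \<Longrightarrow> risk n A (source \<theta>) (tmap \<theta>) \<le> X"
  shows "ennreal (a\<^sup>2 * (\<beta> ^ (2 * CARD('d)) / (32 * 4 ^ CARD('d)))) \<le> X"
proof -
  let ?J = "cells k :: ('d \<Rightarrow> nat) set"
  define s where "s = sep TYPE('d) / 2"
  have s0: "0 \<le> s" using sep_nonneg[where ?'d='d] by (simp add: s_def)
  define m where "m = card ?J"
  have m0: "m \<noteq> 0" using k1 by (simp add: m_def card_cells)
  define r where "r \<theta> j = (\<integral>\<^sup>+d. emeasure (A d) (wrong \<theta> j) \<partial>law n \<theta>)" for \<theta> and j :: "'d \<Rightarrow> nat"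
  have r: "ennreal (2 ^ (m - 1) * (1/2)) \<le> (\<Sum>\<theta>\<in>Pow ?J. r \<theta> j)" if j: "j \<in> ?J" for j
  proof -
    \<comment> \<open>The 2^(m-1) pairs of patterns that differ at j contribute 1/2 each.\<close>
    have "ennreal (2 ^ (m - 1) * (1/2)) = (\<Sum>\<theta>\<in>Pow (?J - {j}). ennreal (1/2))"
    proof -
      have "card (Pow (?J - {j})) = 2 ^ (m - 1)" using j by (simp add: card_Pow m_def)
      then have "(\<Sum>\<theta>\<in>Pow (?J - {j}). ennreal (1/2)) = of_nat (2 ^ (m - 1)) * ennreal (1/2)" by (simp only: sum_constant)
      also have "of_nat (2 ^ (m - 1)) = ennreal (2 ^ (m - 1))" by (subst ennreal_of_nat_eq_real_of_nat) simp
      also have "\<dots> * ennreal (1/2) = ennreal (2 ^ (m - 1) * (1/2))" by (subst ennreal_mult) auto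
      finally show ?thesis by (rule sym)
    qed
    also have "\<dots> \<le> (\<Sum>\<theta>\<in>Pow (?J - {j}). r \<theta> j + r (insert j \<theta>) j)"
    proof (rule sum_mono)
      fix \<theta> assume "\<theta> \<in> Pow (?J - {j})"
      then have "insert j \<theta> \<subseteq> ?J" "j \<notin> \<theta>" using j by auto
      from law_test[OF this(1) A \<epsilon> near_id_sets[OF small j] cond] this(2)
      show "ennreal (1/2) \<le> r \<theta> j + r (insert j \<theta>) j" by (simp add: r_def wrong_def)
    qed
    also have "\<dots> = (\<Sum>\<theta>\<in>Pow ?J. r \<theta> j)" using j by (intro sum_Pow_split[symmetric]) auto
    finally show ?thesis .
  qed
  have "ennreal (2 ^ m * (real m * s / 4)) = (\<Sum>j\<in>?J. ennreal s * ennreal (2 ^ (m - 1) * (1/2)))"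
  proof -
    have "(2::real) ^ m = 2 * 2 ^ (m - 1)" using m0 by (cases m) auto
    then show ?thesis
      using s0 by (simp add: ennreal_mult[symmetric] m_def[symmetric] ennreal_of_nat_eq_real_of_nat)
  qed
  also have "\<dots> \<le> (\<Sum>j\<in>?J. ennreal s * (\<Sum>\<theta>\<in>Pow ?J. r \<theta> j))"
    using r by (intro sum_mono mult_left_mono) auto
  also have "\<dots> = (\<Sum>\<theta>\<in>Pow ?J. \<Sum>j\<in>?J. ennreal s * r \<theta> j)"
    unfolding sum_distrib_left by (rule sum.swap)
  also have "\<dots> \<le> (\<Sum>\<theta>\<in>Pow ?J. X)"
  proof (rule sum_mono)
    fix \<theta> assume "\<theta> \<in> Pow ?J"
    then have \<theta>: "\<theta> \<subseteq> ?J" by simp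
    show "(\<Sum>j\<in>?J. ennreal s * r \<theta> j) \<le> X"
      using order_trans[OF risk_ge_sum[OF \<theta> A] X[OF \<theta>]] by (simp add: r_def s_def)
  qed
  also have "\<dots> = ennreal (2 ^ m) * X"
    by (simp add: card_Pow m_def[symmetric] ennreal_power[symmetric])
  finally have "ennreal (2 ^ m) * ennreal (real m * s / 4) \<le> ennreal (2 ^ m) * X"
    using s0 by (subst (asm) ennreal_mult) auto
  then have "ennreal (real m * s / 4) \<le> X"
    by (subst (asm) ennreal_mult_le_mult_iff) (simp_all add: ennreal_eq_0_iff not_le)
  \<comment> \<open>The number k^d of cells cancels the cell volume in \<open>sep\<close>; the
    factors 4, 2 and 4 combine to 32.\<close>
  moreover have "real m * s / 4 = a\<^sup>2 * (\<beta> ^ (2 * CARD('d)) / (32 * 4 ^ CARD('d)))"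
    using k1 by (simp add: s_def sep_def m_def card_cells power_divide power_mult_distrib field_simps)
  ultimately show ?thesis by simp
qed

end

end


subsection \<open>The minimax lower bound\<close>

context bump
begin

lemma tmap_in_smooth_transport_maps:
  fixes \<theta> :: "('d::finite \<Rightarrow> nat) set"
  assumes \<theta>: "\<theta> \<subseteq> cells k" and small: "small TYPE('d)"
    and \<alpha>: "1 < \<alpha>" "nat \<lfloor>\<alpha>\<rfloor> + 2 \<le> K" and M: "2 < M" "a * B ^ CARD('d) \<le> M - 2"
    and R: "holder_norm \<alpha> (\<lambda>x :: real ^ 'd. x) + ennreal (holder_const \<alpha> TYPE('d) * (a * real k powr \<alpha>)) \<le> ennreal R"
  shows "tmap \<theta> \<in> smooth_transport_maps \<alpha> M R (source \<theta>)"
proof -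
  have fin: "finite \<theta>" using \<theta> by (rule finite_subset) simp
  have "measure (pushforward (source \<theta>) (tmap \<theta>)) Omega = 1"
    by (simp add: pushforward_source[OF \<theta> small] measure_def emeasure_uniform_Omega emeasure_lborel_Omega)
  then have "tmap \<theta> \<in> transport_maps M (source \<theta>)"
    by (rule tmap_in_transport_maps[OF fin M(1) small_imp(1)[OF small] M(2)])
  moreover have "times_differentiable (nat \<lfloor>\<alpha>\<rfloor>) (\<lambda>x. tmap \<theta> x $ i)" for i
    unfolding tmap_component
    by (rule times_differentiable_affine_D[of _ 0 "axis i 1" a \<theta> "unit_index i"])
      (use \<alpha>(2) in \<open>auto simp: unit_index_def\<close>)
  moreover have "holder_norm \<alpha> (tmap \<theta>) \<le> ennreal R"
    using holder_norm_tmap_le[OF \<alpha> fin] R by (rule order_trans)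
  ultimately show ?thesis by (simp add: smooth_transport_maps_def)
qed

lemma sup_risk_ge:
  fixes A :: "'d::finite dataset \<Rightarrow> (real ^ 'd \<Rightarrow> real ^ 'd) measure"
  assumes small: "small TYPE('d)"
    and \<alpha>: "1 < \<alpha>" "nat \<lfloor>\<alpha>\<rfloor> + 2 \<le> K" and M: "2 < M" "a * B ^ CARD('d) \<le> M - 2"
    and R: "holder_norm \<alpha> (\<lambda>x :: real ^ 'd. x) + ennreal (holder_const \<alpha> TYPE('d) * (a * real k powr \<alpha>)) \<le> ennreal R"
    and A: "A \<in> private_estimators n \<epsilon>" and \<epsilon>: "0 < \<epsilon>"
    and cond: "real n * chi_bound TYPE('d) \<le> 1/2 \<or> real n * (tv_bound TYPE('d) * \<epsilon>) \<le> 1/2"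
  shows "ennreal (a\<^sup>2 * (\<beta> ^ (2 * CARD('d)) / (32 * 4 ^ CARD('d))))
    \<le> (SUP (P, T\<^sub>0) \<in> (SIGMA P : measure_class M. smooth_transport_maps \<alpha> M R P). risk n A P T\<^sub>0)"
proof (rule assouad_bound[OF small A \<epsilon> cond])
  fix \<theta> :: "('d \<Rightarrow> nat) set" assume \<theta>: "\<theta> \<subseteq> cells k"
  have "(source \<theta>, tmap \<theta>) \<in> (SIGMA P : measure_class M. smooth_transport_maps \<alpha> M R P)"
    using source_in_measure_class[OF \<theta> small M(1)] tmap_in_smooth_transport_maps[OF \<theta> small \<alpha> M R] by simp
  then show "risk n A (source \<theta>) (tmap \<theta>)
    \<le> (SUP (P, T\<^sub>0) \<in> (SIGMA P : measure_class M. smooth_transport_maps \<alpha> M R P). risk n A P T\<^sub>0)"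
    by (rule SUP_upper2) simp
qed

end

text \<open>The scale is y^(1/p) rounded up. As y >= 1, rounding at most doubles it, which costs the
  factor 2^-q.\<close>

lemma scale_exists:
  fixes y p q :: real
  assumes "1 \<le> y" "0 < p" "0 \<le> q"
  shows "\<exists>k :: nat. 1 \<le> k \<and> y \<le> real k powr p \<and> 2 powr (- q) * y powr (- q / p) \<le> real k powr (- q)"
proof -
  define x where "x = y powr (1 / p)"
  define k where "k = nat \<lceil>x\<rceil>"
  have x1: "1 \<le> x" unfolding x_def using assms by (intro ge_one_powr_ge_zero) auto
  have k: "x \<le> real k" "real k \<le> 2 * x" using x1 by (auto simp: k_def) linarith+
  have "1 \<le> k" using x1 k(1) by linarith
  moreover have "y \<le> real k powr p"
  proof -
    have "y = x powr p" using assms by (simp add: x_def powr_powr)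
    also have "\<dots> \<le> real k powr p" using x1 k(1) assms(2) by (intro powr_mono2) auto
    finally show ?thesis .
  qed
  moreover have "2 powr (- q) * y powr (- q / p) \<le> real k powr (- q)"
  proof -
    have "2 powr (- q) * y powr (- q / p) = (2 * x) powr (- q)"
      using x1 by (simp add: powr_mult x_def powr_powr)
    also have "\<dots> \<le> real k powr (- q)" using k x1 assms(3) by (intro powr_mono2') auto
    finally show ?thesis .
  qed
  ultimately show ?thesis by blast
qed

theorem theorem5p1:
  fixes \<alpha> M R :: real
  assumes "\<alpha> > 1" and "M > 2"
    and "ennreal R > holder_norm \<alpha> (\<lambda>x :: real ^ 'd. x)"
  shows "\<exists>c>0. \<exists>n\<^sub>0 :: nat. \<forall>n\<ge>n\<^sub>0. \<forall>\<epsilon>>0. real n * \<epsilon> \<ge> real n\<^sub>0 \<longrightarrow>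
    (INF A \<in> (private_estimators n \<epsilon> :: ('d::finite dataset \<Rightarrow> (real ^ 'd \<Rightarrow> real ^ 'd) measure) set).
       SUP (P, T\<^sub>0) \<in> (SIGMA P : measure_class M. smooth_transport_maps \<alpha> M R P). risk n A P T\<^sub>0)
    \<ge> ennreal (c * max (1 / real n)
        (max (real n powr (- (2 * \<alpha>) / (2 * \<alpha> - 2 + real CARD('d))))
             ((real n * \<epsilon>) powr (- (2 * \<alpha>) / (\<alpha> - 1 + real CARD('d))))))"
proof -
  let ?sup = "\<lambda>n (A :: 'd dataset \<Rightarrow> (real ^ 'd \<Rightarrow> real ^ 'd) measure). SUP (P, T\<^sub>0) \<in> (SIGMA P : measure_class M. smooth_transport_maps \<alpha> M R P). risk n A P T\<^sub>0"
  \<comment> \<open>One derivative for the gradient, \<lfloor>\<alpha>\<rfloor> for the Hoelder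
    norm, one for the Hoelder quotient.\<close>
  define K where "K = nat \<lfloor>\<alpha>\<rfloor> + 2"
  have "\<exists>c B \<beta>. \<forall>k a. 1 \<le> k \<longrightarrow> 0 \<le> a \<longrightarrow> bump c K B \<beta> k a"
  proof (rule bump_exists[of K])
    fix c :: "nat \<Rightarrow> real \<Rightarrow> real" and B \<beta> :: real
    assume *: "\<And>m t. m < K \<Longrightarrow> (c m has_real_derivative c (Suc m) t) (at t)"
      "\<And>m t. m \<le> K \<Longrightarrow> t \<notin> {0<..<1} \<Longrightarrow> c m t = 0" "\<And>m t. m \<le> K \<Longrightarrow> \<bar>c m t\<bar> \<le> B"
      "1 \<le> B" "0 < \<beta>" "\<And>t. t \<in> {1/8..3/8} \<Longrightarrow> \<beta> \<le> c 0 t" "\<And>t. t \<in> {1/8..3/8} \<Longrightarrow> \<beta> \<le> c 1 t"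
    have "2 \<le> K" by (simp add: K_def)
    then show ?thesis
      by (intro exI[of _ c] exI[of _ B] exI[of _ \<beta>] allI impI) (rule bump.intro; (rule *)?; assumption)
  qed
  then obtain c B \<beta> where bump: "\<And>k a. 1 \<le> k \<Longrightarrow> 0 \<le> a \<Longrightarrow> bump c K B \<beta> k a" by blast
  \<comment> \<open>Dummy scale and amplitude: only the facts about \<open>B\<close> and
    \<open>\<beta>\<close> are wanted before the scale is fixed.\<close>
  interpret base: bump c K B \<beta> 1 0 by (rule bump) auto
  define h where "h = enn2real (holder_norm \<alpha> (\<lambda>x :: real ^ 'd. x))"
  have h: "holder_norm \<alpha> (\<lambda>x :: real ^ 'd. x) = ennreal h" "0 \<le> h"
    using assms(3) by (auto simp: h_def ennreal_enn2real_if)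
  have hR: "h < R" using assms(3) h by (simp add: ennreal_less_iff)
  define d where "d = real CARD('d)"
  have d1: "1 \<le> d" by (simp add: d_def Suc_leI)
  define H where "H = bump.holder_const B \<alpha> TYPE('d)"
  have H0: "0 \<le> H"
    using base.B1 unfolding H_def base.holder_const_def by simp
  \<comment> \<open>Chosen so that 2^d times \<open>\<eta>\<close> equals
    \<open>G * (a * real k)\<close>.\<close>
  define G where "G = 2 ^ CARD('d) * (d * B ^ CARD('d))"
  have BB: "1 \<le> B ^ CARD('d)" using base.B1 by simp
  have G0: "0 < G" using d1 BB by (simp add: G_def)
  \<comment> \<open>The three terms are the room left in the Hoelder norm, the room left by M, and
    the smallness of the density perturbation. The 1/4 gives exactly 8 (1/4)^2 = 1/2 and 2 (1/4) =
    1/2 in the two testing conditions.\<close>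
  define c0 where "c0 = min ((R - h) / (H + 1)) (min ((M - 2) / B ^ CARD('d)) (1 / (4 * G)))"
  have c0: "0 < c0" "H * c0 \<le> R - h" "c0 * B ^ CARD('d) \<le> M - 2" "G * c0 \<le> 1/4"
  proof -
    show pos: "0 < c0" using hR H0 BB G0 assms(2) by (simp add: c0_def)
    have "c0 \<le> (R - h) / (H + 1)" by (simp add: c0_def)
    then have "c0 * (H + 1) \<le> R - h" using H0 by (simp add: field_simps)
    then show "H * c0 \<le> R - h" using pos by (simp add: algebra_simps)
    have "c0 \<le> (M - 2) / B ^ CARD('d)" by (simp add: c0_def)
    then show "c0 * B ^ CARD('d) \<le> M - 2" using BB by (simp add: field_simps)
    have "c0 \<le> 1 / (4 * G)" by (simp add: c0_def)
    then show "G * c0 \<le> 1/4" using G0 by (simp add: field_simps)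
  qed
  define c2 where "c2 = \<beta> ^ (2 * CARD('d)) / (32 * 4 ^ CARD('d))"
  have c2: "0 < c2" using base.\<beta>0 by (simp add: c2_def)
  \<comment> \<open>As \<alpha> > 1 and k >= 1, the single constraint on a k^\<alpha> also bounds a
    and a k by \<open>c0\<close>, so every side condition follows from it.\<close>
  have core: "ennreal (a\<^sup>2 * c2) \<le> ?sup n A"
    if k: "1 \<le> k" and a: "0 \<le> a" "a * real k powr \<alpha> \<le> c0"
      and A: "A \<in> private_estimators n \<epsilon>" and \<epsilon>: "0 < \<epsilon>"
      and cond: "real n * (a * real k)\<^sup>2 * real k powr (- d) \<le> c0\<^sup>2 \<or> (real n * \<epsilon>) * (a * real k) * real k powr (- d) \<le> c0"
    for k n :: nat and a \<epsilon> :: real and A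
  proof -
    interpret bump c K B \<beta> k a by (rule bump[OF k a(1)])
    have "a * real k powr 1 \<le> a * real k powr \<alpha>"
      using k a assms(1) by (intro mult_left_mono powr_mono) auto
    then have ak: "a * real k \<le> c0" using a(2) k by simp
    have ak0: "0 \<le> a * real k" using a by simp
    have a_le: "a \<le> c0" using ak k a(1) mult_left_mono[of 1 "real k" a] by simp
    have \<eta>: "2 ^ CARD('d) * \<eta> TYPE('d) = G * (a * real k)"
      by (simp add: \<eta>_def G_def d_def)
    have "G * (a * real k) \<le> G * c0" using ak G0 by (intro mult_left_mono) auto
    then have small: "small TYPE('d)" using c0(4) \<eta> by (simp add: small_def mult.assoc)
    have aM: "a * B ^ CARD('d) \<le> M - 2"
      using mult_right_mono[OF a_le, of "B ^ CARD('d)"] BB c0(3) by linarith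
    have HR: "holder_norm \<alpha> (\<lambda>x :: real ^ 'd. x) + ennreal (holder_const \<alpha> TYPE('d) * (a * real k powr \<alpha>)) \<le> ennreal R"
    proof -
      have "H * (a * real k powr \<alpha>) \<le> H * c0" using a(2) H0 by (intro mult_left_mono)
      then have "h + H * (a * real k powr \<alpha>) \<le> R" using c0(2) by simp
      then show ?thesis
        using h H0 a(1) by (simp add: H_def[symmetric] ennreal_plus[symmetric] ennreal_leI del: ennreal_plus)
    qed
    have pk: "(1 / real k) ^ CARD('d) = real k powr (- d)"
      using k by (simp add: d_def powr_minus powr_realpow power_one_over inverse_eq_divide)
    have "real n * chi_bound TYPE('d) \<le> 1/2 \<or> real n * (tv_bound TYPE('d) * \<epsilon>) \<le> 1/2"
      using cond
    proof
      assume *: "real n * (a * real k)\<^sup>2 * real k powr (- d) \<le> c0\<^sup>2"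
      have "real n * chi_bound TYPE('d) = 8 * G\<^sup>2 * (real n * (a * real k)\<^sup>2 * real k powr (- d))"
        unfolding chi_bound_def \<eta> pk by (simp add: power_mult_distrib)
      also have "\<dots> \<le> 8 * G\<^sup>2 * c0\<^sup>2" using * by (intro mult_left_mono) auto
      also have "\<dots> = 8 * (G * c0)\<^sup>2" by (simp add: power_mult_distrib)
      also have "\<dots> \<le> 8 * (1/4)\<^sup>2" using c0(1,4) G0 by (intro mult_left_mono power_mono) auto
      finally show ?thesis by (simp add: power2_eq_square)
    next
      assume *: "(real n * \<epsilon>) * (a * real k) * real k powr (- d) \<le> c0"
      have "real n * (tv_bound TYPE('d) * \<epsilon>) = 2 * G * ((real n * \<epsilon>) * (a * real k) * real k powr (- d))"
        unfolding tv_bound_def \<eta> pk by simp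
      also have "\<dots> \<le> 2 * G * c0" using * G0 by (intro mult_left_mono) auto
      also have "\<dots> \<le> 1/2" using c0(4) by simp
      finally show ?thesis by simp
    qed
    from sup_risk_ge[OF small assms(1) _ assms(2) aM HR A \<epsilon> this] show ?thesis
      by (simp add: K_def c2_def)
  qed
  \<comment> \<open>The last factor pays for rounding the scale up to an integer.\<close>
  define C where "C = c2 * c0\<^sup>2 * 2 powr (- (2 * \<alpha>))"
  have C: "0 < C" "C \<le> c2 * c0\<^sup>2"
  proof -
    show "0 < C" using c2 c0(1) by (simp add: C_def)
    have "2 powr (- (2 * \<alpha>)) \<le> 2 powr (0 :: real)" using assms(1) by (intro powr_mono) auto
    then show "C \<le> c2 * c0\<^sup>2" using c2 mult_left_mono[of "2 powr (- (2 * \<alpha>))" 1 "c2 * c0\<^sup>2"] by (simp add: C_def)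
  qed
  have scaled: "ennreal (C * y powr (- (2 * \<alpha>) / p)) \<le> ?sup n A"
    if y: "1 \<le> y" and A: "A \<in> private_estimators n \<epsilon>"
      and \<epsilon>: "0 < \<epsilon>" and p: "(y = real n \<and> p = 2 * \<alpha> - 2 + d) \<or> (y = real n * \<epsilon> \<and> p = \<alpha> - 1 + d)"
    for y p n \<epsilon> A
  proof -
    have p0: "0 < p" using p assms(1) d1 by auto
    obtain k :: nat where k: "1 \<le> k" "y \<le> real k powr p" "2 powr (- (2 * \<alpha>)) * y powr (- (2 * \<alpha>) / p) \<le> real k powr (- (2 * \<alpha>))"
      using scale_exists[OF y p0, of "2 * \<alpha>"] assms(1) by auto
    \<comment> \<open>The largest amplitude that the Hoelder bound permits. It turns both testing
      conditions into y k^-p <= 1, which is how the scale was chosen.\<close>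
    define a where "a = c0 * real k powr (- \<alpha>)"
    have kp: "0 < real k" using k(1) by simp
    have a2: "a\<^sup>2 = c0\<^sup>2 * real k powr (- (2 * \<alpha>))"
      by (simp add: a_def power_mult_distrib power2_eq_square powr_add[symmetric])
    have ak: "a * real k = c0 * real k powr (1 - \<alpha>)"
      using kp powr_add[of "real k" "- \<alpha>" 1] by (simp add: a_def)
    have le: "y * real k powr (- p) \<le> 1"
      using k(2) kp by (simp add: powr_minus divide_simps)
    have cond: "real n * (a * real k)\<^sup>2 * real k powr (- d) \<le> c0\<^sup>2 \<or> (real n * \<epsilon>) * (a * real k) * real k powr (- d) \<le> c0"
      using p
    proof
      assume p: "y = real n \<and> p = 2 * \<alpha> - 2 + d"
      have "real n * (a * real k)\<^sup>2 * real k powr (- d) = c0\<^sup>2 * (y * (real k powr (1 - \<alpha>) * real k powr (1 - \<alpha>) * real k powr (- d)))"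
        unfolding ak using p by (simp add: power_mult_distrib power2_eq_square)
      also have "real k powr (1 - \<alpha>) * real k powr (1 - \<alpha>) * real k powr (- d) = real k powr (- p)"
        using p by (simp add: powr_add[symmetric])
      also have "c0\<^sup>2 * (y * real k powr (- p)) \<le> c0\<^sup>2" using mult_left_mono[OF le, of "c0\<^sup>2"] by simp
      finally show ?thesis by simp
    next
      assume p: "y = real n * \<epsilon> \<and> p = \<alpha> - 1 + d"
      have "(real n * \<epsilon>) * (a * real k) * real k powr (- d) = c0 * (y * (real k powr (1 - \<alpha>) * real k powr (- d)))"
        unfolding ak using p by simp
      also have "real k powr (1 - \<alpha>) * real k powr (- d) = real k powr (- p)"
        using p by (simp add: powr_add[symmetric])
      also have "c0 * (y * real k powr (- p)) \<le> c0" using mult_left_mono[OF le, of c0] c0(1) by simp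
      finally show ?thesis by simp
    qed
    have "a * real k powr \<alpha> \<le> c0" using kp by (simp add: a_def powr_minus_divide)
    from core[OF k(1) _ this A \<epsilon> cond]
    have "ennreal (a\<^sup>2 * c2) \<le> ?sup n A"
      using c0(1) by (simp add: a_def)
    moreover have "C * y powr (- (2 * \<alpha>) / p) \<le> a\<^sup>2 * c2"
      using mult_left_mono[OF k(3), of "c2 * c0\<^sup>2"] c2 by (simp add: C_def a2 ac_simps)
    ultimately show ?thesis using ennreal_leI order_trans by blast
  qed
  have single: "ennreal (C * (1 / real n)) \<le> ?sup n A"
    if n: "1 \<le> n" and A: "A \<in> private_estimators n \<epsilon>"
      and \<epsilon>: "0 < \<epsilon>" for n \<epsilon> A
  proof -
    \<comment> \<open>A single cell, k = 1, with n a^2 equal to \<open>c0\<close> squared: the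
      parametric rate.\<close>
    define a where "a = c0 / sqrt (real n)"
    have a2: "a\<^sup>2 = c0\<^sup>2 / real n" by (simp add: a_def power_divide)
    have "a * real 1 powr \<alpha> \<le> c0"
      using n c0(1) by (simp add: a_def divide_le_eq)
    moreover have "real n * (a * real 1)\<^sup>2 * real 1 powr (- d) \<le> c0\<^sup>2" using n by (simp add: a2)
    ultimately have "ennreal (a\<^sup>2 * c2) \<le> ?sup n A"
      using core[of 1 a A n \<epsilon>] A \<epsilon> c0(1) by (simp add: a_def)
    moreover have "C * (1 / real n) \<le> a\<^sup>2 * c2"
      using C(2) by (simp add: a2 divide_right_mono mult.commute)
    ultimately show ?thesis using ennreal_leI order_trans by blast
  qed
  show ?thesis
  proof (intro exI[of _ C] conjI C(1) exI[of _ "1 :: nat"] allI impI INF_greatest)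
    fix n :: nat and \<epsilon> :: real and A :: "'d dataset \<Rightarrow> (real ^ 'd \<Rightarrow> real ^ 'd) measure"
    assume n: "1 \<le> n" and \<epsilon>: "0 < \<epsilon>" and n\<epsilon>: "real 1 \<le> real n * \<epsilon>" and A: "A \<in> private_estimators n \<epsilon>"
    have "1 \<le> real n" "1 \<le> real n * \<epsilon>" using n n\<epsilon> by auto
    from single[OF n A \<epsilon>] scaled[OF this(1) A \<epsilon>, of "2 * \<alpha> - 2 + d"] scaled[OF this(2) A \<epsilon>, of "\<alpha> - 1 + d"]
    show "ennreal (C * max (1 / real n)
        (max (real n powr (- (2 * \<alpha>) / (2 * \<alpha> - 2 + real CARD('d))))
             ((real n * \<epsilon>) powr (- (2 * \<alpha>) / (\<alpha> - 1 + real CARD('d))))))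
      \<le> ?sup n A"
      unfolding max_def d_def by simp
  qed
qed

end
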